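(* Let $N\ge 2$ be an integer, $\kappa_N=(-1)^{N-1}$, let $a<b$ be real numbers and $x\in(a,b)$. Let $(X_t)_{t\ge0}$ be the pseudo-process driven by $\partial/\partial t=\kappa_N\,\partial^{2N}/\partial x^{2N}$ and let $\tau_{ab}=\inf\{t\ge0:X_t\notin(a,b)\}$ (see the context). Assume the following heuristic: for any $\lambda\ge0$ and any $(N-1)$ times differentiable bounded function $\varphi$, the Feynman-Kac functional $\Phi(x)=\mathbb{E}_x\big(\mathrm{e}^{-\lambda\tau_{ab}}\varphi(X_{\tau_{ab}})\mathbf{1}_{\{\tau_{ab}<+\infty\}}\big)$ solves the boundary value problem $\kappa_N\Phi^{(2N)}(x)=\lambda\,\Phi(x)$ for $x\in(a,b)$, $\Phi^{(k)}(a)=\varphi^{(k)}(a)$ and $\Phi^{(k)}(b)=\varphi^{(k)}(b)$ for $k\in\{0,1,\dots,N-1\}$. Then the joint pseudo-distribution of $(\tau_{ab},X_{\tau_{ab}})$ admits, in the sense of Schwartz distributions, the representation $$\mathbb{P}_x\{\tau_{ab}\in\mathrm{d}t,X_{\tau_{ab}}\in\mathrm{d}z\}/\mathrm{d}t\,\mathrm{d}z=\sum_{k=0}^{N-1}(-1)^kI_k^-(t;x)\,\delta_a^{(k)}(z)+\sum_{k=0}^{N-1}(-1)^kI_k^+(t;x)\,\delta_b^{(k)}(z),$$ where the functions $I_k^\pm(t;x)$, $0\le k\le N-1$, are characterized by their Laplace transforms $$\int_0^\infty I_k^\pm(t;x)\,\mathrm{e}^{-\lambda t}\,\mathrm{d}t=\lambda^{-\frac{k}{2N}}\frac{\Delta_k^\pm(\lambda;x)}{\Delta(\lambda)},$$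 with the determinants $\Delta$, $\Delta_k^\pm$ defined in the context. They are also characterized by the boundary value problems $$\frac{\partial I_k^-}{\partial t}(t;x)=\kappa_N\frac{\partial^{2N}I_k^-}{\partial x^{2N}}(t;x),\qquad \frac{\partial^\ell I_k^-}{\partial x^\ell}(t;a)=\delta_{k\ell},\quad \frac{\partial^\ell I_k^-}{\partial x^\ell}(t;b)=0\quad\text{for }\ell\in\{0,1,\dots,N-1\},$$ $$\frac{\partial I_k^+}{\partial t}(t;x)=\kappa_N\frac{\partial^{2N}I_k^+}{\partial x^{2N}}(t;x),\qquad \frac{\partial^\ell I_k^+}{\partial x^\ell}(t;a)=0,\quad \frac{\partial^\ell I_k^+}{\partial x^\ell}(t;b)=\delta_{k\ell}\quad\text{for }\ell\in\{0,1,\dots,N-1\}.$$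
   Context: Pseudo-process. For $t>0$, $p(t;\cdot)$ is the (signed) kernel with $\int_{-\infty}^{+\infty}\mathrm{e}^{\mathrm{i}ux}p(t;x)\,\mathrm{d}x=\mathrm{e}^{-tu^{2N}}$, and $p(t;x,y)=p(t;x-y)$. The pseudo-process $(X_t)_{t\ge0}$ started at $x$ has the signed finite-dimensional distributions $\mathbb{P}_x\{X_{t_1}\in\mathrm{d}x_1,\dots,X_{t_n}\in\mathrm{d}x_n\}=\prod_{k=1}^n p(t_k-t_{k-1};x_{k-1},x_k)\,\mathrm{d}x_1\cdots\mathrm{d}x_n$ for $0=t_0<t_1<\dots<t_n$, $x_0=x$; $\mathbb{E}_x$ is the corresponding pseudo-expectation. Feynman-Kac functional. Set $\tau_{ab,n}=2^{-n}\min\{k\in\mathbb{N}:X_{k/2^n}\notin(a,b)\}$ and, for $x\in(a,b)$, $\Phi_n(x)=\mathbb{E}_x\big(\mathrm{e}^{-\lambda\tau_{ab,n}}\varphi(X_{\tau_{ab,n}})\mathbf{1}_{\{\tau_{ab,n}<+\infty\}}\big)$. By definition, $\mathbb{E}_x\big(\mathrm{e}^{-\lambda\tau_{ab}}\varphi(X_{\tau_{ab}})\mathbf{1}_{\{\tau_{ab}<+\infty\}}\big)=\Phi(x)=\lim_{n\to+\infty}\Phi_n(x)$. Distributions. $\delta_a^{(k)}$ acts on test functions by $\langle\delta_a^{(k)},\varphi\rangle=(-1)^k\varphi^{(k)}(a)$, and similarly for $\delta_b^{(k)}$. $\delta_{k\ell}$ is the Kronecker symbol. Determinants. $\theta_\ell=\mathrm{e}^{\mathrm{i}\frac{2\ell+N-1}{2N}\pi}$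 for $1\le\ell\le2N$ (the $2N$-th roots of $\kappa_N$), and $e_\lambda^z=\mathrm{e}^{\lambda^{1/(2N)}z}$ for $z\in\mathbb{C}$. $\Delta(\lambda)$ is the determinant of the $2N\times2N$ matrix whose $(j+1)$-th row is $(\theta_\ell^j e_\lambda^{\theta_\ell a})_{1\le\ell\le2N}$ and whose $(N+j+1)$-th row is $(\theta_\ell^j e_\lambda^{\theta_\ell b})_{1\le\ell\le2N}$, for $0\le j\le N-1$. For $0\le k\le N-1$, $\Delta_k^-(\lambda;x)$ (resp. $\Delta_k^+(\lambda;x)$) is the determinant of the matrix obtained from that one by replacing its $(k+1)$-th row (resp. its $(N+k+1)$-th row) by $(e_\lambda^{\theta_\ell x})_{1\le\ell\le2N}$.
   Formalization: In the last boundary value problems the values δ_{kℓ} and 0 are read as Laplace transforms in time of the traces (Dirac mass at t=0), since constant traces contradict the Laplace formulas; zero initial value and a regularity and growth class are added for uniqueness. *)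

theory Defs
  imports "HOL-Probability.Probability" "Jordan_Normal_Form.Determinant"
begin

section \<open>The pseudo-process\<close>

definition kappa :: "nat \<Rightarrow> real" where
  "kappa N = (-1) ^ (N - 1)"

text \<open>The Fourier condition determines \<open>p t\<close> up to a null set; \<open>p\<close> is only used under integrals.\<close>

definition pseudo_kernel :: "nat \<Rightarrow> (real \<Rightarrow> real \<Rightarrow> real) \<Rightarrow> bool" where
  "pseudo_kernel N p \<longleftrightarrow>
     (\<forall>t>0. integrable lborel (p t) \<and>
       (\<forall>u::real. (CLINT x|lborel. exp (\<i> * of_real (u * x)) * of_real (p t x))
                   = of_real (exp (- t * u ^ (2 * N)))))"

text \<open>
  Pseudo-expectation, for the process started at \<open>x\<close>, of a functional \<open>F\<close> of the positions
  \<open>w 0 = x, w 1, \<dots>, w n\<close> at the times \<open>0 = t 0 < t 1 < \<dots> < t n\<close>.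
\<close>

definition pseudo_E ::
    "(real \<Rightarrow> real \<Rightarrow> real) \<Rightarrow> real \<Rightarrow> (nat \<Rightarrow> real) \<Rightarrow> nat \<Rightarrow> ((nat \<Rightarrow> real) \<Rightarrow> real) \<Rightarrow> real" where
  "pseudo_E p x t n F =
     (LINT y | PiM {1..n} (\<lambda>_. lborel).
        (let w = y(0 := x)
         in F w * (\<Prod>k = 1..n. p (t k - t (k - 1)) (w (k - 1) - w k))))"

section \<open>The Feynman-Kac functional\<close>

text \<open>\<open>first_exit a b k w\<close>: \<open>k\<close> is the least index with \<open>w k\<close> outside \<open>(a, b)\<close>.\<close>

definition first_exit :: "real \<Rightarrow> real \<Rightarrow> nat \<Rightarrow> (nat \<Rightarrow> real) \<Rightarrow> bool" where
  "first_exit a b k w \<longleftrightarrow> (\<forall>j<k. w j \<in> {a<..<b}) \<and> w k \<notin> {a<..<b}"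

text \<open>
  \<open>FK_n\<close> is the pseudo-expectation of \<open>exp (- lam * \<tau>) * \<phi> (X \<tau>)\<close> on \<open>\<tau> < \<infinity>\<close>, where \<open>\<tau>\<close> is the first
  exit time along the grid of mesh \<open>2 ^ (-n)\<close>. It is the series over the events \<open>\<tau> = k / 2 ^ n\<close>,
  each of which depends on finitely many positions only.
\<close>

definition FK_n ::
    "(real \<Rightarrow> real \<Rightarrow> real) \<Rightarrow> real \<Rightarrow> real \<Rightarrow> real \<Rightarrow> (real \<Rightarrow> real) \<Rightarrow> nat \<Rightarrow> real \<Rightarrow> real" where
  "FK_n p a b lam \<phi> n x =
     (\<Sum>k. pseudo_E p x (\<lambda>j. real j / 2 ^ n) k
        (\<lambda>w. if first_exit a b k w then exp (- lam * (real k / 2 ^ n)) * \<phi> (w k) else 0))"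

definition FK ::
    "(real \<Rightarrow> real \<Rightarrow> real) \<Rightarrow> real \<Rightarrow> real \<Rightarrow> real \<Rightarrow> (real \<Rightarrow> real) \<Rightarrow> real \<Rightarrow> real" where
  "FK p a b lam \<phi> x = lim (\<lambda>n. FK_n p a b lam \<phi> n x)"

definition times_differentiable_on :: "nat \<Rightarrow> (real \<Rightarrow> real) \<Rightarrow> real set \<Rightarrow> bool" where
  "times_differentiable_on m f S \<longleftrightarrow> (\<forall>j<m. \<forall>y\<in>S. (deriv ^^ j) f differentiable (at y))"

definition admissible :: "nat \<Rightarrow> (real \<Rightarrow> real) \<Rightarrow> bool" where
  "admissible N \<phi> \<longleftrightarrow> bounded (range \<phi>) \<and> times_differentiable_on (N - 1) \<phi> UNIV"

definition solves_exit_bvp ::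
    "nat \<Rightarrow> real \<Rightarrow> real \<Rightarrow> real \<Rightarrow> (real \<Rightarrow> real) \<Rightarrow> (real \<Rightarrow> real) \<Rightarrow> bool" where
  "solves_exit_bvp N a b lam \<phi> \<Phi> \<longleftrightarrow>
     times_differentiable_on (2 * N) \<Phi> {a<..<b} \<and>
     (\<forall>y\<in>{a<..<b}. kappa N * (deriv ^^ (2 * N)) \<Phi> y = lam * \<Phi> y) \<and>
     (\<forall>k<N. ((deriv ^^ k) \<Phi> \<longlongrightarrow> (deriv ^^ k) \<phi> a) (at_right a) \<and>
            ((deriv ^^ k) \<Phi> \<longlongrightarrow> (deriv ^^ k) \<phi> b) (at_left b))"

definition feynman_kac_heuristic ::
    "nat \<Rightarrow> (real \<Rightarrow> real \<Rightarrow> real) \<Rightarrow> real \<Rightarrow> real \<Rightarrow> bool" where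
  "feynman_kac_heuristic N p a b \<longleftrightarrow>
     (\<forall>lam \<phi>. lam \<ge> 0 \<and> admissible N \<phi> \<longrightarrow>
        (\<forall>y\<in>{a<..<b}. convergent (\<lambda>n. FK_n p a b lam \<phi> n y)) \<and>
        solves_exit_bvp N a b lam \<phi> (FK p a b lam \<phi>))"

section \<open>Joint law as a distribution\<close>

definition dirac_deriv :: "nat \<Rightarrow> real \<Rightarrow> (real \<Rightarrow> real) \<Rightarrow> real" where
  "dirac_deriv k c \<phi> = (-1) ^ k * (deriv ^^ k) \<phi> c"

text \<open>
  \<open>D t\<close> is a distribution in the space variable. It is the density in \<open>t\<close> of the joint pseudo-law of
  exit time and exit position, for the start \<open>x\<close>, if the pairing with \<open>exp (- lam * t) * \<phi> z\<close> gives
  the Feynman-Kac functional. All distributions used have order below \<open>N\<close>, so they act on every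
  admissible \<open>\<phi>\<close>, in particular on the smooth compactly supported ones.
\<close>

definition joint_exit_law ::
    "nat \<Rightarrow> (real \<Rightarrow> real \<Rightarrow> real) \<Rightarrow> real \<Rightarrow> real \<Rightarrow> real \<Rightarrow> (real \<Rightarrow> (real \<Rightarrow> real) \<Rightarrow> real) \<Rightarrow> bool" where
  "joint_exit_law N p a b x D \<longleftrightarrow>
     (\<forall>lam>0. \<forall>\<phi>. admissible N \<phi> \<longrightarrow>
        set_integrable lborel {0<..} (\<lambda>t. exp (- lam * t) * D t \<phi>) \<and>
        (LINT t:{0<..}|lborel. exp (- lam * t) * D t \<phi>) = FK p a b lam \<phi> x)"

section \<open>Determinants\<close>

definition theta :: "nat \<Rightarrow> nat \<Rightarrow> complex" where
  "theta N l = exp (\<i> * of_real ((2 * real l + real N - 1) / (2 * real N) * pi))"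

definition e_pow :: "nat \<Rightarrow> real \<Rightarrow> complex \<Rightarrow> complex" where
  "e_pow N lam z = exp (of_real (lam powr (1 / (2 * real N))) * z)"

text \<open>Rows and columns are counted from 0 below; column \<open>j\<close> belongs to \<open>theta N (j + 1)\<close>.\<close>

definition Delta_entry :: "nat \<Rightarrow> real \<Rightarrow> real \<Rightarrow> real \<Rightarrow> nat \<times> nat \<Rightarrow> complex" where
  "Delta_entry N a b lam = (\<lambda>(i, j).
     if i < N then theta N (j + 1) ^ i * e_pow N lam (theta N (j + 1) * of_real a)
     else theta N (j + 1) ^ (i - N) * e_pow N lam (theta N (j + 1) * of_real b))"

definition Delta :: "nat \<Rightarrow> real \<Rightarrow> real \<Rightarrow> real \<Rightarrow> complex" where
  "Delta N a b lam = Determinant.det (Matrix.mat (2 * N) (2 * N) (Delta_entry N a b lam))"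

definition Delta_row :: "nat \<Rightarrow> nat \<Rightarrow> real \<Rightarrow> real \<Rightarrow> real \<Rightarrow> real \<Rightarrow> complex" where
  "Delta_row r N a b lam x = Determinant.det (Matrix.mat (2 * N) (2 * N)
     (\<lambda>(i, j). if i = r then e_pow N lam (theta N (j + 1) * of_real x)
               else Delta_entry N a b lam (i, j)))"

definition Delta_minus :: "nat \<Rightarrow> nat \<Rightarrow> real \<Rightarrow> real \<Rightarrow> real \<Rightarrow> real \<Rightarrow> complex" where
  "Delta_minus k N a b lam x = Delta_row k N a b lam x"

definition Delta_plus :: "nat \<Rightarrow> nat \<Rightarrow> real \<Rightarrow> real \<Rightarrow> real \<Rightarrow> real \<Rightarrow> complex" where
  "Delta_plus k N a b lam x = Delta_row (N + k) N a b lam x"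

section \<open>The two characterizations\<close>

definition has_laplace_transform :: "(real \<Rightarrow> real) \<Rightarrow> (real \<Rightarrow> complex) \<Rightarrow> bool" where
  "has_laplace_transform f F \<longleftrightarrow>
     (\<forall>lam>0. set_integrable lborel {0<..} (\<lambda>t. f t * exp (- lam * t)) \<and>
        complex_of_real (LINT t:{0<..}|lborel. f t * exp (- lam * t)) = F lam)"

text \<open>
  The space derivatives exist, are jointly continuous, and grow subexponentially in time, locally
  uniformly on \<open>(a, b)\<close>. Bounds near \<open>a\<close> and \<open>b\<close> cannot be required because of the singular
  boundary data of \<open>solves_evolution_bvp\<close>.
\<close>

definition regular_on_strip :: "nat \<Rightarrow> real \<Rightarrow> real \<Rightarrow> (real \<Rightarrow> real \<Rightarrow> real) \<Rightarrow> bool" where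
  "regular_on_strip m a b u \<longleftrightarrow>
     (\<forall>t>0. times_differentiable_on m (u t) {a<..<b}) \<and>
     (\<forall>j\<le>m. continuous_on ({0<..} \<times> {a<..<b}) (\<lambda>(t, y). (deriv ^^ j) (u t) y)) \<and>
     (\<forall>j\<le>m. \<forall>\<epsilon>>0. \<forall>c d. a < c \<and> d < b \<longrightarrow>
        (\<exists>M. \<forall>t>0. \<forall>y\<in>{c..d}. \<bar>(deriv ^^ j) (u t) y\<bar> \<le> M * exp (\<epsilon> * t)))"

text \<open>
  Evolution problem on \<open>(0, \<infinity>) \<times> (a, b)\<close> with zero initial value. The boundary conditions are meant
  in the sense of distributions in time: the trace of the \<open>l\<close>-th space derivative at \<open>a\<close> is \<open>\<alpha> l\<close>
  times the Dirac mass at time 0, and \<open>\<alpha> l\<close> is the Laplace transform of that distribution;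
  likewise for \<open>\<beta> l\<close> at \<open>b\<close>. A density of an exit law has no other boundary values: at fixed \<open>t > 0\<close>
  all these traces vanish.
\<close>

definition solves_evolution_bvp ::
    "nat \<Rightarrow> real \<Rightarrow> real \<Rightarrow> (nat \<Rightarrow> real) \<Rightarrow> (nat \<Rightarrow> real) \<Rightarrow> (real \<Rightarrow> real \<Rightarrow> real) \<Rightarrow> bool" where
  "solves_evolution_bvp N a b \<alpha> \<beta> u \<longleftrightarrow>
     regular_on_strip (2 * N) a b u \<and>
     (\<forall>t>0. \<forall>y\<in>{a<..<b}.
        ((\<lambda>s. u s y) has_real_derivative kappa N * (deriv ^^ (2 * N)) (u t) y) (at t)) \<and>
     (\<forall>y\<in>{a<..<b}. ((\<lambda>t. u t y) \<longlongrightarrow> 0) (at_right 0)) \<and>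
     (\<forall>l<N. \<forall>lam>0.
        ((\<lambda>y. LINT t:{0<..}|lborel. exp (- lam * t) * (deriv ^^ l) (u t) y) \<longlongrightarrow> \<alpha> l) (at_right a) \<and>
        ((\<lambda>y. LINT t:{0<..}|lborel. exp (- lam * t) * (deriv ^^ l) (u t) y) \<longlongrightarrow> \<beta> l) (at_left b))"

definition kronecker :: "nat \<Rightarrow> nat \<Rightarrow> real" where
  "kronecker k l = (if k = l then 1 else 0)"

definition characterized_by_laplace :: "(real \<Rightarrow> real) \<Rightarrow> (real \<Rightarrow> complex) \<Rightarrow> bool" where
  "characterized_by_laplace f F \<longleftrightarrow>
     continuous_on {0<..} f \<and> has_laplace_transform f F \<and>
     (\<forall>g. continuous_on {0<..} g \<and> has_laplace_transform g F \<longrightarrow> (\<forall>t>0. g t = f t))"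

definition characterized_by_bvp ::
    "nat \<Rightarrow> real \<Rightarrow> real \<Rightarrow> (nat \<Rightarrow> real) \<Rightarrow> (nat \<Rightarrow> real) \<Rightarrow> (real \<Rightarrow> real \<Rightarrow> real) \<Rightarrow> bool" where
  "characterized_by_bvp N a b \<alpha> \<beta> u \<longleftrightarrow>
     solves_evolution_bvp N a b \<alpha> \<beta> u \<and>
     (\<forall>v. solves_evolution_bvp N a b \<alpha> \<beta> v \<longrightarrow> (\<forall>t>0. \<forall>y\<in>{a<..<b}. v t y = u t y))"

end

theory Submission
  imports Defs "HOL-Complex_Analysis.Complex_Analysis"
begin

text \<open>
  Write \<open>\<kappa>\<close> for \<open>kappa N\<close>. The heuristic reduces the Feynman-Kac functional to the problem
  \<open>\<kappa> \<Phi>\<^sup>(\<^sup>2\<^sup>N\<^sup>) = \<lambda> \<Phi>\<close> on \<open>(a, b)\<close> with the first \<open>N\<close> derivatives prescribed at both ends. For \<open>Re \<lambda> > 0\<close>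
  this problem has at most one solution, by an energy argument (\<open>exit_bvp_unique\<close>). Hence \<open>\<Phi>\<close> is the
  combination, with the boundary data of \<open>\<phi>\<close> as coefficients, of the \<open>2N\<close> solutions whose boundary data
  are unit vectors. Cramer's rule in the basis of exponentials gives these as
  \<open>\<lambda>\<^sup>-\<^sup>k\<^sup>/\<^sup>2\<^sup>N \<Delta>\<^sub>k / \<Delta>\<close> (\<open>Delta_ratio\<close>), and \<open>\<Delta> \<noteq> 0\<close> is uniqueness once more.

  The analytic part is that every such quotient is the Laplace transform of a function of time. It
  continues to a holomorphic function of \<open>\<lambda>\<close> on the right half-plane. There \<open>\<lambda>\<close> has a root \<open>\<mu>\<close> of order
  \<open>2N\<close> with argument below \<open>\<pi>/(4N)\<close>, whereas the numbers \<open>\<theta>\<^sub>l\<close> keep an angle of at least \<open>\<pi>/(2N)\<close> from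
  the imaginary axis; so \<open>|Re (\<mu> \<theta>\<^sub>l)| \<ge> c |\<mu>|\<close> with \<open>c > 0\<close>. If every exponential is normalised at the end
  of the interval at which it is largest, then the matrix of the boundary conditions stays bounded, and
  as \<open>\<lambda> \<rightarrow> \<infinity>\<close> it decouples into two Vandermonde blocks, one for each end. Its determinant is
  therefore bounded away from 0 on \<open>Re \<lambda> \<ge> \<gamma>\<close>, and the solutions decay like
  \<open>exp (- c |\<lambda>|\<^sup>1\<^sup>/\<^sup>2\<^sup>N dist (x, {a, b}))\<close> up to powers of \<open>|\<lambda>|\<close> (\<open>sol_decay\<close>).

  With such decay the Bromwich integral over a vertical line converges absolutely, together with all its
  derivatives, and Cauchy's formula on large rectangles shows that it inverts the Laplace transform
  (\<open>laplace_bromwich\<close>). It does not depend on the line. A line close to the imaginary axis gives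
  the growth bound \<open>exp (\<epsilon> t)\<close>, and the line \<open>Re \<lambda> = 1/t\<close> gives the initial value 0.
  Differentiation under the integral turns \<open>\<kappa> \<Phi>\<^sup>(\<^sup>2\<^sup>N\<^sup>) = \<lambda> \<Phi>\<close> into the evolution equation.

  Both characterizations then follow from the injectivity of the Laplace transform
  (\<open>laplace_transform_inject\<close>): the first one directly, the second one because the transform of a solution
  of the evolution problem solves the stationary problem, which has only one solution
  (\<open>evolution_bvp_unique\<close>).
\<close>

section \<open>Towers of derivatives\<close>

text \<open>
  Differentiation under an integral produces a family \<open>f j\<close> in which each member is the derivative
  of the previous one; the following lemmas pass between such families and iterated \<open>deriv\<close>.
\<close>

lemma higher_deriv_eq_tower:
  fixes f :: "nat \<Rightarrow> real \<Rightarrow> real"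
  assumes S: "open S"
    and D: "\<And>j y. j < m \<Longrightarrow> y \<in> S \<Longrightarrow> (f j has_real_derivative f (Suc j) y) (at y)"
  shows "j \<le> m \<Longrightarrow> y \<in> S \<Longrightarrow> (deriv ^^ j) (f 0) y = f j y"
proof (induction j arbitrary: y)
  case (Suc j)
  have ev: "\<forall>\<^sub>F z in nhds y. (deriv ^^ j) (f 0) z = f j z"
    using eventually_nhds_in_open[OF S Suc.prems(2)] by eventually_elim (use Suc in auto)
  have "deriv ((deriv ^^ j) (f 0)) y = deriv (f j) y"
    by (rule deriv_cong_ev[OF ev refl])
  also have "\<dots> = f (Suc j) y"
    using D[of j y] Suc.prems by (auto intro: DERIV_imp_deriv)
  finally show ?case by simp
qed simp

lemma times_differentiable_on_tower:
  fixes f :: "nat \<Rightarrow> real \<Rightarrow> real"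
  assumes S: "open S"
    and D: "\<And>j y. j < m \<Longrightarrow> y \<in> S \<Longrightarrow> (f j has_real_derivative f (Suc j) y) (at y)"
  shows "times_differentiable_on m (f 0) S"
  unfolding times_differentiable_on_def
proof (intro allI impI ballI)
  fix j y assume j: "j < m" and y: "y \<in> S"
  have "((deriv ^^ j) (f 0) has_real_derivative f (Suc j) y) (at y)"
    by (rule has_field_derivative_transform_within_open[OF D[OF j y] S y])
       (use higher_deriv_eq_tower[of S m f, OF S D] j in auto)
  then show "(deriv ^^ j) (f 0) differentiable at y"
    using real_differentiable_def by blast
qed

lemma times_differentiable_on_derivD:
  assumes "times_differentiable_on m f S" "j < m" "y \<in> S"
  shows "((deriv ^^ j) f has_real_derivative (deriv ^^ Suc j) f y) (at y)"
  using assms unfolding times_differentiable_on_def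
  by (simp add: DERIV_deriv_iff_real_differentiable)

section \<open>Uniqueness for the stationary boundary value problem\<close>

text \<open>
  A function with bounded derivative on a bounded convex set is bounded. For a solution of the
  differential equation the highest derivative is a multiple of the function itself, so
  boundedness of the function passes to all its derivatives.
\<close>

lemma bounded_tower_downward:
  fixes f :: "nat \<Rightarrow> real \<Rightarrow> complex"
  assumes S: "convex S" "bounded S"
    and D: "\<And>j y. j < m \<Longrightarrow> y \<in> S \<Longrightarrow> (f j has_vector_derivative f (Suc j) y) (at y)"
    and top: "bounded (f m ` S)" and j: "j \<le> m"
  shows "bounded (f j ` S)"
  using j
proof (induction j rule: inc_induct)
  case base show ?case by (rule top)
next
  case (step n)
  obtain B where B: "\<And>y. y \<in> S \<Longrightarrow> norm (f (Suc n) y) \<le> B"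
    using step.IH unfolding bounded_iff by auto
  obtain R where R: "\<And>y. y \<in> S \<Longrightarrow> norm y \<le> R" using S(2) unfolding bounded_iff by auto
  show ?case
  proof (cases "S = {}")
    case False
    then obtain c where c: "c \<in> S" by auto
    have B0: "B \<ge> 0" using B[OF c] norm_ge_zero order_trans by blast
    have "norm (f n y) \<le> norm (f n c) + B * (2 * R)" if y: "y \<in> S" for y
    proof -
      have "norm (f n y - f n c) \<le> B * norm (y - c)"
      proof (rule differentiable_bound[OF S(1) _ _ y c])
        fix x assume x: "x \<in> S"
        show "(f n has_derivative (\<lambda>h. h *\<^sub>R f (Suc n) x)) (at x within S)"
          using D[OF _ x] step.hyps by (auto simp: has_vector_derivative_def intro:
            has_derivative_at_withinI)
        show "onorm (\<lambda>h. h *\<^sub>R f (Suc n) x) \<le> B"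
          by (rule onorm_le) (use B[OF x] in \<open>auto simp: mult.commute[of B] intro: mult_left_mono\<close>)
      qed
      moreover have "norm (y - c) \<le> 2 * R"
        using R[OF y] R[OF c] norm_triangle_ineq4[of y c] by linarith
      ultimately have "norm (f n y - f n c) \<le> B * (2 * R)"
        using B0 by (meson mult_left_mono order_trans)
      then show ?thesis using norm_triangle_ineq2[of "f n y" "f n c"] by linarith
    qed
    then show ?thesis unfolding bounded_iff by auto
  qed auto
qed

text \<open>
  Energy argument. Put \<open>E = \<Sum>\<^sub>j\<^sub><\<^sub>N (-1)\<^sup>j f\<^sub>2\<^sub>N\<^sub>-\<^sub>1\<^sub>-\<^sub>j cnj f\<^sub>j\<close>, the boundary terms of the \<open>N\<close>-fold integration by
  parts of \<open>\<integral> f\<^sub>2\<^sub>N cnj f\<^sub>0\<close>. Its derivative telescopes, so that \<open>Re (\<kappa> E)\<close> has the derivative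
  \<open>Re \<lambda> |f\<^sub>0|\<^sup>2 + |f\<^sub>N|\<^sup>2 \<ge> 0\<close>. It tends to 0 at both ends because each summand pairs a bounded derivative
  with a derivative of order below \<open>N\<close>, which vanishes at the boundary. A monotone function with these
  limits is 0, hence so is its derivative.
\<close>

lemma exit_bvp_unique:
  fixes f :: "nat \<Rightarrow> real \<Rightarrow> complex" and lam :: complex
  assumes ab: "a < b" and N: "N \<ge> 1" and lam: "Re lam > 0"
    and D: "\<And>j y. j < 2 * N \<Longrightarrow> y \<in> {a<..<b} \<Longrightarrow> (f j has_vector_derivative f (Suc j) y) (at y)"
    and eq: "\<And>y. y \<in> {a<..<b} \<Longrightarrow> of_real (kappa N) * f (2 * N) y = lam * f 0 y"
    and lima: "\<And>l. l < N \<Longrightarrow> (f l \<longlongrightarrow> 0) (at_right a)"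
    and limb: "\<And>l. l < N \<Longrightarrow> (f l \<longlongrightarrow> 0) (at_left b)"
    and x: "x \<in> {a<..<b}"
  shows "f 0 x = 0"
proof -
  have k2: "kappa N * kappa N = 1" unfolding kappa_def by (simp flip: power_add)
  have f2N: "f (2 * N) y = of_real (kappa N) * lam * f 0 y" if "y \<in> {a<..<b}" for y
  proof -
    have "of_real (kappa N) * (of_real (kappa N) * f (2 * N) y) = of_real (kappa N) * (lam * f 0 y)"
      using eq[OF that] by simp
    then show ?thesis using k2 by (simp flip: mult.assoc of_real_mult)
  qed
  have bdd: "bounded (f j ` S)" if S: "S \<subseteq> {a<..<b}" "convex S" "bounded (f 0 ` S)" and j: "j
      \<le> 2 * N" for S j
  proof (rule bounded_tower_downward[OF S(2) _ _ _ j])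
    show "bounded S" by (rule bounded_subset[OF compact_imp_bounded[OF compact_Icc[of a b]]])
      (use S(1) in force)
    show "bounded (f (2 * N) ` S)"
    proof -
      obtain B where B: "\<And>y. y \<in> S \<Longrightarrow> norm (f 0 y) \<le> B" using S(3) unfolding bounded_iff by auto
      have "norm (f (2*N) y) \<le> norm (of_real (kappa N) * lam) * B" if "y \<in> S" for y
      proof -
        have "norm (f (2*N) y) = norm (of_real (kappa N) * lam) * norm (f 0 y)"
          using f2N[of y] that S(1) by (auto simp: norm_mult)
        also have "\<dots> \<le> norm (of_real (kappa N) * lam) * B"
          by (rule mult_left_mono[OF B[OF that]]) simp
        finally show ?thesis .
      qed
      then show ?thesis unfolding bounded_iff by blast
    qed
  qed (use D S in auto)
  define E where "E y = (\<Sum>j<N. (-1) ^ j * f (2 * N - 1 - j) y * cnj (f j y))" for y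
  define h where "h y = kappa N * Re (E y)" for y
  have dE: "(E has_vector_derivative (f (2 * N) y * cnj (f 0 y)
      + of_real (kappa N) * (f N y * cnj (f N y)))) (at y)"
    if y: "y \<in> {a<..<b}" for y
  proof -
    have "(E has_vector_derivative (\<Sum>j<N. (-1) ^ j * (f (2 * N - j) y * cnj (f j y)
        + f (2 * N - 1 - j) y * cnj (f (Suc j) y)))) (at y)"
      unfolding E_def
    proof (rule has_vector_derivative_sum)
      fix j assume j: "j \<in> {..<N}"
      have e: "Suc (2 * N - 1 - j) = 2 * N - j" using j by auto
      have d1: "(f (2 * N - 1 - j) has_vector_derivative f (2 * N - j) y) (at y)"
        using D[of "2 * N - 1 - j" y] y j unfolding e by auto
      have d2: "((\<lambda>y. cnj (f j y)) has_vector_derivative cnj (f (Suc j) y)) (at y)"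
        by (rule bounded_linear.has_vector_derivative[OF bounded_linear_cnj]) (use D[of j y] y j in auto)
      have "((\<lambda>y. (-1) ^ j * (f (2 * N - 1 - j) y * cnj (f j y))) has_vector_derivative
          (-1) ^ j * (f (2 * N - 1 - j) y * cnj (f (Suc j) y) + f (2 * N - j) y * cnj (f j y))) (at y)"
        by (intro has_vector_derivative_mult_right has_vector_derivative_mult d1 d2)
      then show "((\<lambda>y. (-1) ^ j * f (2 * N - 1 - j) y * cnj (f j y)) has_vector_derivative
          (-1) ^ j * (f (2 * N - j) y * cnj (f j y) + f (2 * N - 1 - j) y * cnj (f (Suc j) y))) (at y)"
        by (simp add: algebra_simps)
    qed
    moreover have "(\<Sum>j<N. (-1) ^ j * (f (2 * N - j) y * cnj (f j y)
        + f (2 * N - 1 - j) y * cnj (f (Suc j) y)))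
       = (\<Sum>j<N. (-1) ^ j * f (2 * N - j) y * cnj (f j y) - (-1) ^ Suc j * f (2 * N - Suc j) y
         * cnj (f (Suc j) y))"
      by (intro sum.cong) (auto simp: algebra_simps)
    moreover have "\<dots> = f (2 * N) y * cnj (f 0 y) - (-1) ^ N * f N y * cnj (f N y)"
      by (subst sum_lessThan_telescope') simp
    moreover have "- ((-1) ^ N :: complex) = of_real (kappa N)"
      using N unfolding kappa_def by (cases N) auto
    ultimately show ?thesis
      by (metis (no_types, lifting) diff_conv_add_uminus minus_mult_left mult.assoc)
  qed
  have dh: "(h has_real_derivative (Re lam * (cmod (f 0 y))\<^sup>2 + (cmod (f N y))\<^sup>2)) (at y)"
    if y: "y \<in> {a<..<b}" for y
  proof -
    have "(h has_vector_derivative kappa N * Re (f (2 * N) y * cnj (f 0 y)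
        + of_real (kappa N) * (f N y * cnj (f N y)))) (at y)"
      unfolding h_def
      by (intro has_vector_derivative_mult_right bounded_linear.has_vector_derivative[OF
        bounded_linear_Re] dE y)
    moreover have "kappa N * Re (f (2 * N) y * cnj (f 0 y) + of_real (kappa N) * (f N y * cnj (f N y)))
       = Re lam * (cmod (f 0 y))\<^sup>2 + (cmod (f N y))\<^sup>2"
    proof -
      have "f (2 * N) y * cnj (f 0 y) + of_real (kappa N) * (f N y * cnj (f N y))
         = of_real (kappa N) * (lam * of_real ((cmod (f 0 y))\<^sup>2) + of_real ((cmod (f N y))\<^sup>2))"
        using f2N[OF y] by (simp only: complex_norm_square) (simp add: algebra_simps)
      then have "kappa N * Re (f (2 * N) y * cnj (f 0 y) + of_real (kappa N) * (f N y * cnj (f N y)))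
         = (kappa N * kappa N) * (Re lam * (cmod (f 0 y))\<^sup>2 + (cmod (f N y))\<^sup>2)"
        by (simp add: Re_complex_of_real del: of_real_power)
      then show ?thesis using k2 by simp
    qed
    ultimately show ?thesis by (simp add: has_real_derivative_iff_has_vector_derivative)
  qed
  \<comment> \<open>both ends at once: the second premise says that \<open>F\<close> is concentrated on arbitrarily small convex subsets of \<open>(a, b)\<close>\<close>
  have lim0: "(h \<longlongrightarrow> 0) F"
    if lim: "\<And>l. l < N \<Longrightarrow> (f l \<longlongrightarrow> 0) F"
      and ev: "\<And>P. eventually P F \<Longrightarrow> \<exists>S. S \<subseteq> {a<..<b} \<and> convex S \<and> (\<forall>y\<in>S. P y) \<and> eventually (\<lambda>y. y \<in> S) F"
        for F
  proof -
    have "eventually (\<lambda>y. dist (f 0 y) 0 < 1) F"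
      by (rule tendstoD[OF lim]) (use N in auto)
    then obtain S where S: "S \<subseteq> {a<..<b}" "convex S" "\<forall>y\<in>S. dist (f 0 y) 0 < 1" "eventually (\<lambda>y. y \<in> S) F"
      using ev by blast
    have b0: "bounded (f 0 ` S)" using S(3) unfolding bounded_iff by (auto intro!: exI[of _ 1] less_imp_le)
    have "(E \<longlongrightarrow> (\<Sum>j<N. 0)) F" unfolding E_def
    proof (rule tendsto_sum)
      fix j assume j: "j \<in> {..<N}"
      obtain B where B: "\<And>y. y \<in> S \<Longrightarrow> norm (f (2 * N - 1 - j) y) \<le> B"
        using bdd[OF S(1,2) b0, of "2 * N - 1 - j"] unfolding bounded_iff by auto
      have "eventually (\<lambda>y. norm ((-1) ^ j * f (2 * N - 1 - j) y) \<le> B) F"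
        using S(4) by eventually_elim (use B in \<open>auto simp: norm_mult norm_power\<close>)
      moreover have "((\<lambda>y. cnj (f j y)) \<longlongrightarrow> 0) F"
        using tendsto_cnj[OF lim[of j]] j by simp
      ultimately show "((\<lambda>y. (-1) ^ j * f (2 * N - 1 - j) y * cnj (f j y)) \<longlongrightarrow> 0) F"
        by (rule lim_null_mult_left_bounded)
    qed
    then have "(h \<longlongrightarrow> kappa N * Re (\<Sum>j<N. 0)) F" unfolding h_def by (intro tendsto_intros)
    then show ?thesis by simp
  qed
  have ha: "(h \<longlongrightarrow> 0) (at_right a)"
  proof (rule lim0)
    fix P assume "eventually P (at_right a)"
    then obtain c where c: "c > a" "\<forall>y>a. y < c \<longrightarrow> P y" by (auto simp: eventually_at_right_field)
    show "\<exists>S. S \<subseteq> {a<..<b} \<and> convex S \<and> (\<forall>y\<in>S. P y) \<and> eventually (\<lambda>y. y \<in> S) (at_right a)"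
      by (rule exI[of _ "{a<..<min b c}"])
         (use c ab in \<open>auto simp: eventually_at_right_field intro!: exI[of _ "min b c"]\<close>)
  qed (use lima in auto)
  have hb: "(h \<longlongrightarrow> 0) (at_left b)"
  proof (rule lim0)
    fix P assume "eventually P (at_left b)"
    then obtain c where c: "c < b" "\<forall>y>c. y < b \<longrightarrow> P y" by (auto simp: eventually_at_left_field)
    show "\<exists>S. S \<subseteq> {a<..<b} \<and> convex S \<and> (\<forall>y\<in>S. P y) \<and> eventually (\<lambda>y. y \<in> S) (at_left b)"
      by (rule exI[of _ "{max a c<..<b}"])
         (use c ab in \<open>auto simp: eventually_at_left_field intro!: exI[of _ "max a c"]\<close>)
  qed (use limb in auto)
  have mono: "h y \<le> h z" if "a < y" "y \<le> z" "z < b" for y z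
  proof (rule DERIV_nonneg_imp_nondecreasing[OF that(2)])
    fix t assume "y \<le> t" "t \<le> z"
    then have t: "t \<in> {a<..<b}" using that by auto
    have "0 \<le> Re lam * (cmod (f 0 t))\<^sup>2 + (cmod (f N t))\<^sup>2" using lam by simp
    with dh[OF t] show "\<exists>D. (h has_real_derivative D) (at t) \<and> 0 \<le> D" by blast
  qed
  have zero: "h y = 0" if y: "y \<in> {a<..<b}" for y
  proof (rule antisym)
    show "h y \<le> 0"
      by (rule tendsto_lowerbound[OF hb])
         (use y mono in \<open>auto simp: eventually_at_left_field intro!: exI[of _ y]\<close>)
    show "0 \<le> h y"
      by (rule tendsto_upperbound[OF ha])
         (use y mono in \<open>auto simp: eventually_at_right_field intro!: exI[of _ y]\<close>)
  qed
  have "(h has_real_derivative 0) (at x)"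
    by (rule has_field_derivative_transform_within_open[of "\<lambda>_. 0" _ _ "{a<..<b}"])
       (use x zero in auto)
  then have "Re lam * (cmod (f 0 x))\<^sup>2 + (cmod (f N x))\<^sup>2 = 0"
    using dh[OF x] DERIV_unique by blast
  then have "Re lam * (cmod (f 0 x))\<^sup>2 = 0"
    using lam by (smt (verit) mult_nonneg_nonneg zero_le_power2)
  then show ?thesis using lam by simp
qed

section \<open>Injectivity of the Laplace transform\<close>

text \<open>
  Lerch's theorem. The values of the transform at \<open>c + 1 + n\<close> are the moments of
  \<open>h\<^sub>1 t = exp (- (c + 1) t) h t\<close> against the powers of \<open>s = exp (- t)\<close>. As \<open>s\<close> ranges over \<open>[0, 1]\<close>,
  Weierstrass approximation gives \<open>\<integral> h\<^sub>1 t q (exp (- t)) dt = 0\<close> for every continuous \<open>q\<close>; a tent function \<open>q\<close>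
  around \<open>exp (- t0)\<close> on which \<open>h\<^sub>1\<close> keeps its sign contradicts \<open>h t0 \<noteq> 0\<close>.
\<close>

lemma laplace_transform_eq_0_imp_eq_0:
  fixes h :: "real \<Rightarrow> real"
  assumes cont: "continuous_on {0<..} h"
    and int: "\<And>lam. lam > c \<Longrightarrow> set_integrable lborel {0<..} (\<lambda>t. exp (- lam * t) * h t)"
    and zero: "\<And>lam. lam > c \<Longrightarrow> (LINT t:{0<..}|lborel. exp (- lam * t) * h t) = 0"
    and t0: "t0 > 0"
  shows "h t0 = 0"
proof (rule ccontr)
  assume nz: "h t0 \<noteq> 0"
  define h1 where "h1 t = exp (- (c + 1) * t) * h t" for t
  have h1n: "h1 t * exp (- t) ^ n = exp (- (c + 1 + real n) * t) * h t" for t n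
    proof -
    have "exp (- (c + 1) * t) * exp (- t) ^ n = exp (- (c + 1 + real n) * t)"
      by (simp flip: exp_of_nat_mult exp_add add: algebra_simps)
    then show ?thesis unfolding h1_def by (simp add: mult_ac)
  qed
  have int_n: "set_integrable lborel {0<..} (\<lambda>t. h1 t * exp (- t) ^ n)" for n
    unfolding h1n by (rule int) simp
  have zero_n: "(LINT t:{0<..}|lborel. h1 t * exp (- t) ^ n) = 0" for n
    unfolding h1n by (rule zero) simp
  have int1: "set_integrable lborel {0<..} h1" using int_n[of 0] by simp
  have poly: "set_integrable lborel {0<..} (\<lambda>t. h1 t * (\<Sum>i\<le>n. w i * exp (- t) ^ i))
      \<and> (LINT t:{0<..}|lborel. h1 t * (\<Sum>i\<le>n. w i * exp (- t) ^ i)) = 0" for w :: "nat \<Rightarrow> real" and n :: nat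
  proof -
    have e: "h1 t * (\<Sum>i\<le>n. w i * exp (- t) ^ i) = (\<Sum>i\<le>n. w i * (h1 t * exp (- t) ^ i))" for t
      by (simp add: sum_distrib_left algebra_simps)
    have i: "integrable lborel (\<lambda>t. indicator {0<..} t *\<^sub>R (w i * (h1 t * exp (- t) ^ i)))" for i
    proof -
      have "set_integrable lborel {0<..} (\<lambda>t. w i * (h1 t * exp (- t) ^ i))"
        by (intro set_integrable_mult_right int_n)
      then show ?thesis unfolding set_integrable_def .
    qed
    have z: "(LINT t|lborel. indicator {0<..} t *\<^sub>R (w i * (h1 t * exp (- t) ^ i))) = 0" for i
      using set_integral_mult_right[of lborel "{0<..}" "w i" "\<lambda>t. h1 t * exp (- t) ^ i"] zero_n[of i]
      unfolding set_lebesgue_integral_def by auto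
    show ?thesis
      unfolding e set_integrable_def set_lebesgue_integral_def scaleR_sum_right
      by (rule conjI, rule Bochner_Integration.integrable_sum[OF i],
          subst Bochner_Integration.integral_sum[OF i], rule sum.neutral) (use z in blast)
  qed
  have mes: "set_borel_measurable lborel {0<..} h1"
    using int1 unfolding set_integrable_def set_borel_measurable_def by auto
  have contq: "set_integrable lborel {0<..} (\<lambda>t. h1 t * q (exp (- t)))
      \<and> (LINT t:{0<..}|lborel. h1 t * q (exp (- t)))
        = 0" if q: "continuous_on UNIV q" for q :: "real \<Rightarrow> real"
  proof -
    have "bounded (q ` {0..1})"
      by (intro compact_imp_bounded compact_continuous_image) (use q continuous_on_subset in auto)
    then obtain B where "\<forall>s\<in>q ` {0..1}. norm s \<le> B" unfolding bounded_iff ..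
    then have B: "\<bar>q s\<bar> \<le> B" if "s \<in> {0..1}" for s using that by auto
    have e01: "exp (- t) \<in> {0..1}" if "t > 0" for t :: real using that by auto
    have qm: "q \<in> borel_measurable borel" using q by (rule borel_measurable_continuous_onI)
    have intq: "set_integrable lborel {0<..} (\<lambda>t. h1 t * q (exp (- t)))"
      unfolding set_integrable_def
    proof (rule Bochner_Integration.integrable_bound)
      show "integrable lborel (\<lambda>t. B * (indicator {0<..} t *\<^sub>R h1 t))"
        using int1 unfolding set_integrable_def by auto
      have "(\<lambda>t. indicator {0<..} t *\<^sub>R (h1 t * q (exp (- t))))
          = (\<lambda>t. (indicator {0<..} t *\<^sub>R h1 t) * q (exp (- t)))" by auto
      moreover have "(\<lambda>t. (indicator {0<..} t *\<^sub>R h1 t) * q (exp (- t))) \<in> borel_measurable lborel"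
        by (rule borel_measurable_times, use mes[unfolded set_borel_measurable_def] in simp)
           (use qm in measurable)
      ultimately show "(\<lambda>t. indicator {0<..} t *\<^sub>R (h1 t * q (exp (- t)))) \<in> borel_measurable lborel"
        by simp
      show "AE t in lborel. norm (indicator {0<..} t *\<^sub>R (h1 t * q (exp (- t))))
          \<le> norm (B * (indicator {0<..} t *\<^sub>R h1 t))"
      proof (rule AE_I2)
        fix t :: real
        have "\<bar>h1 t\<bar> * \<bar>q (exp (- t))\<bar> \<le> \<bar>B\<bar> * \<bar>h1 t\<bar>" if "t > 0"
          using mult_mono[OF order_refl[of "\<bar>h1 t\<bar>"] order_trans[OF B[OF e01[OF that]] abs_ge_self]]
          by (simp add: mult.commute)
        then show "norm (indicator {0<..} t *\<^sub>R (h1 t * q (exp (- t))))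
            \<le> norm (B * (indicator {0<..} t *\<^sub>R h1 t))"
          by (auto simp: indicator_def abs_mult)
      qed
    qed
    define A where "A = (LINT t:{0<..}|lborel. \<bar>h1 t\<bar>)"
    have small: "\<bar>LINT t:{0<..}|lborel. h1 t * q (exp (- t))\<bar> \<le> e * A" if e: "e > 0" for e
    proof -
      obtain g where g: "real_polynomial_function g" "\<And>s. s \<in> {0..1} \<Longrightarrow> \<bar>q s - g s\<bar> < e"
        using Stone_Weierstrass_real_polynomial_function[of "{0..1::real}" q e] q e
          continuous_on_subset by (metis compact_Icc subset_UNIV)
      obtain w n where gc: "g = (\<lambda>x. \<Sum>i\<le>n. w i * x ^ i)"
        using g(1) real_polynomial_function_iff_sum by blast
      have ig: "set_integrable lborel {0<..} (\<lambda>t. h1 t * g (exp (- t)))"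
        and zg: "(LINT t:{0<..}|lborel. h1 t * g (exp (- t))) = 0"
        using poly[of w n] unfolding gc by auto
      have "(LINT t:{0<..}|lborel. h1 t * q (exp (- t)))
          = (LINT t:{0<..}|lborel. h1 t * q (exp (- t)) - h1 t * g (exp (- t)))"
        using set_integral_diff(2)[OF intq ig] zg by simp
      also have "\<bar>\<dots>\<bar> \<le> (LINT t:{0<..}|lborel. e * \<bar>h1 t\<bar>)"
        unfolding set_lebesgue_integral_def real_norm_def[symmetric]
      proof (rule Bochner_Integration.integral_norm_bound_integral)
        show "integrable lborel (\<lambda>t. indicator {0<..} t *\<^sub>R (h1 t * q (exp (- t)) - h1 t * g (exp (- t))))"
          using set_integral_diff(1)[OF intq ig] unfolding set_integrable_def .
        show "integrable lborel (\<lambda>t. indicator {0<..} t *\<^sub>R (e * norm (h1 t)))"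
        proof -
          have "set_integrable lborel {0<..} (\<lambda>t. e * norm (h1 t))"
            by (intro set_integrable_mult_right set_integrable_norm int1)
          then show ?thesis unfolding set_integrable_def .
        qed
        fix t :: real
        have "\<bar>h1 t\<bar> * \<bar>q (exp (- t)) - g (exp (- t))\<bar> \<le> e * \<bar>h1 t\<bar>" if "t > 0"
          using mult_left_mono[OF less_imp_le[OF g(2)[OF e01[OF that]]], of "\<bar>h1 t\<bar>"]
            by (simp add: mult.commute)
        then show "norm (indicator {0<..} t *\<^sub>R (h1 t * q (exp (- t)) - h1 t * g (exp (- t))))
            \<le> indicator {0<..} t *\<^sub>R (e * norm (h1 t))"
          by (auto simp: indicator_def abs_mult simp flip: right_diff_distrib)
      qed
      finally show ?thesis unfolding A_def by simp
    qed
    have "(LINT t:{0<..}|lborel. h1 t * q (exp (- t))) = 0"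
    proof (rule ccontr)
      assume nz: "(LINT t:{0<..}|lborel. h1 t * q (exp (- t))) \<noteq> 0" (is "?I \<noteq> 0")
      have A0: "A \<ge> 0" unfolding A_def set_lebesgue_integral_def by (intro integral_nonneg_AE AE_I2) auto
      have "\<bar>?I\<bar> \<le> (\<bar>?I\<bar> / (2 * (A + 1))) * A" by (rule small) (use nz A0 in auto)
      also have "\<dots> \<le> \<bar>?I\<bar> / 2" using A0 by (simp add: field_simps mult_left_mono)
      finally show False using nz by simp
    qed
    with intq show ?thesis by blast
  qed
  have "isCont h t0" using cont t0 continuous_on_eq_continuous_at open_greaterThan by blast
  then have "isCont (\<lambda>t. sgn (h t0) * h1 t) t0" unfolding h1_def by (intro continuous_intros)
  moreover have "sgn (h t0) * h1 t0 > 0"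
    using nz unfolding h1_def by (simp add: sgn_if zero_less_mult_iff mult_less_0_iff)
  ultimately have "\<forall>\<^sub>F t in nhds t0. sgn (h t0) * h1 t > 0"
    by (metis isCont_def order_tendstoD(1) tendsto_at_iff_tendsto_nhds)
  then have "\<forall>\<^sub>F t in nhds t0. sgn (h t0) * h1 t > 0 \<and> t > 0"
    using eventually_nhds_in_open[of "{0<..}" t0] t0 by (auto elim: eventually_elim2)
  then obtain d where d: "d > 0" "\<And>t. \<bar>t - t0\<bar> < d \<Longrightarrow> sgn (h t0) * h1 t > 0 \<and> t > 0"
    unfolding eventually_nhds_metric dist_real_def by blast
  \<comment> \<open>a width such that the tent around \<open>exp (- t0)\<close> lies over the interval on which \<open>h1\<close> keeps its sign\<close>
  define e where "e = min (exp (- t0) - exp (- (t0 + d))) (exp (- (t0 - d)) - exp (- t0))"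
  have e0: "e > 0" unfolding e_def using d(1) by auto
  have e: "\<bar>t - t0\<bar> < d" if t: "\<bar>exp (- t) - exp (- t0)\<bar> < e" for t
  proof -
    have "exp (- (t0 + d)) < exp (- t)" "exp (- t) < exp (- (t0 - d))"
      using t unfolding e_def by linarith+
    then show ?thesis by simp
  qed
  define q where "q s = sgn (h t0) * max 0 (e - \<bar>s - exp (- t0)\<bar>)" for s
  have q: "continuous_on UNIV q" unfolding q_def by (intro continuous_intros)
  let ?F = "\<lambda>t. indicator {0<..} t *\<^sub>R (h1 t * q (exp (- t)))"
  have F0: "?F t \<ge> 0" for t
  proof (cases "\<bar>exp (- t) - exp (- t0)\<bar> < e")
    case True
    then have "sgn (h t0) * h1 t > 0" using d(2)[OF e] by auto
    then have "(sgn (h t0) * h1 t) * max 0 (e - \<bar>exp (- t) - exp (- t0)\<bar>) \<ge> 0" by auto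
    then show ?thesis unfolding q_def by (simp add: indicator_def mult_ac)
  qed (auto simp: q_def)
  have "integrable lborel ?F" "(LINT t|lborel. ?F t) = 0"
    using contq[OF q] unfolding set_integrable_def set_lebesgue_integral_def by auto
  then have ae: "AE t in lborel. ?F t = 0"
    by (subst (asm) integral_nonneg_eq_0_iff_AE) (use F0 in auto)
  have "((\<lambda>t. exp (- t)) \<longlongrightarrow> exp (- t0)) (nhds t0)"
    by (intro tendsto_intros) (rule filterlim_ident)
  from tendstoD[OF this e0] obtain r where r: "r > 0" "\<And>t. \<bar>t - t0\<bar> < r \<Longrightarrow> \<bar>exp (- t) - exp (- t0)\<bar> < e"
    unfolding eventually_nhds_metric dist_real_def by blast
  have "?F t \<noteq> 0" if "t \<in> {t0 - r<..<t0 + r}" for t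
  proof -
    have "\<bar>exp (- t) - exp (- t0)\<bar> < e" using r(2)[of t] that by auto
    then have "sgn (h t0) * h1 t > 0" "t > 0" "max 0 (e - \<bar>exp (- t) - exp (- t0)\<bar>) > 0" using d(2)[OF e]
      by auto
    then show ?thesis unfolding q_def by (auto simp: indicator_def)
  qed
  then have "AE t in lborel. t \<notin> {t0 - r<..<t0 + r}" using ae by (auto elim: eventually_mono)
  then have "emeasure lborel {t0 - r<..<t0 + r} = 0"
    by (subst (asm) AE_iff_measurable[of "{t0 - r<..<t0 + r}"]) auto
  then show False using r(1) by simp
qed

corollary laplace_transform_inject:
  fixes f g :: "real \<Rightarrow> real"
  assumes "continuous_on {0<..} f" "continuous_on {0<..} g"
    and f: "\<And>lam. lam > c \<Longrightarrow> set_integrable lborel {0<..} (\<lambda>t. exp (- lam * t) * f t)"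
    and g: "\<And>lam. lam > c \<Longrightarrow> set_integrable lborel {0<..} (\<lambda>t. exp (- lam * t) * g t)"
    and eq: "\<And>lam. lam > c \<Longrightarrow> (LINT t:{0<..}|lborel. exp (- lam * t) * f t)
        = (LINT t:{0<..}|lborel. exp (- lam * t) * g t)"
    and "t > 0"
  shows "f t = g t"
proof -
  have "f t - g t = 0"
  proof (rule laplace_transform_eq_0_imp_eq_0[where c = c and h = "\<lambda>t. f t - g t"])
    fix lam assume l: "lam > c"
    show "set_integrable lborel {0<..} (\<lambda>t. exp (- lam * t) * (f t - g t))"
      using set_integral_diff(1)[OF f[OF l] g[OF l]] by (simp add: right_diff_distrib)
    show "(LINT t:{0<..}|lborel. exp (- lam * t) * (f t - g t)) = 0"
      using set_integral_diff(2)[OF f[OF l] g[OF l]] eq[OF l] by (simp add: right_diff_distrib)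
  qed (use assms in \<open>auto intro!: continuous_intros\<close>)
  then show ?thesis by simp
qed

section \<open>Parameter integrals\<close>

lemma continuous_on_integral_dominated:
  fixes f :: "'p::metric_space \<Rightarrow> 'w \<Rightarrow> real"
  assumes cont: "\<And>w. w \<in> space M \<Longrightarrow> continuous_on S (\<lambda>p. f p w)"
    and mes: "\<And>p. p \<in> S \<Longrightarrow> f p \<in> borel_measurable M"
    and g: "integrable M g" and dom: "\<And>p w. p \<in> S \<Longrightarrow> w \<in> space M \<Longrightarrow> \<bar>f p w\<bar> \<le> g w"
  shows "continuous_on S (\<lambda>p. LINT w|M. f p w)"
  unfolding continuous_on_sequentially
proof (intro allI ballI impI)
  fix X p assume p: "p \<in> S" and X: "(\<forall>n. X n \<in> S) \<and> X \<longlonglongrightarrow> p"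
  show "((\<lambda>p. LINT w|M. f p w) \<circ> X) \<longlonglongrightarrow> (LINT w|M. f p w)"
    unfolding comp_def
  proof (rule integral_dominated_convergence[OF mes[OF p] _ g])
    show "AE w in M. (\<lambda>i. f (X i) w) \<longlonglongrightarrow> f p w"
      using cont p X unfolding continuous_on_sequentially comp_def by (intro AE_I2) blast
  qed (use X mes dom in auto)
qed

lemma has_real_derivative_integral_dominated:
  fixes f :: "real \<Rightarrow> 'w \<Rightarrow> real"
  assumes y: "y \<in> {c<..<d}"
    and int: "\<And>s. s \<in> {c<..<d} \<Longrightarrow> integrable M (f s)"
    and D: "\<And>s w. s \<in> {c<..<d} \<Longrightarrow> w \<in> space M \<Longrightarrow> ((\<lambda>s. f s w) has_real_derivative f' s w) (at s)"
    and mes: "f' y \<in> borel_measurable M"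
    and g: "integrable M g" and dom: "\<And>s w. s \<in> {c<..<d} \<Longrightarrow> w \<in> space M \<Longrightarrow> \<bar>f' s w\<bar> \<le> g w"
  shows "((\<lambda>s. LINT w|M. f s w) has_real_derivative (LINT w|M. f' y w)) (at y)"
proof -
  have "((\<lambda>s. LINT w|M. f s w) has_real_derivative (LINT w|M. f' y w)) (at y within {c<..<d})"
    unfolding has_field_derivative_iff tendsto_at_iff_sequentially
  proof (intro allI impI)
    fix X assume "\<forall>i. X i \<in> {c<..<d} - {y}" and lim: "X \<longlonglongrightarrow> y"
    then have X: "X i \<in> {c<..<d}" "X i \<noteq> y" for i by auto
    have e: "((LINT w|M. f (X i) w) - (LINT w|M. f y w)) / (X i - y)
        = (LINT w|M. (f (X i) w - f y w) / (X i - y))" for i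
      using Bochner_Integration.integral_diff[OF int[OF X(1)] int[OF y]] by simp
    show "((\<lambda>s. ((LINT w|M. f s w) - (LINT w|M. f y w)) / (s - y)) \<circ> X) \<longlonglongrightarrow> (LINT w|M. f' y w)"
      unfolding comp_def e
    proof (rule integral_dominated_convergence[OF mes _ g])
      show "(\<lambda>w. (f (X i) w - f y w) / (X i - y)) \<in> borel_measurable M" for i
        using int[OF X(1)] int[OF y] by (intro borel_measurable_divide borel_measurable_diff) auto
      show "AE w in M. (\<lambda>i. (f (X i) w - f y w) / (X i - y)) \<longlonglongrightarrow> f' y w"
      proof (rule AE_I2)
        fix w assume w: "w \<in> space M"
        show "(\<lambda>i. (f (X i) w - f y w) / (X i - y)) \<longlonglongrightarrow> f' y w"
          using D[OF y w] lim X unfolding has_field_derivative_iff tendsto_at_iff_sequentially comp_def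
            by auto
      qed
      show "AE w in M. norm ((f (X i) w - f y w) / (X i - y)) \<le> g w" for i
      proof (rule AE_I2)
        fix w assume w: "w \<in> space M"
        have "\<bar>f (X i) w - f y w\<bar> \<le> g w * \<bar>X i - y\<bar>"
          unfolding real_norm_def[symmetric]
          by (rule field_differentiable_bound[of "{c<..<d}" _ "\<lambda>s. f' s w"])
             (use D w dom X y in \<open>auto intro: has_field_derivative_at_within\<close>)
        then show "norm ((f (X i) w - f y w) / (X i - y)) \<le> g w"
          using X(2)[of i] by (simp add: abs_divide divide_le_eq)
      qed
    qed
  qed
  moreover have "at y within {c<..<d} = at y" using y by (intro at_within_open) auto
  ultimately show ?thesis by simp
qed

section \<open>Inversion of the Laplace transform on half-planes\<close>

lemma continuous_on_vertical_line: "continuous_on A (Complex g)"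
  unfolding Complex_eq by (intro continuous_intros)

lemma norm_vertical_line_ge: "g > 0 \<Longrightarrow> norm (Complex g w) \<ge> g"
  using abs_Re_le_cmod[of "Complex g w"] by simp

text \<open>
  The functions to be inverted are dominated by \<open>C / |z|\<^sup>3\<close> on half-planes. On the line \<open>Re z = g\<close> this
  weight is integrable with an integral of order \<open>1 / g\<close> for large \<open>g\<close>. This factor
  yields the initial value of the inverse transform.
\<close>

lemma cubic_weight_le:
  assumes "g > 0"
  shows "1 / norm (Complex g w) ^ 3 \<le> (1 / g) * (1 + 1 / g\<^sup>2) * inverse (1 + w\<^sup>2)"
proof -
  have n2: "norm (Complex g w) ^ 2 = g\<^sup>2 + w\<^sup>2" by (simp add: cmod_power2)
  have pos: "1 + w\<^sup>2 > 0" "g\<^sup>2 + w\<^sup>2 > 0" using assms by (auto intro: add_pos_nonneg)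
  have "g * (g\<^sup>2 + w\<^sup>2) \<le> norm (Complex g w) * norm (Complex g w) ^ 2"
    unfolding n2 by (intro mult_right_mono norm_vertical_line_ge assms) auto
  then have le: "g * (g\<^sup>2 + w\<^sup>2) \<le> norm (Complex g w) ^ 3" by (simp add: power3_eq_cube power2_eq_square)
  have "1 / norm (Complex g w) ^ 3 \<le> 1 / (g * (g\<^sup>2 + w\<^sup>2))"
  proof (rule divide_left_mono[OF le])
    have p: "0 < g * (g\<^sup>2 + w\<^sup>2)" using pos assms by simp
    show "0 < norm (Complex g w) ^ 3 * (g * (g\<^sup>2 + w\<^sup>2))"
      by (rule mult_pos_pos[OF less_le_trans[OF p le] p])
  qed simp
  also have "\<dots> = (1 / g) * (1 / (g\<^sup>2 + w\<^sup>2))" by simp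
  also have "1 / (g\<^sup>2 + w\<^sup>2) \<le> (1 + 1 / g\<^sup>2) * inverse (1 + w\<^sup>2)"
  proof -
    have "1 + w\<^sup>2 \<le> (1 + 1 / g\<^sup>2) * (g\<^sup>2 + w\<^sup>2)" using assms by (simp add: field_simps)
    then show ?thesis using pos by (simp add: field_simps)
  qed
  finally show ?thesis using assms by (simp add: mult.assoc mult_left_mono divide_right_mono)
qed

lemma integrable_inverse_1_plus_sq: "integrable lborel (\<lambda>w::real. inverse (1 + w\<^sup>2))"
  and integral_inverse_1_plus_sq: "(LINT w|lborel. inverse (1 + w\<^sup>2)) = pi"
  using integrable_inverse_1_plus_square LBINT_inverse_1_plus_square
  by (simp_all add: set_integrable_def interval_lebesgue_integral_def set_lebesgue_integral_def)

lemma integrable_cubic_weight: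
  assumes "g > 0" shows "integrable lborel (\<lambda>w. 1 / norm (Complex g w) ^ 3)"
proof (rule Bochner_Integration.integrable_bound)
  show "integrable lborel (\<lambda>w. (1 / g) * (1 + 1 / g\<^sup>2) * inverse (1 + w\<^sup>2))"
    using integrable_inverse_1_plus_sq by (rule integrable_mult_right)
  show "(\<lambda>w. 1 / norm (Complex g w) ^ 3) \<in> borel_measurable lborel"
    using borel_measurable_continuous_onI[OF continuous_on_vertical_line] by measurable
  show "AE w in lborel. norm (1 / norm (Complex g w) ^ 3)
      \<le> norm ((1 / g) * (1 + 1 / g\<^sup>2) * inverse (1 + w\<^sup>2))"
    by (rule AE_I2) (use cubic_weight_le[OF assms] assms in auto)
qed

lemma integral_cubic_weight_le:
  assumes "g > 0" shows "(LINT w|lborel. 1 / norm (Complex g w) ^ 3) \<le> (1 / g) * (1 + 1 / g\<^sup>2) * pi"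
proof -
  have "(LINT w|lborel. 1 / norm (Complex g w) ^ 3)
      \<le> (LINT w|lborel. (1 / g) * (1 + 1 / g\<^sup>2) * inverse (1 + w\<^sup>2))"
    by (intro integral_mono integrable_cubic_weight assms cubic_weight_le integrable_mult_right
      integrable_inverse_1_plus_sq)
  then show ?thesis by (simp add: integral_inverse_1_plus_sq)
qed

lemma laplace_exp:
  fixes s :: complex
  assumes s: "Re s > 0"
  shows "set_integrable lborel {0<..} (\<lambda>t. exp (- s * of_real t))"
    and "(LINT t:{0<..}|lborel. exp (- s * of_real t)) = 1 / s"
proof -
  have "((\<lambda>t. exp (- Re s * t)) has_integral exp (- Re s * 0) / Re s) {0..}"
    by (rule has_integral_exp_minus_to_infinity[OF s])
  then have "(\<lambda>t. exp (- Re s * t)) absolutely_integrable_on {0..}"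
    by (intro nonnegative_absolutely_integrable_1) auto
  then have "set_integrable lborel {0..} (\<lambda>t. exp (- Re s * t))"
    unfolding set_integrable_def
    by (subst (asm) integrable_completion) (auto intro!: borel_measurable_continuous_on_indicator
      continuous_intros)
  then have r: "set_integrable lborel {0<..} (\<lambda>t. exp (- Re s * t))"
    by (rule set_integrable_subset) auto
  have "(\<lambda>t. indicator {0<..} t *\<^sub>R exp (- s * complex_of_real t)) \<in> borel_measurable borel"
    by (intro borel_measurable_continuous_on_indicator continuous_intros) auto
  then have mes: "(\<lambda>t. indicator {0<..} t *\<^sub>R exp (- s * complex_of_real t)) \<in> borel_measurable lborel"
    by simp
  show int: "set_integrable lborel {0<..} (\<lambda>t. exp (- s * of_real t))"
    unfolding set_integrable_def
    by (rule Bochner_Integration.integrable_bound[OF r[unfolded set_integrable_def] mes])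
       (auto simp: indicator_def)
  have "(LBINT t=0..\<infinity>. exp (- s * of_real t)) = 0 - (- (1 / s))"
  proof (rule interval_integral_FTC_integrable[where F = "\<lambda>t. - exp (- s * of_real t) / s"])
    have s0: "s \<noteq> 0" using s by auto
    show "((\<lambda>t. - exp (- s * complex_of_real t) / s)
        has_vector_derivative exp (- s * of_real t)) (at t)" for t
    proof -
      have "((\<lambda>z. - exp (- s * z) / s) has_field_derivative exp (- s * of_real t)) (at (of_real t))"
        using s0 by (auto intro!: derivative_eq_intros)
      from has_vector_derivative_real_field[OF this] show ?thesis by simp
    qed
    show "isCont (\<lambda>t. exp (- s * complex_of_real t)) t" for t by (intro continuous_intros)
    show "set_integrable lborel (einterval 0 \<infinity>) (\<lambda>t. exp (- s * complex_of_real t))"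
      using int by (simp add: zero_ereal_def)
    have "((\<lambda>t. - exp (- s * complex_of_real t) / s) \<longlongrightarrow> - exp (- s * of_real 0) / s) (at_right 0)"
      by (intro tendsto_intros) (use s0 in auto)
    then show "(((\<lambda>t. - exp (- s * complex_of_real t) / s) \<circ> real_of_ereal) \<longlongrightarrow> - (1 / s)) (at_right 0)"
      by (simp add: zero_ereal_def ereal_tendsto_simps)
    have "((\<lambda>t. exp (- Re s * t) / norm s) \<longlongrightarrow> 0 / norm s) at_top"
      by (intro tendsto_intros filterlim_compose[OF exp_at_bot] filterlim_tendsto_neg_mult_at_bot[OF
        tendsto_const _ filterlim_ident])
         (use s in auto)
    then have "((\<lambda>t. norm (- exp (- s * complex_of_real t) / s)) \<longlongrightarrow> 0) at_top"
      by (simp add: norm_divide)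
    then have "((\<lambda>t. - exp (- s * complex_of_real t) / s) \<longlongrightarrow> 0) at_top"
      using tendsto_norm_zero_iff by blast
    then show "(((\<lambda>t. - exp (- s * complex_of_real t) / s) \<circ> real_of_ereal) \<longlongrightarrow> 0) (at_left \<infinity>)"
      by (simp add: ereal_tendsto_simps)
  qed simp
  then show "(LINT t:{0<..}|lborel. exp (- s * of_real t)) = 1 / s"
    by (simp add: interval_lebesgue_integral_def zero_ereal_def)
qed

text \<open>
  The exponent 3 is a convenient choice: the functions of interest decay faster than every power, and 3
  makes the Bromwich integral converge absolutely and the far sides of the contour negligible.
\<close>

definition decays_on_half_planes :: "(complex \<Rightarrow> complex) \<Rightarrow> bool" where
  "decays_on_half_planes H \<longleftrightarrow> H holomorphic_on {z. Re z > 0} \<and>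
     (\<forall>g>0. \<exists>C. \<forall>z. Re z \<ge> g \<longrightarrow> norm (H z) \<le> C / norm z ^ 3)"

lemma continuous_on_line_of_holomorphic:
  assumes "H holomorphic_on {z. Re z > 0}" "g > 0"
  shows "continuous_on A (\<lambda>w. H (Complex g w))"
  by (rule continuous_on_compose2[OF holomorphic_on_imp_continuous_on[OF assms(1)]
    continuous_on_vertical_line])
     (use assms(2) in auto)

text \<open>
  Cauchy's formula on the rectangle with corners \<open>g - i R\<close> and \<open>g + R + i R\<close>. The three sides away from
  the line \<open>Re z = g\<close> contribute \<open>O (R\<^sup>-\<^sup>3)\<close>, so only the integral over that line survives.
\<close>

lemma half_plane_cauchy:
  assumes H: "decays_on_half_planes H" and g: "0 < g" "g < lam"
  shows "(LINT w|lborel. H (Complex g w) / (of_real lam - Complex g w))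
      = of_real (2 * pi) * H (of_real lam)"
proof -
  have hol: "H holomorphic_on {z. Re z > 0}" using H unfolding decays_on_half_planes_def by auto
  obtain C where C: "\<And>z. Re z \<ge> g \<Longrightarrow> norm (H z) \<le> C / norm z ^ 3"
    using H g unfolding decays_on_half_planes_def by blast
  have C0: "C \<ge> 0"
    using order_trans[OF norm_ge_zero C[of "of_real g"]] g by (auto simp: zero_le_divide_iff)
  let ?f = "\<lambda>w. H (Complex g w) / (of_real lam - Complex g w)"
  have nz: "of_real lam - Complex g w \<noteq> 0" for w using g by (auto simp: complex_eq_iff)
  have cont: "continuous_on A ?f" for A
    by (intro continuous_intros continuous_on_vertical_line continuous_on_line_of_holomorphic[OF hol
      g(1)]) (use nz in auto)
  have bnd: "norm (?f w) \<le> (C / (lam - g)) * (1 / norm (Complex g w) ^ 3)" for w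
  proof -
    have "norm (of_real lam - Complex g w) \<ge> lam - g"
      using abs_Re_le_cmod[of "of_real lam - Complex g w"] by simp
    then have "norm (?f w) \<le> (C / norm (Complex g w) ^ 3) / (lam - g)"
      unfolding norm_divide using C[of "Complex g w"] g C0 by (intro frac_le) auto
    then show ?thesis by (simp add: mult.commute)
  qed
  have int: "integrable lborel ?f"
  proof (rule Bochner_Integration.integrable_bound)
    show "integrable lborel (\<lambda>w. (C / (lam - g)) * (1 / norm (Complex g w) ^ 3))"
      by (intro integrable_mult_right integrable_cubic_weight g)
    show "?f \<in> borel_measurable lborel" using borel_measurable_continuous_onI[OF cont] by simp
    show "AE w in lborel. norm (?f w) \<le> norm ((C / (lam - g)) * (1 / norm (Complex g w) ^ 3))"
      unfolding real_norm_def by (rule AE_I2, rule order_trans[OF bnd abs_ge_self])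
  qed
  let ?h = "\<lambda>w. H w / (w - of_real lam)"
  \<comment> \<open>with \<open>R > 2 * lam\<close> the far sides stay at distance \<open>R / 2\<close> or more from the pole\<close>
  have box_est: "norm (of_real (2 * pi) * H (of_real lam) - integral {-R..R} ?f)
      \<le> 8 * C / R ^ 3" if R: "R > 2 * lam" "R > 1" for R
  proof -
    define a1 a2 a3 a4 where "a1 = Complex g (-R)" and "a2 = Complex (g + R) (-R)"
      and "a3 = Complex (g + R) R" and "a4 = Complex g R"
    have "(?h has_contour_integral (2 * pi * \<i> * winding_number (rectpath a1 a3) (of_real lam)
        * H (of_real lam))) (rectpath a1 a3)"
    proof (rule Cauchy_integral_formula_convex_simple[where S = "{z. Re z > 0}"])
      show "convex {z. Re z > 0}" by (rule convex_halfspace_Re_gt)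
      show "of_real lam \<in> interior {z. Re z > 0}"
        using g by (subst interior_open) (auto simp: open_halfspace_Re_gt)
      show "path_image (rectpath a1 a3) \<subseteq> {z. 0 < Re z} - {complex_of_real lam}"
        using g R by (subst path_image_rectpath) (auto simp: a1_def a3_def)
    qed (use hol in auto)
    moreover have "winding_number (rectpath a1 a3) (of_real lam) = 1"
      by (rule winding_number_rectpath) (use g R in \<open>auto simp: a1_def a3_def in_box_complex_iff\<close>)
    ultimately have hc: "(?h has_contour_integral (2 * pi * \<i> * H (of_real lam))) (rectpath a1 a3)" by simp
    have rp: "rectpath a1 a3 = linepath a1 a2 +++ linepath a2 a3 +++ linepath a3 a4 +++ linepath a4 a1"
      unfolding rectpath_def Let_def a1_def a2_def a3_def a4_def by simp
    have ci: "?h contour_integrable_on linepath p q"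
      if "closed_segment p q \<subseteq> {z. 0 < Re z} - {complex_of_real lam}" for p q
      by (rule contour_integrable_continuous_linepath)
         (use that in \<open>intro continuous_intros continuous_on_subset[OF holomorphic_on_imp_continuous_on[OF
           hol]]; auto\<close>)
    have s1: "closed_segment a1 a2 = {z. Im z = -R \<and> Re z \<in> {g..g + R}}"
      unfolding a1_def a2_def using R by (subst closed_segment_same_Im) (auto simp:
        closed_segment_eq_real_ivl)
    have s2: "closed_segment a2 a3 = {z. Re z = g + R \<and> Im z \<in> {-R..R}}"
      unfolding a2_def a3_def using R by (subst closed_segment_same_Re) (auto simp:
        closed_segment_eq_real_ivl)
    have s3: "closed_segment a3 a4 = {z. Im z = R \<and> Re z \<in> {g..g + R}}"
      unfolding a3_def a4_def using R by (subst closed_segment_same_Im) (auto simp: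
        closed_segment_eq_real_ivl)
    have s4: "closed_segment a4 a1 = {z. Re z = g \<and> Im z \<in> {-R..R}}"
      unfolding a4_def a1_def using R by (subst closed_segment_same_Re) (auto simp:
        closed_segment_eq_real_ivl)
    have c1: "?h contour_integrable_on linepath a1 a2" by (rule ci) (use s1 g R in auto)
    have c2: "?h contour_integrable_on linepath a2 a3" by (rule ci) (use s2 g R in auto)
    have c3: "?h contour_integrable_on linepath a3 a4" by (rule ci) (use s3 g R in auto)
    have c4: "?h contour_integrable_on linepath a4 a1" by (rule ci) (use s4 g R in auto)
    have c5: "?h contour_integrable_on linepath a1 a4"
      by (rule ci) (use s4 g R in \<open>auto simp: closed_segment_commute\<close>)
    have far: "norm (?h z) \<le> 2 * C / R ^ 4"
      if z: "Re z \<ge> g" "norm z \<ge> R" "norm (z - of_real lam) \<ge> R / 2" for z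
    proof -
      have "norm (H z) \<le> C / R ^ 3"
        by (rule order_trans[OF C[OF z(1)]])
          (use R z(2) C0 in \<open>auto intro!: divide_left_mono power_mono mult_pos_pos\<close>)
      then have "norm (?h z) \<le> (C / R ^ 3) / (R / 2)"
        unfolding norm_divide using z(3) R C0 by (intro frac_le) auto
      also have "\<dots> = 2 * C / R ^ 4" using R by (simp add: field_simps eval_nat_numeral)
      finally show ?thesis .
    qed
    have B0: "0 \<le> 2 * C / R ^ 4" using C0 R by simp
    have i1: "norm (contour_integral (linepath a1 a2) ?h) \<le> 2 * C / R ^ 4 * norm (a2 - a1)"
    proof (rule contour_integral_bound_linepath[OF c1 B0 far])
      fix z assume z: "z \<in> closed_segment a1 a2"
      then show "g \<le> Re z" using s1 by auto
      show "R \<le> norm z" using z s1 abs_Im_le_cmod[of z] by auto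
      show "R / 2 \<le> norm (z - of_real lam)" using z s1 R abs_Im_le_cmod[of "z - of_real lam"] by auto
    qed
    have i2: "norm (contour_integral (linepath a2 a3) ?h) \<le> 2 * C / R ^ 4 * norm (a3 - a2)"
    proof (rule contour_integral_bound_linepath[OF c2 B0 far])
      fix z assume z: "z \<in> closed_segment a2 a3"
      then show "g \<le> Re z" using s2 R by auto
      show "R \<le> norm z" using z s2 g abs_Re_le_cmod[of z] by auto
      show "R / 2 \<le> norm (z - of_real lam)" using z s2 R g abs_Re_le_cmod[of "z - of_real lam"] by auto
    qed
    have i3: "norm (contour_integral (linepath a3 a4) ?h) \<le> 2 * C / R ^ 4 * norm (a4 - a3)"
    proof (rule contour_integral_bound_linepath[OF c3 B0 far])
      fix z assume z: "z \<in> closed_segment a3 a4"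
      then show "g \<le> Re z" using s3 by auto
      show "R \<le> norm z" using z s3 abs_Im_le_cmod[of z] by auto
      show "R / 2 \<le> norm (z - of_real lam)" using z s3 R abs_Im_le_cmod[of "z - of_real lam"] by auto
    qed
    have d: "a2 - a1 = of_real R" "a3 - a2 = \<i> * of_real (2 * R)" "a4 - a3 = of_real (- R)"
      by (auto simp: a1_def a2_def a3_def a4_def complex_eq_iff)
    have n: "norm (a2 - a1) = R" "norm (a3 - a2) = 2 * R" "norm (a4 - a3) = R"
      unfolding d using R by (simp_all add: norm_mult)
    have i4: "contour_integral (linepath a4 a1) ?h = \<i> * integral {-R..R} ?f"
    proof -
      have "contour_integral (linepath a4 a1) ?h = - contour_integral (linepath a1 a4) ?h"
        using contour_integral_reversepath[of "linepath a1 a4" ?h] by (simp add: valid_path_linepath)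
      also have "contour_integral (linepath a1 a4) ?h = \<i> * integral {-R..R} (\<lambda>w. ?h (Complex g w))"
        by (rule contour_integral_linepath_same_Re) (use R in \<open>auto simp: a1_def a4_def\<close>)
      also have "(\<lambda>w. ?h (Complex g w)) = (\<lambda>w. - ?f w)"
        by (rule ext) (metis minus_diff_eq minus_divide_right)
      finally show ?thesis by simp
    qed
    have "2 * pi * \<i> * H (of_real lam) = contour_integral (rectpath a1 a3) ?h"
      using contour_integral_unique[OF hc] by simp
    also have "\<dots> = contour_integral (linepath a1 a2) ?h + (contour_integral (linepath a2 a3) ?h +
        (contour_integral (linepath a3 a4) ?h + contour_integral (linepath a4 a1) ?h))"
      unfolding rp using c1 c2 c3 c4 by simp
    finally have "\<i> * (of_real (2 * pi) * H (of_real lam) - integral {-R..R} ?f)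
        = contour_integral (linepath a1 a2) ?h
        + contour_integral (linepath a2 a3) ?h + contour_integral (linepath a3 a4) ?h"
      unfolding i4 by (simp add: algebra_simps)
    then have "norm (\<i> * (of_real (2 * pi) * H (of_real lam) - integral {-R..R} ?f))
        = norm (contour_integral (linepath a1 a2) ?h
        + contour_integral (linepath a2 a3) ?h + contour_integral (linepath a3 a4) ?h)" by simp
    then have "norm (of_real (2 * pi) * H (of_real lam) - integral {-R..R} ?f)
       \<le> norm (contour_integral (linepath a1 a2) ?h) + norm (contour_integral (linepath a2 a3) ?h)
         + norm (contour_integral (linepath a3 a4) ?h)"
      unfolding norm_mult norm_ii by (simp only: mult_1) (meson add_right_mono norm_triangle_ineq
        order_trans)
    also have "\<dots> \<le> 2 * C / R ^ 4 * R + 2 * C / R ^ 4 * (2 * R) + 2 * C / R ^ 4 * R"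
      using i1 i2 i3 unfolding n by linarith
    also have "\<dots> = 8 * C / R ^ 3" using R by (simp add: field_simps eval_nat_numeral)
    finally show ?thesis .
  qed
  have "(\<lambda>n. integral {- real n..real n} ?f) \<longlonglongrightarrow> (LINT w|lborel. ?f w)"
  proof -
    have e: "integral {- real n..real n} ?f
        = (LINT w|lborel. indicator {- real n..real n} w *\<^sub>R ?f w)" for n
      using set_borel_integral_eq_integral(2)[OF borel_integrable_atLeastAtMost'[OF cont]]
      unfolding set_lebesgue_integral_def by simp
    show ?thesis unfolding e
    proof (rule integral_dominated_convergence[where w = "\<lambda>w. norm (?f w)"])
      show "AE w in lborel. (\<lambda>n. indicator {- real n..real n} w *\<^sub>R ?f w) \<longlonglongrightarrow> ?f w"
      proof (rule AE_I2, rule tendsto_eventually)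
        fix w :: real
        show "\<forall>\<^sub>F n in sequentially. indicator {- real n..real n} w *\<^sub>R ?f w = ?f w"
          using eventually_ge_at_top[of "nat \<lceil>\<bar>w\<bar>\<rceil>"]
        proof eventually_elim
          case (elim n)
          then have "\<bar>w\<bar> \<le> real n" by linarith
          then show ?case by (auto simp: indicator_def)
        qed
      qed
    qed (use int in \<open>auto simp: indicator_def\<close>)
  qed
  moreover have "(\<lambda>n. integral {- real n..real n} ?f) \<longlonglongrightarrow> of_real (2 * pi) * H (of_real lam)"
  proof (rule LIM_zero_cancel, rule Lim_null_comparison)
    show "\<forall>\<^sub>F n in sequentially. norm (integral {- real n..real n} ?f - of_real (2 * pi)
        * H (of_real lam)) \<le> 8 * C / real n ^ 3"
      using eventually_gt_at_top[of "nat \<lceil>2 * lam + 1\<rceil>"]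
    proof eventually_elim
      case (elim n)
      then have "2 * lam + 1 < real n" by linarith
      then have "2 * lam < real n" "1 < real n" using g by linarith+
      then show ?case
        using box_est[of "real n"] by (simp add: norm_minus_commute)
    qed
    have "(\<lambda>n. 8 * C * inverse (real n ^ 3)) \<longlonglongrightarrow> 8 * C * 0"
      by (intro tendsto_intros tendsto_inverse_0_at_top filterlim_pow_at_top filterlim_real_sequentially)
        auto
    then show "(\<lambda>n. 8 * C / real n ^ 3) \<longlonglongrightarrow> 0" by (simp add: divide_inverse)
  qed
  ultimately show "(LINT w|lborel. ?f w) = of_real (2 * pi) * H (of_real lam)"
    using LIMSEQ_unique by blast
qed

text \<open>
  The complex inversion integral, whose real part is taken since only real originals are wanted.
\<close>

definition bromwich :: "real \<Rightarrow> (complex \<Rightarrow> complex) \<Rightarrow> real \<Rightarrow> real" where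
  "bromwich g H t = (LINT w|lborel. Re (exp (Complex g w * of_real t) * H (Complex g w))) / (2 * pi)"

lemma norm_bromwich_integrand_le:
  assumes "\<And>z. Re z \<ge> g \<Longrightarrow> norm (H z) \<le> C / norm z ^ 3"
  shows "norm (exp (Complex g w * of_real t) * H (Complex g w))
      \<le> exp (g * t) * C * (1 / norm (Complex g w) ^ 3)"
  using mult_left_mono[OF assms[of "Complex g w"], of "exp (g * t)"] by (simp add: norm_mult)

lemma borel_measurable_bromwich_integrand:
  assumes "H holomorphic_on {z. Re z > 0}" "g > 0"
  shows "(\<lambda>w. exp (Complex g w * of_real t) * H (Complex g w)) \<in> borel_measurable lborel"
proof -
  have "continuous_on UNIV (\<lambda>w. exp (Complex g w * of_real t) * H (Complex g w))"
    by (intro continuous_intros continuous_on_vertical_line continuous_on_line_of_holomorphic assms)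
  then show ?thesis using borel_measurable_continuous_onI by auto
qed

lemma integrable_bromwich_integrand:
  assumes H: "decays_on_half_planes H" and g: "g > 0"
  shows "integrable lborel (\<lambda>w. exp (Complex g w * of_real t) * H (Complex g w))"
proof -
  obtain C where C: "\<And>z. Re z \<ge> g \<Longrightarrow> norm (H z) \<le> C / norm z ^ 3"
    using H g unfolding decays_on_half_planes_def by blast
  show ?thesis
  proof (rule Bochner_Integration.integrable_bound)
    show "integrable lborel (\<lambda>w. exp (g * t) * C * (1 / norm (Complex g w) ^ 3))"
      by (intro integrable_mult_right integrable_cubic_weight g)
    show "(\<lambda>w. exp (Complex g w * of_real t) * H (Complex g w)) \<in> borel_measurable lborel"
      using H g unfolding decays_on_half_planes_def by (intro borel_measurable_bromwich_integrand) auto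
    show "AE w in lborel. norm (exp (Complex g w * of_real t) * H (Complex g w))
        \<le> norm (exp (g * t) * C * (1 / norm (Complex g w) ^ 3))"
      by (rule AE_I2) (metis norm_bromwich_integrand_le[OF C] order_trans abs_ge_self real_norm_def)
  qed
qed

lemma abs_bromwich_le:
  assumes H: "decays_on_half_planes H" and g: "g > 0"
    and C: "\<And>z. Re z \<ge> g \<Longrightarrow> norm (H z) \<le> C / norm z ^ 3"
  shows "\<bar>bromwich g H t\<bar> \<le> C * ((1 / g) * (1 + 1 / g\<^sup>2) / 2) * exp (g * t)"
proof -
  have C0: "C \<ge> 0"
    using order_trans[OF norm_ge_zero C[of "of_real g"]] g by (auto simp: zero_le_divide_iff)
  have "\<bar>LINT w|lborel. Re (exp (Complex g w * of_real t) * H (Complex g w))\<bar>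
      \<le> (LINT w|lborel. exp (g * t) * C * (1 / norm (Complex g w) ^ 3))"
    unfolding real_norm_def[symmetric]
  proof (rule Bochner_Integration.integral_norm_bound_integral)
    show "integrable lborel (\<lambda>w. Re (exp (Complex g w * of_real t) * H (Complex g w)))"
      by (intro integrable_Re integrable_bromwich_integrand H g)
    show "integrable lborel (\<lambda>w. exp (g * t) * C * (1 / norm (Complex g w) ^ 3))"
      by (intro integrable_mult_right integrable_cubic_weight g)
    show "norm (Re (exp (Complex g w * of_real t) * H (Complex g w)))
        \<le> exp (g * t) * C * (1 / norm (Complex g w) ^ 3)" for w
      unfolding real_norm_def by (rule order_trans[OF abs_Re_le_cmod norm_bromwich_integrand_le[OF C]])
  qed
  also have "\<dots> \<le> exp (g * t) * C * ((1 / g) * (1 + 1 / g\<^sup>2) * pi)"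
    unfolding integral_mult_right_zero
    by (intro mult_left_mono integral_cubic_weight_le g) (use C0 in auto)
  finally have "\<bar>LINT w|lborel. Re (exp (Complex g w * of_real t) * H (Complex g w))\<bar> / (2 * pi)
      \<le> exp (g * t) * C * ((1 / g) * (1 + 1 / g\<^sup>2) * pi) / (2 * pi)"
    by (rule divide_right_mono) simp
  also have "\<dots> = C * ((1 / g) * (1 + 1 / g\<^sup>2) / 2) * exp (g * t)" by simp
  finally show ?thesis unfolding bromwich_def by simp
qed

lemma continuous_on_bromwich:
  assumes H: "decays_on_half_planes H" and g: "g > 0"
  shows "continuous_on UNIV (bromwich g H)"
proof -
  obtain C where C: "\<And>z. Re z \<ge> g \<Longrightarrow> norm (H z) \<le> C / norm z ^ 3"
    using H g unfolding decays_on_half_planes_def by blast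
  have C0: "C \<ge> 0"
    using order_trans[OF norm_ge_zero C[of "of_real g"]] g by (auto simp: zero_le_divide_iff)
  have "continuous_on {..<T} (bromwich g H)" for T
    unfolding bromwich_def
  proof (intro continuous_on_divide continuous_on_const continuous_on_integral_dominated)
    show "integrable lborel (\<lambda>w. exp (g * T) * C * (1 / norm (Complex g w) ^ 3))"
      by (intro integrable_mult_right integrable_cubic_weight g)
    show "(\<lambda>w. Re (exp (Complex g w * of_real t) * H (Complex g w))) \<in> borel_measurable lborel" for t
      by (rule borel_measurable_integrable[OF integrable_Re[OF integrable_bromwich_integrand[OF H g]]])
    show "continuous_on {..<T} (\<lambda>t. Re (exp (Complex g w * of_real t) * H (Complex g w)))" for w
      by (intro continuous_intros)
    fix t w assume t: "t \<in> {..<T}"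
    have "exp (g * t) * C * (1 / norm (Complex g w) ^ 3) \<le> exp (g * T) * C * (1 / norm (Complex g w) ^ 3)"
      using t g C0 by (intro mult_right_mono) auto
    then show "\<bar>Re (exp (Complex g w * of_real t) * H (Complex g w))\<bar>
        \<le> exp (g * T) * C * (1 / norm (Complex g w) ^ 3)"
      using order_trans[OF abs_Re_le_cmod norm_bromwich_integrand_le[where g = g and t = t and w
        = w, OF C]] by linarith
  qed simp
  then have "isCont (bromwich g H) t" for t
    using continuous_on_eq_continuous_at[OF open_lessThan[of "t + 1"]] by (metis lessThan_iff less_add_one)
  then show ?thesis by (simp add: continuous_at_imp_continuous_on)
qed

text \<open>
  By Fubini, the time integral of \<open>exp ((z - lam) t)\<close> is \<open>1 / (lam - z)\<close>, and the remaining integral over the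
  line is the one of Cauchy's formula.
\<close>

lemma laplace_bromwich:
  assumes H: "decays_on_half_planes H" and g: "0 < g" "g < lam"
  shows "set_integrable lborel {0<..} (\<lambda>t. exp (- lam * t) * bromwich g H t)"
    and "(LINT t:{0<..}|lborel. exp (- lam * t) * bromwich g H t) = Re (H (of_real lam))"
proof -
  obtain C where C: "\<And>z. Re z \<ge> g \<Longrightarrow> norm (H z) \<le> C / norm z ^ 3"
    using H g unfolding decays_on_half_planes_def by blast
  have hol: "H holomorphic_on {z. Re z > 0}" using H unfolding decays_on_half_planes_def by auto
  have "integrable lborel (\<lambda>t. norm (indicator {0<..} t *\<^sub>R exp (- complex_of_real (lam - g) * of_real t)))"
    using laplace_exp(1)[of "of_real (lam - g)"] g unfolding set_integrable_def
      by (intro integrable_norm) auto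
  moreover have "norm (indicator {0<..} t *\<^sub>R exp (- complex_of_real (lam - g) * of_real t))
      = indicator {0<..} t * exp (- (lam - g) * t)" for t
    by (auto simp: indicator_def)
  ultimately have er: "integrable lborel (\<lambda>t. indicator {0<..} t * exp (- (lam - g) * t))" by simp
  let ?E = "\<lambda>t w. exp (- (of_real lam - Complex g w) * complex_of_real t)"
  define F where "F = (\<lambda>(t, w). indicator {0<..} t *\<^sub>R (?E t w * H (Complex g w)))"
  have Ee: "?E t w = of_real (exp (- lam * t)) * exp (Complex g w * of_real t)" for t w
    by (simp add: exp_of_real[symmetric] algebra_simps flip: exp_add)
  have nE: "norm (?E t w) = exp (- (lam - g) * t)" for t w by simp
  have Fm: "F \<in> borel_measurable (lborel \<Otimes>\<^sub>M lborel)"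
  proof -
    have "continuous_on UNIV (\<lambda>p. exp (- (of_real lam - Complex g (snd p)) * complex_of_real (fst p))
        * H (Complex g (snd p)))"
      by (intro continuous_intros continuous_on_compose2[OF continuous_on_vertical_line continuous_on_snd]
          continuous_on_compose2[OF continuous_on_line_of_holomorphic[OF hol g(1)] continuous_on_snd]) auto
    then have "continuous_on ({0<..} \<times> UNIV) (\<lambda>p. exp (- (of_real lam - Complex g (snd p))
        * complex_of_real (fst p)) * H (Complex g (snd p)))"
      using continuous_on_subset by blast
    then have "(\<lambda>p. indicator ({0<..} \<times> UNIV) p
        *\<^sub>R (exp (- (of_real lam - Complex g (snd p)) * complex_of_real (fst p)) * H (Complex g (snd p))))
          \<in> borel_measurable borel"
      by (intro borel_measurable_continuous_on_indicator) (auto intro!: borel_open open_Times)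
    moreover have "(\<lambda>p. indicator ({0<..} \<times> UNIV) p
        *\<^sub>R (exp (- (of_real lam - Complex g (snd p)) * complex_of_real (fst p)) * H (Complex g (snd p))))
          = F"
      by (auto simp: F_def fun_eq_iff indicator_def)
    ultimately show ?thesis by (simp add: lborel_prod)
  qed
  have Hint: "integrable lborel (\<lambda>w. H (Complex g w))"
    using integrable_bromwich_integrand[OF H g(1), of 0] by simp
  have Ft: "F (t, w) = indicator {0<..} t
      *\<^sub>R of_real (exp (- lam * t)) * (exp (Complex g w * of_real t) * H (Complex g w))" for t w
    unfolding F_def Ee by simp
  have "integrable (lborel \<Otimes>\<^sub>M lborel) F"
  proof (rule lborel_pair.Fubini_integrable[OF Fm])
    have "(LINT w|lborel. norm (F (t, w)))
        = (indicator {0<..} t * exp (- (lam - g) * t)) * (LINT w|lborel. norm (H (Complex g w)))" for t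
      unfolding F_def by (simp add: norm_mult nE)
    then show "integrable lborel (\<lambda>t. LINT w|lborel. norm (F (t, w)))"
      using er by (simp add: integrable_mult_left)
    show "AE t in lborel. integrable lborel (\<lambda>w. F (t, w))"
      unfolding Ft by (intro AE_I2 integrable_mult_right integrable_bromwich_integrand H g)
  qed
  then have fub: "(LINT w|lborel. LINT t|lborel. F (t, w)) = (LINT t|lborel. LINT w|lborel. F (t, w))"
    using lborel_pair.Fubini_integral[of "\<lambda>t w. F (t, w)"] by simp
  have inner: "(LINT t|lborel. F (t, w)) = H (Complex g w) / (of_real lam - Complex g w)" for w
  proof -
    have "(LINT t|lborel. F (t, w)) = (LINT t|lborel. (indicator {0<..} t *\<^sub>R ?E t w) * H (Complex g w))"
      unfolding F_def by simp
    also have "\<dots> = (LINT t|lborel. indicator {0<..} t *\<^sub>R ?E t w) * H (Complex g w)"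
      by (rule integral_mult_left_zero)
    also have "(LINT t|lborel. indicator {0<..} t *\<^sub>R ?E t w) = 1 / (of_real lam - Complex g w)"
      using laplace_exp(2)[of "of_real lam - Complex g w"] g unfolding set_lebesgue_integral_def by simp
    finally show ?thesis by simp
  qed
  have outer: "Re (LINT w|lborel. F (t, w))
      = 2 * pi * (indicator {0<..} t *\<^sub>R (exp (- lam * t) * bromwich g H t))" for t
  proof -
    have "(LINT w|lborel. F (t, w)) = indicator {0<..} t
        *\<^sub>R of_real (exp (- lam * t)) * (LINT w|lborel. exp (Complex g w * of_real t) * H (Complex g w))"
      unfolding Ft by (rule integral_mult_right_zero)
    then have "Re (LINT w|lborel. F (t, w))
        = indicator {0<..} t * exp (- lam * t) * Re (LINT w|lborel. exp (Complex g w * of_real t)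
          * H (Complex g w))"
      by (auto simp: indicator_def simp del: of_real_exp)
    then show ?thesis
      unfolding bromwich_def by (subst integral_Re[OF integrable_bromwich_integrand[OF H g(1)]]) simp
  qed
  have "Re (LINT t|lborel. LINT w|lborel. F (t, w)) = 2 * pi * Re (H (of_real lam))"
    unfolding fub[symmetric] inner half_plane_cauchy[OF H g] by simp
  moreover have iF: "integrable lborel (\<lambda>t. LINT w|lborel. F (t, w))"
    using lborel_pair.integrable_fst'[OF \<open>integrable (lborel \<Otimes>\<^sub>M lborel) F\<close>] .
  ultimately have "(LINT t|lborel. 2 * pi * (indicator {0<..} t *\<^sub>R (exp (- lam * t) * bromwich g H t)))
      = 2 * pi * Re (H (of_real lam))"
    by (simp only: integral_Re[OF iF, symmetric] outer[symmetric])
  then show "(LINT t:{0<..}|lborel. exp (- lam * t) * bromwich g H t) = Re (H (of_real lam))"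
    unfolding set_lebesgue_integral_def by simp
  define X where "X t = indicator {0<..} t *\<^sub>R (exp (- lam * t) * bromwich g H t)" for t
  have i: "integrable lborel (\<lambda>t. 2 * pi * X t)"
    using integrable_Re[OF iF] unfolding outer X_def .
  have "integrable lborel (\<lambda>t. (1 / (2 * pi)) * (2 * pi * X t))"
    by (rule integrable_mult_right, rule i)
  then have "integrable lborel X" by simp
  then show "set_integrable lborel {0<..} (\<lambda>t. exp (- lam * t) * bromwich g H t)"
    unfolding set_integrable_def X_def .
qed

text \<open>
  Both sides have the same Laplace transform to the right of both lines.
\<close>

lemma bromwich_abscissa_irrelevant:
  assumes H: "decays_on_half_planes H" and "0 < g" "0 < g'" "t > 0"
  shows "bromwich g H t = bromwich g' H t"
proof (rule laplace_transform_inject[where c = "max g g'" and f = "bromwich g H" and g = "bromwich g' H"])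
  show "continuous_on {0<..} (bromwich g H)" "continuous_on {0<..} (bromwich g' H)"
    using continuous_on_bromwich[OF H] assms continuous_on_subset by blast+
qed (use assms laplace_bromwich[OF H] in auto)

text \<open>
  At time \<open>t\<close> the line \<open>Re z = 1 / t\<close> keeps \<open>exp (z t)\<close> bounded while the integral of the weight is \<open>O (t)\<close>.
\<close>

lemma bromwich_initial_value:
  assumes H: "decays_on_half_planes H"
  shows "(bromwich 1 H \<longlongrightarrow> 0) (at_right 0)"
proof -
  have "\<exists>C. \<forall>z. Re z \<ge> 1 \<longrightarrow> norm (H z) \<le> C / norm z ^ 3"
    using conjunct2[OF H[unfolded decays_on_half_planes_def], rule_format, of 1] by simp
  then obtain C where C: "\<And>z. Re z \<ge> 1 \<Longrightarrow> norm (H z) \<le> C / norm z ^ 3" by auto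
  have C0: "C \<ge> 0"
    using order_trans[OF norm_ge_zero C[of "of_real 1"]] by (auto simp: zero_le_divide_iff)
  have le: "\<bar>bromwich 1 H t\<bar> \<le> C * exp 1 * t" if t: "0 < t" "t < 1" for t
  proof -
    have "\<bar>bromwich 1 H t\<bar> = \<bar>bromwich (1 / t) H t\<bar>"
      using bromwich_abscissa_irrelevant[OF H, of 1 "1 / t" t] t by simp
    also have "\<dots> \<le> C * ((1 / (1 / t)) * (1 + 1 / (1 / t)\<^sup>2) / 2) * exp ((1 / t) * t)"
    proof (rule abs_bromwich_le[OF H])
      fix z assume "1 / t \<le> Re z"
      moreover have "1 \<le> 1 / t" using t by simp
      ultimately have "1 \<le> Re z" by linarith
      then show "norm (H z) \<le> C / norm z ^ 3" by (rule C)
    qed (use t in auto)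
    also have "\<dots> = C * exp 1 * (t * ((1 + t\<^sup>2) / 2))" using t by (simp add: field_simps)
    also have "\<dots> \<le> C * exp 1 * (t * 1)"
      using t C0 power_le_one[of t 2] by (intro mult_left_mono) auto
    finally show ?thesis by simp
  qed
  show ?thesis
  proof (rule Lim_null_comparison)
    show "\<forall>\<^sub>F t in at_right 0. norm (bromwich 1 H t) \<le> C * exp 1 * t"
      unfolding eventually_at_right_field by (rule exI[of _ 1]) (use le in auto)
    have "((\<lambda>t. C * exp 1 * t) \<longlongrightarrow> C * exp 1 * 0) (at_right 0)" by (intro tendsto_intros)
    then show "((\<lambda>t. C * exp 1 * t) \<longlongrightarrow> 0) (at_right 0)" by simp
  qed
qed

section \<open>Holomorphic families of solutions and their originals\<close>

text \<open>
  \<open>F j z\<close> is the \<open>j\<close>-th space derivative of a function which depends holomorphically on the Laplace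
  variable \<open>z\<close>. Decay is required on compact subintervals of \<open>(a, b)\<close> only, since a solution with
  nonzero boundary values does not decay at the ends.
\<close>

locale laplace_tower =
  fixes F :: "nat \<Rightarrow> complex \<Rightarrow> real \<Rightarrow> complex" and a b :: real
  assumes hol: "y \<in> {a<..<b} \<Longrightarrow> (\<lambda>z. F j z y) holomorphic_on {z. Re z > 0}"
    and decay: "g > 0 \<Longrightarrow> a < c \<Longrightarrow> d < b \<Longrightarrow> \<exists>C. \<forall>z y. Re z \<ge> g \<longrightarrow> y \<in> {c..d} \<longrightarrow> norm (F j z y) \<le> C / norm z ^ 3"
    and deriv: "Re z > 0 \<Longrightarrow> y \<in> {a<..<b} \<Longrightarrow> (F j z has_vector_derivative F (Suc j) z y) (at y)"
begin

definition original :: "nat \<Rightarrow> real \<Rightarrow> real \<Rightarrow> real" where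
  "original j t y = bromwich 1 (\<lambda>z. F j z y) t"

lemma decays: "y \<in> {a<..<b} \<Longrightarrow> decays_on_half_planes (\<lambda>z. F j z y)"
  unfolding decays_on_half_planes_def using hol[of y j] decay[of _ y y j] by auto

lemma original_space_derivative:
  assumes y: "y \<in> {a<..<b}"
  shows "(original j t has_real_derivative original (Suc j) t y) (at y)"
proof -
  obtain c where c: "a < c" "c < y" using y dense by auto
  obtain d where d: "y < d" "d < b" using y dense by auto
  obtain C where C: "\<And>z y. Re z \<ge> 1 \<Longrightarrow> y \<in> {c..d} \<Longrightarrow> norm (F (Suc j) z y) \<le> C / norm z ^ 3"
    using decay[of 1 c d "Suc j"] c d by auto
  have sub: "s \<in> {a<..<b}" "s \<in> {c..d}" if "s \<in> {c<..<d}" for s using that c d by auto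
  have "((\<lambda>s. LINT w|lborel. Re (exp (Complex 1 w * of_real t) * F j (Complex 1 w) s))
      has_real_derivative (LINT w|lborel. Re (exp (Complex 1 w * of_real t)
        * F (Suc j) (Complex 1 w) y))) (at y)"
  proof (rule has_real_derivative_integral_dominated[where c = c and d = d])
    show "integrable lborel (\<lambda>w. exp (1 * t) * C * (1 / norm (Complex 1 w) ^ 3))"
      by (intro integrable_mult_right integrable_cubic_weight) auto
    show "integrable lborel (\<lambda>w. Re (exp (Complex 1 w * of_real t) * F j (Complex 1 w) s))"
      if "s \<in> {c<..<d}" for s
      using sub[OF that] by (intro integrable_Re integrable_bromwich_integrand decays) auto
    show "(\<lambda>w. Re (exp (Complex 1 w * of_real t) * F (Suc j) (Complex 1 w) y)) \<in> borel_measurable lborel"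
      by (rule borel_measurable_integrable[OF integrable_Re[OF integrable_bromwich_integrand[OF decays[OF
        y]]]]) simp
    fix s w assume s: "s \<in> {c<..<d}"
    show "((\<lambda>s. Re (exp (Complex 1 w * of_real t) * F j (Complex 1 w) s))
       has_real_derivative Re (exp (Complex 1 w * of_real t) * F (Suc j) (Complex 1 w) s)) (at s)"
      unfolding has_real_derivative_iff_has_vector_derivative
      by (intro bounded_linear.has_vector_derivative[OF bounded_linear_Re]
        has_vector_derivative_mult_right deriv)
         (use sub[OF s] in auto)
    show "\<bar>Re (exp (Complex 1 w * of_real t) * F (Suc j) (Complex 1 w) s)\<bar>
        \<le> exp (1 * t) * C * (1 / norm (Complex 1 w) ^ 3)"
      by (rule order_trans[OF abs_Re_le_cmod norm_bromwich_integrand_le]) (use C sub[OF s] in auto)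
  qed (use c d in auto)
  then show ?thesis unfolding original_def[abs_def] bromwich_def by (rule DERIV_cdivide)
qed

text \<open>
  The time derivative brings down a factor \<open>z\<close>, which the stationary equation converts into space
  derivatives.
\<close>

lemma original_time_derivative:
  assumes y: "y \<in> {a<..<b}"
    and heat: "\<And>z. Re z > 0 \<Longrightarrow> z * F 0 z y = of_real k * F m z y"
  shows "((\<lambda>s. original 0 s y) has_real_derivative k * original m t y) (at t)"
proof -
  obtain C where C: "\<And>z. Re z \<ge> 1 \<Longrightarrow> norm (F m z y) \<le> C / norm z ^ 3"
    using decay[of 1 y y m] y by auto
  have C0: "C \<ge> 0"
    using order_trans[OF norm_ge_zero C[of "of_real 1"]] by (auto simp: zero_le_divide_iff)
  have e: "Re (z * (exp (z * of_real s) * F 0 z y))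
      = k * Re (exp (z * of_real s) * F m z y)" if "Re z > 0" for z s
  proof -
    have "z * (exp (z * of_real s) * F 0 z y) = of_real k * (exp (z * of_real s) * F m z y)"
      using heat[OF that] by (simp add: mult.left_commute)
    moreover have "Re (of_real k * v) = k * Re v" for v by simp
    ultimately show ?thesis by (simp only:)
  qed
  have "((\<lambda>s. LINT w|lborel. Re (exp (Complex 1 w * of_real s) * F 0 (Complex 1 w) y))
      has_real_derivative (LINT w|lborel. k * Re (exp (Complex 1 w * of_real t)
        * F m (Complex 1 w) y))) (at t)"
  proof (rule has_real_derivative_integral_dominated[where c = "t - 1" and d = "t + 1"])
    show "integrable lborel (\<lambda>w. \<bar>k\<bar> * (exp (1 * (t + 1)) * C * (1 / norm (Complex 1 w) ^ 3)))"
      by (intro integrable_mult_right integrable_cubic_weight) auto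
    show "integrable lborel (\<lambda>w. Re (exp (Complex 1 w * of_real s) * F 0 (Complex 1 w) y))" for s
      using y by (intro integrable_Re integrable_bromwich_integrand decays) auto
    show "(\<lambda>w. k * Re (exp (Complex 1 w * of_real t) * F m (Complex 1 w) y)) \<in> borel_measurable lborel"
      by (intro borel_measurable_times borel_measurable_const borel_measurable_integrable[OF integrable_Re]
          integrable_bromwich_integrand decays y) simp
    fix s w assume s: "s \<in> {t - 1<..<t + 1}"
    show "((\<lambda>s. Re (exp (Complex 1 w * of_real s) * F 0 (Complex 1 w) y))
       has_real_derivative k * Re (exp (Complex 1 w * of_real s) * F m (Complex 1 w) y)) (at s)"
    proof -
      have "((\<lambda>x. exp (Complex 1 w * x) * F 0 (Complex 1 w) y) has_field_derivative
          Complex 1 w * (exp (Complex 1 w * of_real s) * F 0 (Complex 1 w) y)) (at (of_real s))"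
        by (auto intro!: derivative_eq_intros)
      note bounded_linear.has_vector_derivative[OF bounded_linear_Re has_vector_derivative_real_field[OF
        this, of UNIV]]
      moreover have "k * Re (exp (Complex 1 w * of_real s) * F m (Complex 1 w) y)
          = Re (Complex 1 w * (exp (Complex 1 w * of_real s) * F 0 (Complex 1 w) y))"
        by (rule e[symmetric]) simp
      ultimately show ?thesis unfolding has_real_derivative_iff_has_vector_derivative by (simp only:)
    qed
    have "\<bar>Re (exp (Complex 1 w * of_real s) * F m (Complex 1 w) y)\<bar>
        \<le> exp (1 * s) * C * (1 / norm (Complex 1 w) ^ 3)"
      by (rule order_trans[OF abs_Re_le_cmod norm_bromwich_integrand_le]) (use C in auto)
    also have "\<dots> \<le> exp (1 * (t + 1)) * C * (1 / norm (Complex 1 w) ^ 3)"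
      using s C0 by (intro mult_right_mono) auto
    finally show "\<bar>k * Re (exp (Complex 1 w * of_real s) * F m (Complex 1 w) y)\<bar>
        \<le> \<bar>k\<bar> * (exp (1 * (t + 1)) * C * (1 / norm (Complex 1 w) ^ 3))"
      unfolding abs_mult by (rule mult_left_mono) simp
  qed auto
  then have "((\<lambda>s. original 0 s y) has_real_derivative
      (LINT w|lborel. k * Re (exp (Complex 1 w * of_real t) * F m (Complex 1 w) y)) / (2 * pi)) (at t)"
    unfolding original_def bromwich_def by (rule DERIV_cdivide)
  then show ?thesis unfolding original_def bromwich_def by simp
qed

lemma original_jointly_continuous: "continuous_on ({0<..} \<times> {a<..<b}) (\<lambda>(t, y). original j t y)"
proof -
  have "isCont (\<lambda>(t, y). original j t y) p" if p: "p \<in> {0<..} \<times> {a<..<b}" for p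
  proof -
    obtain t y where ty: "p = (t, y)" "0 < t" "y \<in> {a<..<b}" using p by auto
    obtain c where c: "a < c" "c < y" using ty dense by auto
    obtain d where d: "y < d" "d < b" using ty dense by auto
    obtain C where C: "\<And>z y. Re z \<ge> 1 \<Longrightarrow> y \<in> {c..d} \<Longrightarrow> norm (F j z y) \<le> C / norm z ^ 3"
      using decay[of 1 c d j] c d by auto
    have C0: "C \<ge> 0"
      using order_trans[OF norm_ge_zero C[of "of_real 1" y]] c d by (auto simp: zero_le_divide_iff)
    let ?S = "{0<..<t + 1} \<times> {c<..<d}"
    have sub: "snd q \<in> {a<..<b}" "snd q \<in> {c..d}" if "q \<in> ?S" for q using that c d by auto
    have "continuous_on ?S (\<lambda>q. original j (fst q) (snd q))"
      unfolding original_def bromwich_def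
    proof (intro continuous_on_divide continuous_on_const continuous_on_integral_dominated)
      show "integrable lborel (\<lambda>w. exp (1 * (t + 1)) * C * (1 / norm (Complex 1 w) ^ 3))"
        by (intro integrable_mult_right integrable_cubic_weight) auto
      fix w
      have "continuous_on {a<..<b} (F j (Complex 1 w))"
        by (rule continuous_at_imp_continuous_on, rule ballI, rule has_vector_derivative_continuous, rule
          deriv) auto
      then have "continuous_on ?S (\<lambda>q. F j (Complex 1 w) (snd q))"
        by (rule continuous_on_compose2[OF _ continuous_on_snd[OF continuous_on_id]]) (use sub in blast)
      then show "continuous_on ?S (\<lambda>q. Re (exp (Complex 1 w * of_real (fst q))
          * F j (Complex 1 w) (snd q)))"
        by (intro continuous_intros)
    next
      fix q assume q: "q \<in> ?S"
      show "(\<lambda>w. Re (exp (Complex 1 w * of_real (fst q)) * F j (Complex 1 w) (snd q)))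
          \<in> borel_measurable lborel"
        by (rule borel_measurable_integrable[OF integrable_Re[OF integrable_bromwich_integrand[OF
          decays[OF sub(1)[OF q]]]]]) simp
      fix w
      have "\<bar>Re (exp (Complex 1 w * of_real (fst q)) * F j (Complex 1 w) (snd q))\<bar>
          \<le> exp (1 * fst q) * C * (1 / norm (Complex 1 w) ^ 3)"
        by (rule order_trans[OF abs_Re_le_cmod norm_bromwich_integrand_le]) (use C sub[OF q] in auto)
      also have "\<dots> \<le> exp (1 * (t + 1)) * C * (1 / norm (Complex 1 w) ^ 3)"
        using q C0 by (intro mult_right_mono) auto
      finally show "\<bar>Re (exp (Complex 1 w * of_real (fst q)) * F j (Complex 1 w) (snd q))\<bar>
         \<le> exp (1 * (t + 1)) * C * (1 / norm (Complex 1 w) ^ 3)" .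
    qed simp
    moreover have "open ?S" "p \<in> ?S" using ty c d by (auto intro: open_Times)
    ultimately have "isCont (\<lambda>q. original j (fst q) (snd q)) p"
      using continuous_on_eq_continuous_at by blast
    then show ?thesis by (simp add: case_prod_beta')
  qed
  then show ?thesis by (simp add: continuous_at_imp_continuous_on)
qed

text \<open>
  The growth rate is the abscissa of the line of integration, and any positive abscissa will do.
\<close>

lemma original_bound:
  assumes e: "e > 0" and cd: "a < c" "d < b"
  shows "\<exists>M. \<forall>t>0. \<forall>y\<in>{c..d}. \<bar>original j t y\<bar> \<le> M * exp (e * t)"
proof -
  obtain C where C: "\<And>z y. Re z \<ge> e \<Longrightarrow> y \<in> {c..d} \<Longrightarrow> norm (F j z y) \<le> C / norm z ^ 3"
    using decay[of e c d j] e cd by auto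
  have "\<bar>original j t y\<bar> \<le> C * ((1 / e) * (1 + 1 / e\<^sup>2) / 2) * exp (e * t)"
    if t: "t > 0" and y: "y \<in> {c..d}" for t y
  proof -
    have "original j t y = bromwich e (\<lambda>z. F j z y) t"
      unfolding original_def using y cd e t by (intro bromwich_abscissa_irrelevant decays) auto
    also have "\<bar>\<dots>\<bar> \<le> C * ((1 / e) * (1 + 1 / e\<^sup>2) / 2) * exp (e * t)"
      by (rule abs_bromwich_le[OF decays e C]) (use y cd in auto)
    finally show ?thesis .
  qed
  then show ?thesis by blast
qed

lemma original_laplace:
  assumes y: "y \<in> {a<..<b}" and lam: "lam > 0"
  shows "set_integrable lborel {0<..} (\<lambda>t. exp (- lam * t) * original j t y)"
    and "(LINT t:{0<..}|lborel. exp (- lam * t) * original j t y) = Re (F j (of_real lam) y)"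
proof -
  define g where "g = lam / 2"
  have g: "0 < g" "g < lam" using lam unfolding g_def by auto
  have e: "original j t y = bromwich g (\<lambda>z. F j z y) t" if "t > 0" for t
    unfolding original_def using that y g by (intro bromwich_abscissa_irrelevant decays) auto
  show "set_integrable lborel {0<..} (\<lambda>t. exp (- lam * t) * original j t y)"
    by (subst set_integrable_cong[OF refl refl])
      (use laplace_bromwich(1)[OF decays[OF y] g, of j] e in auto)
  show "(LINT t:{0<..}|lborel. exp (- lam * t) * original j t y) = Re (F j (of_real lam) y)"
    by (subst set_lebesgue_integral_cong) (use laplace_bromwich(2)[OF decays[OF y] g, of j] e in auto)
qed

lemma higher_deriv_original: "y \<in> {a<..<b} \<Longrightarrow> (deriv ^^ j) (original 0 t) y = original j t y"
  by (rule higher_deriv_eq_tower[where f = "\<lambda>j. original j t" and m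
    = j, OF open_greaterThanLessThan original_space_derivative]) auto

lemma original_solves_evolution_bvp:
  assumes heat: "\<And>z y. Re z > 0 \<Longrightarrow> y \<in> {a<..<b} \<Longrightarrow> z * F 0 z y = of_real (kappa N) * F (2 * N) z y"
    and lima: "\<And>l lam. l < N \<Longrightarrow> lam > 0 \<Longrightarrow> ((\<lambda>y. Re (F l (of_real lam) y)) \<longlongrightarrow> \<alpha> l) (at_right a)"
    and limb: "\<And>l lam. l < N \<Longrightarrow> lam > 0 \<Longrightarrow> ((\<lambda>y. Re (F l (of_real lam) y)) \<longlongrightarrow> \<beta> l) (at_left b)"
    and ab: "a < b"
  shows "solves_evolution_bvp N a b \<alpha> \<beta> (original 0)"
  unfolding solves_evolution_bvp_def regular_on_strip_def
proof (intro conjI allI impI ballI)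
  show "times_differentiable_on (2 * N) (original 0 t) {a<..<b}" for t
    by (rule times_differentiable_on_tower[where f = "\<lambda>j. original j t"])
      (use original_space_derivative in auto)
  show "continuous_on ({0<..} \<times> {a<..<b}) (\<lambda>(t, y). (deriv ^^ j) (original 0 t) y)" for j
    by (rule continuous_on_eq[OF original_jointly_continuous[of j]]) (auto simp: higher_deriv_original)
  show "\<exists>M. \<forall>t>0. \<forall>y\<in>{c..d}. \<bar>(deriv ^^ j) (original 0 t) y\<bar>
      \<le> M * exp (e * t)" if "e > 0" "a < c \<and> d < b" for j e c d
  proof -
    have "y \<in> {a<..<b}" if "y \<in> {c..d}" for y using that \<open>a < c \<and> d < b\<close> by auto
    then show ?thesis using original_bound[of e c d j] that by (simp add: higher_deriv_original)
  qed
  show "((\<lambda>s. original 0 s y) has_real_derivative kappa N * (deriv ^^ (2 * N)) (original 0 t) y) (at t)"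
    if "y \<in> {a<..<b}" for t y
    using original_time_derivative[OF that heat] that by (simp add: higher_deriv_original)
  show "((\<lambda>t. original 0 t y) \<longlongrightarrow> 0) (at_right 0)" if "y \<in> {a<..<b}" for y
    unfolding original_def using bromwich_initial_value[OF decays[OF that]] .
  fix l lam assume l: "l < N" and lam: "(lam::real) > 0"
  have e: "(LINT t:{0<..}|lborel. exp (- lam * t) * (deriv ^^ l) (original 0 t) y)
      = Re (F l (of_real lam) y)"
    if "y \<in> {a<..<b}" for y using original_laplace(2)[OF that lam] that by (simp add: higher_deriv_original)
  show "((\<lambda>y. LINT t:{0<..}|lborel. exp (- lam * t) * (deriv ^^ l) (original 0 t) y) \<longlongrightarrow> \<alpha> l) (at_right a)"
    by (rule Lim_transform_eventually[OF lima[OF l lam]])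
       (use e ab in \<open>auto simp: eventually_at_right_field intro!: exI[of _ b]\<close>)
  show "((\<lambda>y. LINT t:{0<..}|lborel. exp (- lam * t) * (deriv ^^ l) (original 0 t) y) \<longlongrightarrow> \<beta> l) (at_left b)"
    by (rule Lim_transform_eventually[OF limb[OF l lam]])
       (use e ab in \<open>auto simp: eventually_at_left_field intro!: exI[of _ a]\<close>)
qed

end

section \<open>Uniqueness for the evolution problem\<close>

lemma set_integrable_exp_neg:
  assumes "c > 0" shows "set_integrable lborel {0<..} (\<lambda>t. exp (- c * t) :: real)"
proof -
  have "set_integrable lborel {0<..} (\<lambda>t. norm (exp (- complex_of_real c * of_real t)))"
    by (rule set_integrable_norm, rule laplace_exp(1)) (use assms in simp)
  then show ?thesis by simp
qed

text \<open>
  The Laplace transform in time of a solution of the evolution problem solves the stationary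
  problem with parameter \<open>lam\<close>.
\<close>

locale evolution_solution =
  fixes N :: nat and a b :: real and \<alpha> \<beta> :: "nat \<Rightarrow> real" and u :: "real \<Rightarrow> real \<Rightarrow> real" and lam :: real
  assumes sol: "solves_evolution_bvp N a b \<alpha> \<beta> u" and lam: "lam > 0"
begin

definition transform :: "nat \<Rightarrow> real \<Rightarrow> real" where
  "transform j y = (LINT t:{0<..}|lborel. exp (- lam * t) * (deriv ^^ j) (u t) y)"

lemma space_derivative:
  "t > 0 \<Longrightarrow> j < 2 * N \<Longrightarrow> y \<in> {a<..<b} \<Longrightarrow>
    ((deriv ^^ j) (u t) has_real_derivative (deriv ^^ Suc j) (u t) y) (at y)"
  using sol unfolding solves_evolution_bvp_def regular_on_strip_def
  by (intro times_differentiable_on_derivD[where m = "2 * N" and S = "{a<..<b}"]) auto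

lemma continuous_in_time:
  assumes "j \<le> 2 * N" "y \<in> {a<..<b}"
  shows "continuous_on {0<..} (\<lambda>t. (deriv ^^ j) (u t) y)"
proof -
  have "continuous_on ({0<..} \<times> {a<..<b}) (\<lambda>(t, y). (deriv ^^ j) (u t) y)"
    using sol assms unfolding solves_evolution_bvp_def regular_on_strip_def by auto
  then have "continuous_on {0<..} (\<lambda>t. (\<lambda>(t, y). (deriv ^^ j) (u t) y) (t, y))"
    by (rule continuous_on_compose2) (use assms(2) in \<open>auto intro!: continuous_intros\<close>)
  then show ?thesis by simp
qed

lemma exponential_bound:
  assumes "j \<le> 2 * N" "a < c" "d < b"
  obtains M where "\<And>t y. t > 0 \<Longrightarrow> y \<in> {c..d} \<Longrightarrow>
    \<bar>exp (- lam * t) * (deriv ^^ j) (u t) y\<bar> \<le> M * exp (- (lam / 2) * t)"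
proof -
  have "\<forall>\<epsilon>>0. \<forall>c d. a < c \<and> d < b \<longrightarrow> (\<exists>M. \<forall>t>0. \<forall>y\<in>{c..d}. \<bar>(deriv ^^ j) (u t) y\<bar> \<le> M * exp (\<epsilon> * t))"
    using sol assms unfolding solves_evolution_bvp_def regular_on_strip_def by blast
  \<comment> \<open>half of the exponential factor absorbs the growth of \<open>u\<close>, the other half remains for integrability\<close>
  then obtain M where M: "\<forall>t>0. \<forall>y\<in>{c..d}. \<bar>(deriv ^^ j) (u t) y\<bar> \<le> M * exp ((lam / 2) * t)"
    using lam assms half_gt_zero by blast
  have "\<bar>exp (- lam * t) * (deriv ^^ j) (u t) y\<bar>
      \<le> M * exp (- (lam / 2) * t)" if "t > 0" "y \<in> {c..d}" for t y
  proof -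
    have "\<bar>exp (- lam * t) * (deriv ^^ j) (u t) y\<bar> \<le> exp (- lam * t) * (M * exp ((lam / 2) * t))"
      unfolding abs_mult abs_exp_cancel by (rule mult_left_mono) (use M that in auto)
    also have "\<dots> = M * exp (- (lam / 2) * t)"
      by (simp add: mult.left_commute flip: exp_add)
    finally show ?thesis .
  qed
  then show thesis by (rule that)
qed

lemma integrable_transform:
  assumes "j \<le> 2 * N" "y \<in> {a<..<b}"
  shows "set_integrable lborel {0<..} (\<lambda>t. exp (- lam * t) * (deriv ^^ j) (u t) y)"
proof -
  obtain M where M: "\<And>t z. t > 0 \<Longrightarrow> z \<in> {y..y} \<Longrightarrow>
      \<bar>exp (- lam * t) * (deriv ^^ j) (u t) z\<bar> \<le> M * exp (- (lam / 2) * t)"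
    using exponential_bound[of j y y] assms by auto
  have "(\<lambda>t. indicator {0<..} t *\<^sub>R (exp (- lam * t) * (deriv ^^ j) (u t) y)) \<in> borel_measurable borel"
    by (intro borel_measurable_continuous_on_indicator continuous_intros continuous_in_time assms) auto
  then have mes: "(\<lambda>t. indicator {0<..} t *\<^sub>R (exp (- lam * t) * (deriv ^^ j) (u t) y))
      \<in> borel_measurable lborel"
    by simp
  have "set_integrable lborel {0<..} (\<lambda>t. M * exp (- (lam / 2) * t))"
    by (intro set_integrable_mult_right set_integrable_exp_neg) (use lam in auto)
  then show ?thesis
    unfolding set_integrable_def
  proof (rule Bochner_Integration.integrable_bound[OF _ mes])
    show "AE t in lborel. norm (indicator {0<..} t *\<^sub>R (exp (- lam * t) * (deriv ^^ j) (u t) y))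
        \<le> norm (indicator {0<..} t *\<^sub>R (M * exp (- (lam / 2) * t)))"
    proof (rule AE_I2)
      fix t :: real
      show "norm (indicator {0<..} t *\<^sub>R (exp (- lam * t) * (deriv ^^ j) (u t) y))
        \<le> norm (indicator {0<..} t *\<^sub>R (M * exp (- (lam / 2) * t)))"
      proof (cases "t > 0")
        case True
        then show ?thesis using order_trans[OF M[OF True, of y] abs_ge_self] by simp
      qed auto
    qed
  qed
qed

lemma transform_derivative:
  assumes j: "j < 2 * N" and y: "y \<in> {a<..<b}"
  shows "(transform j has_real_derivative transform (Suc j) y) (at y)"
  unfolding transform_def[abs_def] set_lebesgue_integral_def
proof -
  obtain c where c: "a < c" "c < y" using y dense by auto
  obtain d where d: "y < d" "d < b" using y dense by auto
  obtain M where M: "\<And>t z. t > 0 \<Longrightarrow> z \<in> {c..d} \<Longrightarrow>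
      \<bar>exp (- lam * t) * (deriv ^^ Suc j) (u t) z\<bar> \<le> M * exp (- (lam / 2) * t)"
    using exponential_bound[of "Suc j" c d] j c d by auto
  have sub: "s \<in> {a<..<b}" "s \<in> {c..d}" if "s \<in> {c<..<d}" for s using that c d by auto
  show "((\<lambda>y. LINT t|lborel. indicator {0<..} t
      *\<^sub>R (exp (- lam * t) * (deriv ^^ j) (u t) y)) has_real_derivative
      (LINT t|lborel. indicator {0<..} t *\<^sub>R (exp (- lam * t) * (deriv ^^ Suc j) (u t) y))) (at y)"
  proof (rule has_real_derivative_integral_dominated[where c = c and d = d])
    show "integrable lborel (\<lambda>t. indicator {0<..} t *\<^sub>R (M * exp (- (lam / 2) * t)))"
      unfolding set_integrable_def[symmetric]
      by (intro set_integrable_mult_right set_integrable_exp_neg) (use lam in auto)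
    show "integrable lborel (\<lambda>t. indicator {0<..} t *\<^sub>R (exp (- lam * t) * (deriv ^^ j) (u t) s))"
      if "s \<in> {c<..<d}" for s
      using integrable_transform[of j s] sub[OF that] j unfolding set_integrable_def by simp
    show "(\<lambda>t. indicator {0<..} t *\<^sub>R (exp (- lam * t) * (deriv ^^ Suc j) (u t) y))
        \<in> borel_measurable lborel"
      by (rule borel_measurable_integrable[OF integrable_transform[unfolded set_integrable_def]])
        (use j y in auto)
    fix s t assume s: "s \<in> {c<..<d}"
    show "((\<lambda>s. indicator {0<..} t *\<^sub>R (exp (- lam * t) * (deriv ^^ j) (u t) s)) has_real_derivative
        indicator {0<..} t *\<^sub>R (exp (- lam * t) * (deriv ^^ Suc j) (u t) s)) (at s)"
    proof (cases "t > 0")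
      case True
      have "((\<lambda>s. exp (- lam * t) * (deriv ^^ j) (u t) s) has_real_derivative
          exp (- lam * t) * (deriv ^^ Suc j) (u t) s) (at s)"
        by (rule DERIV_cmult, rule space_derivative) (use True j sub[OF s] in auto)
      then show ?thesis using True by simp
    qed simp
    show "\<bar>indicator {0<..} t *\<^sub>R (exp (- lam * t) * (deriv ^^ Suc j) (u t) s)\<bar>
        \<le> indicator {0<..} t *\<^sub>R (M * exp (- (lam / 2) * t))"
      using M[of t s] sub[OF s] by (cases "t > 0") simp_all
  qed (use c d in auto)
qed

text \<open>
  Integration by parts in time; the boundary terms vanish because of the zero initial value and the
  subexponential growth.
\<close>

lemma transform_equation:
  assumes y: "y \<in> {a<..<b}"
  shows "kappa N * transform (2 * N) y = lam * transform 0 y"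
proof -
  let ?w = "\<lambda>t. (deriv ^^ (2 * N)) (u t) y"
  define f where "f t = kappa N * (exp (- lam * t) * ?w t) - lam * (exp (- lam * t)
      * (deriv ^^ 0) (u t) y)" for t
  have i1: "set_integrable lborel {0<..} (\<lambda>t. kappa N * (exp (- lam * t) * ?w t))"
    by (intro set_integrable_mult_right integrable_transform y) auto
  have i2: "set_integrable lborel {0<..} (\<lambda>t. lam * (exp (- lam * t) * (deriv ^^ 0) (u t) y))"
    by (intro set_integrable_mult_right integrable_transform y) auto
  have fint: "set_integrable lborel {0<..} f" unfolding f_def by (rule set_integral_diff(1)[OF i1 i2])
  have fval: "(LINT t:{0<..}|lborel. f t) = kappa N * transform (2 * N) y - lam * transform 0 y"
    unfolding f_def transform_def using set_integral_diff(2)[OF i1 i2] by simp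
  obtain M where M: "\<And>t z. t > 0 \<Longrightarrow> z \<in> {y..y} \<Longrightarrow>
      \<bar>exp (- lam * t) * (deriv ^^ 0) (u t) z\<bar> \<le> M * exp (- (lam / 2) * t)"
    using exponential_bound[of 0 y y] y by auto
  have "(LBINT t=0..\<infinity>. f t) = 0 - 0"
  proof (rule interval_integral_FTC_integrable[where F = "\<lambda>t. exp (- lam * t) * u t y"])
    fix t assume "0 < ereal t"
    then have t: "t > 0" by (simp add: zero_ereal_def)
    have ut: "((\<lambda>s. u s y) has_real_derivative kappa N * ?w t) (at t)"
      using sol t y unfolding solves_evolution_bvp_def by blast
    have "((\<lambda>t. exp (- lam * t) * u t y) has_real_derivative f t) (at t)"
      unfolding f_def by (rule derivative_eq_intros ut refl)+ (simp add: algebra_simps)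
    then show "((\<lambda>t. exp (- lam * t) * u t y) has_vector_derivative f t) (at t)"
      by (simp add: has_real_derivative_iff_has_vector_derivative)
    have "continuous_on {0<..} f"
      unfolding f_def by (intro continuous_intros continuous_in_time y) auto
    then show "isCont f t" using t continuous_on_eq_continuous_at[of "{0<..}" f] by auto
  next
    show "set_integrable lborel (einterval 0 \<infinity>) f" using fint by (simp add: zero_ereal_def)
    have "((\<lambda>t. u t y) \<longlongrightarrow> 0) (at_right 0)" using sol y unfolding solves_evolution_bvp_def by blast
    then have "((\<lambda>t. exp (- lam * t) * u t y) \<longlongrightarrow> exp (- lam * 0) * 0) (at_right 0)"
      by (intro tendsto_intros)
    then show "(((\<lambda>t. exp (- lam * t) * u t y) \<circ> real_of_ereal) \<longlongrightarrow> 0) (at_right 0)"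
      by (simp add: zero_ereal_def ereal_tendsto_simps)
    have lim: "((\<lambda>t. M * exp (- (lam / 2) * t)) \<longlongrightarrow> M * 0) at_top"
      by (intro tendsto_intros filterlim_compose[OF exp_at_bot] filterlim_tendsto_neg_mult_at_bot[OF
        tendsto_const _ filterlim_ident])
         (use lam in auto)
    have "((\<lambda>t. exp (- lam * t) * u t y) \<longlongrightarrow> 0) at_top"
    proof (rule Lim_null_comparison)
      show "((\<lambda>t. M * exp (- (lam / 2) * t)) \<longlongrightarrow> 0) at_top" using lim by simp
      show "\<forall>\<^sub>F t in at_top. norm (exp (- lam * t) * u t y) \<le> M * exp (- (lam / 2) * t)"
        using eventually_gt_at_top[of 0] by eventually_elim (use M[of _ y] in auto)
    qed
    then show "(((\<lambda>t. exp (- lam * t) * u t y) \<circ> real_of_ereal) \<longlongrightarrow> 0) (at_left \<infinity>)"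
      by (simp add: ereal_tendsto_simps)
  qed simp
  then have "(LINT t:{0<..}|lborel. f t) = 0"
    by (simp add: interval_lebesgue_integral_def zero_ereal_def)
  then show ?thesis unfolding fval by simp
qed

lemma transform_boundary:
  "l < N \<Longrightarrow> (transform l \<longlongrightarrow> \<alpha> l) (at_right a)" "l < N \<Longrightarrow> (transform l \<longlongrightarrow> \<beta> l) (at_left b)"
  using sol lam unfolding solves_evolution_bvp_def transform_def[abs_def] by blast+

end

theorem evolution_bvp_unique:
  assumes N: "N \<ge> 1" and ab: "a < b"
    and u: "solves_evolution_bvp N a b \<alpha> \<beta> u" and v: "solves_evolution_bvp N a b \<alpha> \<beta> v"
    and t: "t > 0" and y: "y \<in> {a<..<b}"
  shows "v t y = u t y"
proof (rule laplace_transform_inject[where c = 0 and f = "\<lambda>t. v t y" and g = "\<lambda>t. u t y", OF _ _ _ _ _ t])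
  have sol: "evolution_solution N a b \<alpha> \<beta> u lam" "evolution_solution N a b \<alpha> \<beta> v lam" if "lam > 0" for lam
    using that u v by (auto intro: evolution_solution.intro)
  show "continuous_on {0<..} (\<lambda>t. v t y)" "continuous_on {0<..} (\<lambda>t. u t y)"
    using evolution_solution.continuous_in_time[OF sol(1)[of 1], of 0 y]
      evolution_solution.continuous_in_time[OF sol(2)[of 1], of 0 y] y by auto
  fix lam :: real assume lam: "lam > 0"
  interpret U: evolution_solution N a b \<alpha> \<beta> u lam by (rule sol(1)[OF lam])
  interpret V: evolution_solution N a b \<alpha> \<beta> v lam by (rule sol(2)[OF lam])
  show "set_integrable lborel {0<..} (\<lambda>t. exp (- lam * t) * v t y)"
    "set_integrable lborel {0<..} (\<lambda>t. exp (- lam * t) * u t y)"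
    using U.integrable_transform[of 0 y] V.integrable_transform[of 0 y] y by auto
  define f where "f j y = complex_of_real (V.transform j y - U.transform j y)" for j y
  have "f 0 y = 0"
  proof (rule exit_bvp_unique[OF ab N _ _ _ _ _ y])
    show "0 < Re (of_real lam)" using lam by simp
    fix j z assume "j < 2 * N" "z \<in> {a<..<b}"
    then have "((\<lambda>y. V.transform j y - U.transform j y)
        has_vector_derivative V.transform (Suc j) z - U.transform (Suc j) z) (at z)"
      using U.transform_derivative V.transform_derivative
      unfolding has_real_derivative_iff_has_vector_derivative[symmetric] by (auto intro: DERIV_diff)
    then show "(f j has_vector_derivative f (Suc j) z) (at z)"
      unfolding f_def by (rule bounded_linear.has_vector_derivative[OF bounded_linear_of_real])
  next
    fix z assume z: "z \<in> {a<..<b}"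
    have "kappa N * (V.transform (2 * N) z - U.transform (2 * N) z)
        = lam * (V.transform 0 z - U.transform 0 z)"
      using U.transform_equation[OF z] V.transform_equation[OF z] by (simp add: right_diff_distrib)
    then show "of_real (kappa N) * f (2 * N) z = of_real lam * f 0 z"
      unfolding f_def by (simp only: of_real_mult[symmetric])
  next
    fix l assume l: "l < N"
    have "(f l \<longlongrightarrow> of_real (\<alpha> l - \<alpha> l)) (at_right a)" "(f l \<longlongrightarrow> of_real (\<beta> l - \<beta> l)) (at_left b)"
      unfolding f_def by (intro tendsto_intros U.transform_boundary V.transform_boundary l)+
    then show "(f l \<longlongrightarrow> 0) (at_right a)" "(f l \<longlongrightarrow> 0) (at_left b)" by simp_all
  qed
  then have "V.transform 0 y = U.transform 0 y" unfolding f_def by simp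
  then show "(LINT t:{0<..}|lborel. exp (- lam * t) * v t y)
      = (LINT t:{0<..}|lborel. exp (- lam * t) * u t y)"
    unfolding U.transform_def V.transform_def by simp
qed

section \<open>The roots of unity and the principal root\<close>

lemma theta_power_2N:
  assumes "N \<ge> 1" shows "theta N l ^ (2 * N) = of_real (kappa N)"
proof -
  define n where "n = 2 * l + (N - 1)"
  have n: "real n = 2 * real l + real N - 1" using assms by (simp add: n_def of_nat_diff)
  have "theta N l ^ (2 * N) = exp (of_nat (2 * N) * (\<i> * of_real (real n / (2 * real N) * pi)))"
    unfolding theta_def n by (simp only: exp_of_nat_mult)
  also have "of_nat (2 * N) * (\<i> * of_real (real n / (2 * real N) * pi)) = of_nat n * (\<i> * of_real pi)"
    using assms by simp
  also have "exp \<dots> = (-1) ^ n" by (simp only: exp_of_nat_mult) simp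
  also have "\<dots> = of_real (kappa N)" unfolding kappa_def n_def by (simp add: power_add)
  finally show ?thesis .
qed

lemma theta_shift:
  assumes "N \<ge> 1" shows "theta N (l + N) = - theta N l"
proof -
  have "\<i> * complex_of_real ((2 * real (l + N) + real N - 1) / (2 * real N) * pi)
      = \<i> * of_real ((2 * real l + real N - 1) / (2 * real N) * pi) + \<i> * of_real pi"
    using assms by (simp add: field_simps)
  then show ?thesis unfolding theta_def by (simp only: exp_add) simp
qed

lemma norm_theta [simp]: "norm (theta N l) = 1"
  unfolding theta_def by simp

lemma inj_on_theta:
  assumes "N \<ge> 1" shows "inj_on (\<lambda>j. theta N (j + 1)) {..<2 * N}"
proof (rule inj_onI)
  fix i j assume ij: "i \<in> {..<2 * N}" "j \<in> {..<2 * N}" and eq: "theta N (i + 1) = theta N (j + 1)"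
  obtain n :: int where n: "\<i> * complex_of_real ((2 * real (i + 1) + real N - 1) / (2 * real N) * pi)
      = \<i> * of_real ((2 * real (j + 1) + real N - 1) / (2 * real N) * pi) + of_int (2 * n) * of_real pi * \<i>"
    using eq unfolding theta_def exp_eq by auto
  have "(2 * real (i + 1) + real N - 1) / (2 * real N) * pi
      = (2 * real (j + 1) + real N - 1) / (2 * real N) * pi + 2 * of_int n * pi"
    using arg_cong[OF n, of Im] by simp
  then have "((2 * real (i + 1) + real N - 1) / (2 * real N)) * pi
      = ((2 * real (j + 1) + real N - 1) / (2 * real N) + 2 * of_int n) * pi"
    by (simp add: algebra_simps)
  then have "(2 * real (i + 1) + real N - 1) / (2 * real N)
      = (2 * real (j + 1) + real N - 1) / (2 * real N) + 2 * of_int n"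
    using mult_right_cancel[OF pi_neq_zero] by blast
  then have "real i = real j + 2 * real N * of_int n" using assms by (simp add: field_simps)
  then have "real_of_int (int i) = of_int (int j + 2 * int N * n)" by simp
  then have e: "int i = int j + 2 * int N * n" by linarith
  have "n = 0"
  proof (rule ccontr)
    assume "n \<noteq> 0"
    then have "\<bar>n\<bar> \<ge> 1" by simp
    then have "2 * int N * \<bar>n\<bar> \<ge> 2 * int N * 1" by (intro mult_left_mono) auto
    then have "\<bar>2 * int N * n\<bar> \<ge> 2 * int N" by (simp add: abs_mult)
    then show False using e ij by auto
  qed
  then show "i = j" using e by simp
qed

text \<open>
  For \<open>j < N\<close> the angle of \<open>theta N (j + 1)\<close> lies in \<open>[\<pi>/2 + \<pi>/(2N), 3\<pi>/2 - \<pi>/(2N)]\<close>. A rotation by at most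
  \<open>\<pi>/(4N)\<close> uses up half of the distance to the imaginary axis.
\<close>

lemma Re_theta_rotated_le:
  assumes N: "N \<ge> 1" and j: "j < N" and phi: "\<bar>phi\<bar> \<le> pi / (4 * real N)"
  shows "Re (theta N (j + 1) * cis phi) \<le> - sin (pi / (4 * real N))"
proof -
  define d where "d = pi / (4 * real N)"
  define s where "s = (2 * real j + 1) / (2 * real N) * pi + phi"
  have e: "(2 * real (j + 1) + real N - 1) / (2 * real N) * pi + phi = pi / 2 + s"
    unfolding s_def using N by (simp add: field_simps)
  have th: "theta N (j + 1) = cis ((2 * real (j + 1) + real N - 1) / (2 * real N) * pi)"
    unfolding theta_def cis_conv_exp ..
  have "Re (theta N (j + 1) * cis phi) = cos (pi / 2 + s)"
    unfolding th cis_mult e by simp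
  also have "\<dots> = - sin s" by (simp add: cos_add)
  finally have re: "Re (theta N (j + 1) * cis phi) = - sin s" .
  have d0: "0 < d" "d \<le> pi / 4" unfolding d_def using N by (auto simp: field_simps)
  have "1 / (2 * real N) \<le> (2 * real j + 1) / (2 * real N)" by (intro divide_right_mono) auto
  then have "1 / (2 * real N) * pi \<le> (2 * real j + 1) / (2 * real N) * pi" by (intro mult_right_mono) auto
  moreover have "1 / (2 * real N) * pi = 2 * d" unfolding d_def by simp
  ultimately have s1: "d \<le> s" unfolding s_def using phi d_def by linarith
  have "2 * real j + 1 \<le> 2 * real N - 1" using j by linarith
  then have "(2 * real j + 1) / (2 * real N) \<le> (2 * real N - 1) / (2 * real N)"
    by (intro divide_right_mono) auto
  then have "(2 * real j + 1) / (2 * real N) * pi \<le> (2 * real N - 1) / (2 * real N) * pi"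
    by (intro mult_right_mono) auto
  moreover have "(2 * real N - 1) / (2 * real N) * pi = pi - 2 * d" unfolding d_def using N
    by (simp add: field_simps)
  ultimately have s2: "s \<le> pi - d" unfolding s_def using phi d_def by linarith
  have "sin d \<le> sin s"
  proof (cases "s \<le> pi / 2")
    case True then show ?thesis using s1 d0 by (intro sin_monotone_2pi_le) auto
  next
    case False
    have "sin d \<le> sin (pi - s)" using s2 d0 False by (intro sin_monotone_2pi_le) auto
    then show ?thesis by simp
  qed
  then show ?thesis using re unfolding d_def by simp
qed

text \<open>
  The continuation of \<open>lam powr (1 / (2 N))\<close> to the right half-plane.
\<close>

definition principal_root :: "nat \<Rightarrow> complex \<Rightarrow> complex" where
  "principal_root N z = exp (Ln z / of_nat (2 * N))"

lemma principal_root_power: "N \<ge> 1 \<Longrightarrow> z \<noteq> 0 \<Longrightarrow> principal_root N z ^ (2 * N) = z"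
  unfolding principal_root_def by (simp flip: exp_of_nat_mult)

lemma principal_root_nonzero [simp]: "principal_root N z \<noteq> 0"
  unfolding principal_root_def by simp

lemma principal_root_of_real:
  assumes "lam > 0"
  shows "principal_root N (of_real lam) = of_real (lam powr (1 / (2 * real N)))"
  unfolding principal_root_def using assms by (simp add: powr_def Ln_of_real exp_of_real[symmetric])

lemma norm_principal_root: "norm (principal_root N z) = exp (Re (Ln z) / (2 * real N))"
proof -
  have "Re (Ln z / of_nat (2 * N)) = Re (Ln z) / real (2 * N)" by (rule Re_divide_of_nat)
  then show ?thesis unfolding principal_root_def norm_exp_eq_Re by simp
qed

lemma norm_principal_root_power: "N \<ge> 1 \<Longrightarrow> z \<noteq> 0 \<Longrightarrow> norm (principal_root N z) ^ (2 * N) = norm z"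
  by (metis norm_power principal_root_power)

lemma principal_root_holomorphic: "N \<ge> 1 \<Longrightarrow> principal_root N holomorphic_on {z. Re z > 0}"
  unfolding principal_root_def
  by (intro holomorphic_intros) (auto simp: complex_nonpos_Reals_iff)

lemma Re_theta_principal_root_le:
  assumes N: "N \<ge> 1" and j: "j < N" and z: "Re z > 0"
  shows "Re (principal_root N z * theta N (j + 1)) \<le> - sin (pi / (4 * real N)) * norm (principal_root N z)"
proof -
  define phi where "phi = Im (Ln z) / (2 * real N)"
  have "\<bar>Im (Ln z)\<bar> / (2 * real N) \<le> (pi / 2) / (2 * real N)"
    using Re_Ln_pos_lt_imp[OF z] by (intro divide_right_mono) auto
  then have phi: "\<bar>phi\<bar> \<le> pi / (4 * real N)" unfolding phi_def by simp
  have "Ln z / of_nat (2 * N) = of_real (Re (Ln z) / (2 * real N)) + \<i> * of_real phi"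
    unfolding phi_def by (subst complex_eq[of "Ln z"]) (simp add: add_divide_distrib)
  then have "principal_root N z = of_real (exp (Re (Ln z) / (2 * real N))) * cis phi"
    unfolding principal_root_def cis_conv_exp by (simp only: exp_add exp_of_real)
  then have mu: "principal_root N z = of_real (norm (principal_root N z)) * cis phi"
    unfolding norm_principal_root .
  have "Re (principal_root N z * theta N (j + 1))
      = Re (of_real (norm (principal_root N z)) * (theta N (j + 1) * cis phi))"
    by (subst mu) (simp only: mult_ac)
  also have "\<dots> = norm (principal_root N z) * Re (theta N (j + 1) * cis phi)" by simp
  also have "\<dots> \<le> norm (principal_root N z) * (- sin (pi / (4 * real N)))"
    by (intro mult_left_mono Re_theta_rotated_le N j phi) auto
  finally show ?thesis by (simp add: mult.commute)
qed

section \<open>Vandermonde systems and determinants\<close>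

text \<open>
  Pair the equations with the coefficients of \<open>\<Prod>\<^sub>j\<^sub>\<noteq>\<^sub>k (X - s\<^sub>j)\<close>, which has degree \<open>card J - 1\<close> and
  vanishes at all nodes except \<open>s\<^sub>k\<close>.
\<close>

lemma vandermonde_kernel_trivial:
  fixes w s :: "nat \<Rightarrow> complex"
  assumes J: "finite J" and inj: "inj_on s J"
    and zero: "\<And>l. l < card J \<Longrightarrow> (\<Sum>j\<in>J. w j * s j ^ l) = 0" and k: "k \<in> J"
  shows "w k = 0"
proof -
  define p where "p = (\<Prod>j\<in>J - {k}. [:- s j, 1:])"
  have dp: "degree p = card J - 1"
    unfolding p_def using J k by (subst degree_prod_eq_sum_degree) auto
  have c: "card J > 0" using J k by (auto simp: card_gt_0_iff)
  have "(\<Sum>l\<le>degree p. coeff p l * (\<Sum>j\<in>J. w j * s j ^ l)) = 0"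
    using zero dp c by (intro sum.neutral) auto
  also have "(\<Sum>l\<le>degree p. coeff p l * (\<Sum>j\<in>J. w j * s j ^ l)) = (\<Sum>j\<in>J. w j * poly p (s j))"
    unfolding poly_altdef sum_distrib_left by (subst sum.swap) (simp add: mult_ac)
  also have "\<dots> = (\<Sum>j\<in>{k}. w j * poly p (s j))"
  proof (rule sum.mono_neutral_right)
    show "\<forall>j\<in>J - {k}. w j * poly p (s j) = 0"
      unfolding p_def poly_prod using J by (auto simp: prod_zero_iff)
  qed (use J k in auto)
  finally have "w k * poly p (s k) = 0" by simp
  moreover have "poly p (s k) \<noteq> 0"
    unfolding p_def poly_prod using J inj k by (auto simp: prod_zero_iff dest: inj_onD)
  ultimately show ?thesis by simp
qed

text \<open>
  A function of the entries, so that bounds, limits and holomorphy of the entries pass to determinants.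
\<close>

definition det_of :: "nat \<Rightarrow> (nat \<Rightarrow> nat \<Rightarrow> complex) \<Rightarrow> complex" where
  "det_of n A = Determinant.det (Matrix.mat n n (\<lambda>(i, j). A i j))"

lemma det_of_permutations:
  "det_of n A = (\<Sum>p\<in>{p. p permutes {0..<n}}. signof p * (\<Prod>i = 0..<n. A i (p i)))"
proof -
  have "det_of n A = (\<Sum>p\<in>{p. p permutes {0..<n}}. signof p * (\<Prod>i
      = 0..<n. Matrix.mat n n (\<lambda>(i, j). A i j) $$ (i, p i)))"
    unfolding det_of_def by (rule det_def') simp
  also have "\<dots> = (\<Sum>p\<in>{p. p permutes {0..<n}}. signof p * (\<Prod>i = 0..<n. A i (p i)))"
  proof (intro sum.cong refl arg_cong2[of _ _ _ _ "(*)"] prod.cong)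
    fix p i assume "p \<in> {p. p permutes {0..<n}}" "i \<in> {0..<n}"
    then have "i < n" "p i < n" using permutes_in_image[of p "{0..<n}" i] by auto
    then show "Matrix.mat n n (\<lambda>(i, j). A i j) $$ (i, p i) = A i (p i)" by simp
  qed
  finally show ?thesis .
qed

lemma det_of_cong: "(\<And>i j. i < n \<Longrightarrow> j < n \<Longrightarrow> A i j = B i j) \<Longrightarrow> det_of n A = det_of n B"
  unfolding det_of_def by (intro arg_cong[of _ _ Determinant.det] eq_matI) auto

lemma det_of_scale_columns: "det_of n (\<lambda>i j. A i j * d j) = (\<Prod>j<n. d j) * det_of n A"
proof -
  have "(\<Prod>i = 0..<n. A i (p i) * d (p i)) = (\<Prod>i
      = 0..<n. A i (p i)) * (\<Prod>j<n. d j)" if "p permutes {0..<n}" for p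
    using prod.permute[OF that, of d] by (simp add: prod.distrib comp_def lessThan_atLeast0)
  then show ?thesis unfolding det_of_permutations sum_distrib_left by (intro sum.cong) auto
qed

text \<open>
  Laplace expansion with the cofactors written as determinants of size \<open>n\<close> that contain a unit row: the
  bounds and the holomorphy of determinants then apply to cofactors without change.
\<close>

lemma det_of_expand_row:
  assumes r: "r < n"
  shows "det_of n (\<lambda>i j. if i = r then v j else A i j)
    = (\<Sum>j<n. v j * det_of n (\<lambda>i j'. if i = r then (if j' = j then 1 else 0) else A i j'))"
proof -
  let ?M = "\<lambda>v. Matrix.mat n n (\<lambda>(i, j). if i = r then v j else A i j)"
  have del: "mat_delete (?M v) r j = mat_delete (?M v') r j" for v v' :: "nat \<Rightarrow> complex" and j
    unfolding mat_delete_def by (rule eq_matI) auto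
  have ex: "det_of n (\<lambda>i j. if i = r then v j else A i j) = (\<Sum>j<n. v j * cofactor (?M (\<lambda>_. 0)) r j)" for v
  proof -
    have "det_of n (\<lambda>i j. if i = r then v j else A i j) = (\<Sum>j<n. ?M v $$ (r, j) * cofactor (?M v) r j)"
      unfolding det_of_def by (rule laplace_expansion_row) (use r in auto)
    also have "\<dots> = (\<Sum>j<n. v j * cofactor (?M (\<lambda>_. 0)) r j)"
      by (intro sum.cong refl) (use r in \<open>auto simp: cofactor_def del[of v _ "\<lambda>_. 0"]\<close>)
    finally show ?thesis .
  qed
  have "det_of n (\<lambda>i j'. if i = r then (if j' = j then 1 else 0) else A i j')
      = cofactor (?M (\<lambda>_. 0)) r j" if "j < n" for j
    unfolding ex using that by (simp add: if_distrib if_distribR sum.delta cong: if_cong)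
  then show ?thesis unfolding ex by simp
qed

lemma det_of_repeated_row:
  assumes "r < n" "l < n" "l \<noteq> r"
  shows "det_of n (\<lambda>i j. if i = r then A l j else A i j) = 0"
  unfolding det_of_def
  by (rule det_identical_rows[of _ n r l]) (use assms in \<open>auto intro!: eq_vecI\<close>)

lemma norm_det_of_le:
  assumes "\<And>i j. i < n \<Longrightarrow> j < n \<Longrightarrow> norm (A i j) \<le> 1"
  shows "norm (det_of n A) \<le> fact n"
proof -
  have "norm (det_of n A) \<le> (\<Sum>p\<in>{p. p permutes {0..<n}}. 1)"
    unfolding det_of_permutations
  proof (rule sum_norm_le)
    fix p assume p: "p \<in> {p. p permutes {0..<n}}"
    have "(\<Prod>i = 0..<n. norm (A i (p i))) \<le> 1"
    proof (rule prod_le_1)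
      fix i assume "i \<in> {0..<n}"
      then have "i < n" "p i < n" using p permutes_in_image[of p "{0..<n}" i] by auto
      then show "0 \<le> norm (A i (p i)) \<and> norm (A i (p i)) \<le> 1" using assms by auto
    qed
    then show "norm (signof p * (\<Prod>i = 0..<n. A i (p i))) \<le> 1"
      by (simp add: norm_mult prod_norm[symmetric] sign_def)
  qed
  then show ?thesis by (simp add: card_permutations)
qed

lemma det_of_holomorphic:
  assumes "\<And>i j. i < n \<Longrightarrow> j < n \<Longrightarrow> (\<lambda>z. A z i j) holomorphic_on S"
  shows "(\<lambda>z. det_of n (A z)) holomorphic_on S"
  unfolding det_of_permutations
proof (intro holomorphic_on_sum holomorphic_on_mult holomorphic_on_const holomorphic_on_prod)
  fix p i assume "p \<in> {p. p permutes {0..<n}}" "i \<in> {0..<n}"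
  then have "i < n" "p i < n" using permutes_in_image[of p "{0..<n}" i] by auto
  then show "(\<lambda>z. A z i (p i)) holomorphic_on S" using assms by auto
qed

lemma det_of_tendsto:
  assumes "\<And>i j. i < n \<Longrightarrow> j < n \<Longrightarrow> ((\<lambda>z. A z i j) \<longlongrightarrow> B i j) F"
  shows "((\<lambda>z. det_of n (A z)) \<longlongrightarrow> det_of n B) F"
  unfolding det_of_permutations
proof (intro tendsto_sum tendsto_mult tendsto_const tendsto_prod)
  fix p i assume "p \<in> {p. p permutes {0..<n}}" "i \<in> {0..<n}"
  then have "i < n" "p i < n" using permutes_in_image[of p "{0..<n}" i] by auto
  then show "((\<lambda>z. A z i (p i)) \<longlongrightarrow> B i (p i)) F" using assms by auto
qed

lemma det_of_eq_0D:
  assumes "det_of n A = 0"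
  obtains v where "\<exists>j<n. v j \<noteq> 0" "\<And>i. i < n \<Longrightarrow> (\<Sum>j<n. v j * A i j) = 0"
proof -
  let ?M = "Matrix.mat n n (\<lambda>(i, j). A i j)"
  obtain v where v: "v \<in> carrier_vec n" "v \<noteq> 0\<^sub>v n" "?M *\<^sub>v v = 0\<^sub>v n"
    using assms det_0_iff_vec_prod_zero[of ?M n] unfolding det_of_def by auto
  have "(\<Sum>j<n. Matrix.vec_index v j * A i j) = 0" if i: "i < n" for i
  proof -
    have "Matrix.vec_index (?M *\<^sub>v v) i = 0" using v(3) i by simp
    then show ?thesis using i v(1)
      by (simp add: scalar_prod_def lessThan_atLeast0 mult.commute)
  qed
  moreover have "\<exists>j<n. Matrix.vec_index v j \<noteq> 0"
    using v(1,2) by (metis carrier_vecD eq_vecI index_zero_vec)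
  ultimately show thesis using that by blast
qed

lemma power_times_exp_bounded:
  fixes e x :: real
  assumes "e > 0" "x \<ge> 0"
  shows "x ^ n * exp (- e * x) \<le> fact n / e ^ n"
proof -
  have s: "(\<lambda>k. (e * x) ^ k /\<^sub>R fact k) sums exp (e * x)" by (rule exp_converges)
  have "(\<Sum>k\<in>{n}. (e * x) ^ k /\<^sub>R fact k) \<le> (\<Sum>k. (e * x) ^ k /\<^sub>R fact k)"
    by (rule Series.sum_le_suminf) (use s assms in \<open>auto simp: sums_iff\<close>)
  then have "(\<Sum>k\<in>{n}. (e * x) ^ k /\<^sub>R fact k) \<le> exp (e * x)" using s by (simp add: sums_iff)
  then have "(e * x) ^ n / fact n \<le> exp (e * x)" by (simp add: divide_inverse mult.commute)
  then have "e ^ n * x ^ n \<le> fact n * exp (e * x)" by (simp add: power_mult_distrib field_simps)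
  then show ?thesis using assms by (simp add: exp_minus field_simps)
qed

section \<open>Solutions with unit boundary data\<close>

locale clamped_interval =
  fixes N :: nat and a b :: real
  assumes N: "N \<ge> 1" and ab: "a < b"
begin

definition anchor :: "nat \<Rightarrow> real" where
  "anchor j = (if j < N then a else b)"

text \<open>
  \<open>mode m j\<close> is the exponential solution \<open>exp (m \<theta> x)\<close>, normalised at its anchor. For the roots
  \<open>m\<close> of parameters in the right half-plane the first \<open>N\<close> exponentials decrease in modulus along the interval
  and the others increase, so the anchor is the end at which the modulus is largest.
\<close>

definition mode :: "complex \<Rightarrow> nat \<Rightarrow> real \<Rightarrow> complex" where
  "mode m j x = exp (m * theta N (j + 1) * of_real (x - anchor j))"

text \<open>
  The matrix of \<open>Delta_entry\<close> with its columns divided by the values of the exponentials at their anchors.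
  Row \<open>i\<close> stands for the derivative of order \<open>i\<close> at \<open>a\<close>, row \<open>N + i\<close> for the one at \<open>b\<close>.
\<close>

definition boundary_row :: "complex \<Rightarrow> nat \<Rightarrow> nat \<Rightarrow> complex" where
  "boundary_row m i j = theta N (j + 1) ^ (if i < N then i else i - N) * mode m j (if i < N then a else b)"

definition boundary_det :: "complex \<Rightarrow> complex" where
  "boundary_det m = det_of (2 * N) (boundary_row m)"

definition boundary_cofactor :: "complex \<Rightarrow> nat \<Rightarrow> nat \<Rightarrow> complex" where
  "boundary_cofactor m r j = det_of (2 * N) (\<lambda>i j'. if i = r then (if j'
      = j then 1 else 0) else boundary_row m i j')"

text \<open>
  Cramer's rule for the \<open>l\<close>-th derivative of the solution whose boundary datum number \<open>r\<close> is 1 and whose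
  other boundary data are 0. The final power of \<open>m\<close> compensates that the rows of the matrix omit the
  factors of \<open>m\<close> that differentiation produces.
\<close>

definition sol :: "nat \<Rightarrow> nat \<Rightarrow> complex \<Rightarrow> real \<Rightarrow> complex" where
  "sol r l z x = (let m = principal_root N z in
     (\<Sum>j<2 * N. boundary_cofactor m r j * (m * theta N (j + 1)) ^ l * mode m j x)
       / (boundary_det m * m ^ (if r < N then r else r - N)))"

lemma expand_row: "r < 2 * N \<Longrightarrow> det_of (2 * N) (\<lambda>i j. if i = r then v j else boundary_row m i j)
    = (\<Sum>j<2 * N. v j * boundary_cofactor m r j)"
  unfolding boundary_cofactor_def by (rule det_of_expand_row)

lemma mode_has_vector_derivative:
  "(mode m j has_vector_derivative m * theta N (j + 1) * mode m j x) (at x)"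
proof -
  have "((\<lambda>y. exp (m * theta N (j + 1) * (y - of_real (anchor j)))) has_field_derivative
      m * theta N (j + 1) * exp (m * theta N (j + 1) * (of_real x - of_real (anchor j)))) (at (of_real x))"
    by (auto intro!: derivative_eq_intros)
  from has_vector_derivative_real_field[OF this, of UNIV] show ?thesis
    unfolding mode_def[abs_def] by simp
qed

lemma combination_has_vector_derivative:
  "((\<lambda>x. \<Sum>j<2 * N. v j * (m * theta N (j + 1)) ^ l * mode m j x) has_vector_derivative
    (\<Sum>j<2 * N. v j * (m * theta N (j + 1)) ^ Suc l * mode m j x)) (at x)"
proof (rule has_vector_derivative_sum)
  fix j
  have "((\<lambda>x. v j * (m * theta N (j + 1)) ^ l * mode m j x) has_vector_derivative
      v j * (m * theta N (j + 1)) ^ l * (m * theta N (j + 1) * mode m j x)) (at x)"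
    by (intro has_vector_derivative_mult_right mode_has_vector_derivative)
  then show "((\<lambda>x. v j * (m * theta N (j + 1)) ^ l * mode m j x) has_vector_derivative
      v j * (m * theta N (j + 1)) ^ Suc l * mode m j x) (at x)"
    by (simp add: mult_ac)
qed

lemma combination_top:
  assumes "z \<noteq> 0"
  shows "(\<Sum>j<2 * N. v j * (principal_root N z * theta N (j + 1)) ^ (2 * N) * mode (principal_root N z) j x)
    = of_real (kappa N) * z * (\<Sum>j<2 * N. v j * (principal_root N z * theta N (j
      + 1)) ^ 0 * mode (principal_root N z) j x)"
  unfolding sum_distrib_left power_mult_distrib principal_root_power[OF N assms] theta_power_2N[OF N]
  by (intro sum.cong refl) (simp add: mult_ac)

lemma kappa_sq: "complex_of_real (kappa N) * of_real (kappa N) = 1"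
  unfolding kappa_def by (simp flip: power_add of_real_mult)

lemma kappa_cancel: "complex_of_real (kappa N) * (of_real (kappa N) * z * w) = z * w"
  by (metis kappa_sq mult.assoc mult_1)

lemma combination_at_boundary:
  assumes "i < 2 * N"
  shows "(\<Sum>j<2 * N. v j * (m * theta N (j
      + 1)) ^ (if i < N then i else i - N) * mode m j (if i < N then a else b))
     = m ^ (if i < N then i else i - N) * (\<Sum>j<2 * N. v j * boundary_row m i j)"
  unfolding boundary_row_def sum_distrib_left power_mult_distrib
    by (intro sum.cong refl) (simp add: mult_ac)

text \<open>
  A vector in the kernel is a combination of exponentials with zero boundary data, hence zero by
  uniqueness. All its derivatives at the midpoint vanish, which is a Vandermonde system for the
  coefficients.
\<close>

lemma boundary_det_nonzero:
  assumes z: "Re z > 0"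
  shows "boundary_det (principal_root N z) \<noteq> 0"
proof
  define m where "m = principal_root N z"
  assume "boundary_det (principal_root N z) = 0"
  then obtain v where v: "\<exists>j<2 * N. v j \<noteq> 0" and ker: "\<And>i. i < 2 * N
      \<Longrightarrow> (\<Sum>j<2 * N. v j * boundary_row m i j) = 0"
    unfolding boundary_det_def m_def[symmetric] by (rule det_of_eq_0D) blast
  define f where "f l x = (\<Sum>j<2 * N. v j * (m * theta N (j + 1)) ^ l * mode m j x)" for l x
  have D: "(f l has_vector_derivative f (Suc l) x) (at x)" for l x
    unfolding f_def by (rule combination_has_vector_derivative)
  have z0: "z \<noteq> 0" using z by auto
  have fa: "f l a = 0" "f l b = 0" if "l < N" for l
    using combination_at_boundary[where i = l and v = v and m = m] combination_at_boundary[where i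
      = "N + l" and v = v and m = m] ker[of l] ker[of "N + l"] that
    unfolding f_def by simp_all
  have cont: "isCont (f l) x" for l x using D has_vector_derivative_continuous by blast
  have f0: "f 0 x = 0" if x: "x \<in> {a<..<b}" for x
  proof (rule exit_bvp_unique[OF ab N z _ _ _ _ x])
    show "of_real (kappa N) * f (2 * N) y = z * f 0 y" for y
      unfolding f_def m_def combination_top[OF z0] by (rule kappa_cancel)
    show "(f l \<longlongrightarrow> 0) (at_right a)" if "l < N" for l
      using cont[of a l] fa(1)[OF that] unfolding isCont_def filterlim_at_split by simp
    show "(f l \<longlongrightarrow> 0) (at_left b)" if "l < N" for l
      using cont[of b l] fa(2)[OF that] unfolding isCont_def filterlim_at_split by simp
  qed (rule D)
  have fl: "\<forall>x\<in>{a<..<b}. f l x = 0" for l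
  proof (induction l)
    case (Suc l)
    show ?case
    proof
      fix x assume x: "x \<in> {a<..<b}"
      have "(f l has_vector_derivative 0) (at x)"
        by (rule has_vector_derivative_transform_within_open[of "\<lambda>_. 0" _ _ "{a<..<b}"]) (use x Suc in auto)
      then show "f (Suc l) x = 0" using D[of l x] vector_derivative_unique_at by blast
    qed
  qed (use f0 in auto)
  define x where "x = (a + b) / 2"
  have x: "x \<in> {a<..<b}" using ab unfolding x_def by auto
  have "v j * mode m j x = 0" if j: "j < 2 * N" for j
  proof (rule vandermonde_kernel_trivial[where J = "{..<2 * N}" and s = "\<lambda>j. m * theta N (j + 1)" and w
    = "\<lambda>j. v j * mode m j x"])
    show "inj_on (\<lambda>j. m * theta N (j + 1)) {..<2 * N}"
      using inj_on_theta[OF N] unfolding inj_on_def m_def by auto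
    show "(\<Sum>j<2 * N. v j * mode m j x * (m * theta N (j + 1)) ^ l) = 0" for l
      using fl[of l] x unfolding f_def by (auto simp: mult_ac)
  qed (use j in auto)
  then show False using v unfolding mode_def by auto
qed

text \<open>
  The decay that drives all estimates: a mode is small at distance \<open>d\<close> from its anchor.
\<close>

lemma norm_mode_le:
  assumes z: "Re z > 0" and x: "a \<le> x" "x \<le> b" and j: "j < 2 * N" and d: "d \<le> \<bar>x - anchor j\<bar>"
  shows "norm (mode (principal_root N z) j x)
      \<le> exp (- (sin (pi / (4 * real N)) * d) * norm (principal_root N z))"
proof -
  define m where "m = principal_root N z"
  define c where "c = sin (pi / (4 * real N))"
  have c0: "c \<ge> 0" unfolding c_def using N by (intro sin_ge_zero) (auto simp: field_simps)
  have "Re (m * theta N (j + 1) * of_real (x - anchor j)) \<le> - c * norm m * \<bar>x - anchor j\<bar>"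
  proof (cases "j < N")
    case True
    have "Re (m * theta N (j + 1)) * (x - a) \<le> (- c * norm m) * (x - a)"
      unfolding m_def c_def by (intro mult_right_mono Re_theta_principal_root_le N z True) (use x in auto)
    then show ?thesis using True x unfolding anchor_def by simp
  next
    case False
    have th: "theta N (j + 1) = - theta N (j - N + 1)"
      using theta_shift[OF N, of "j - N + 1"] False by simp
    have "Re (m * theta N (j - N + 1)) * (b - x) \<le> (- c * norm m) * (b - x)"
      unfolding m_def c_def by (intro mult_right_mono Re_theta_principal_root_le N z) (use x j in auto)
    moreover have "Re (m * theta N (j + 1) * of_real (x - b)) = Re (m * theta N (j - N + 1)) * (b - x)"
      unfolding th by (simp add: algebra_simps)
    ultimately show ?thesis using False x unfolding anchor_def by simp
  qed
  also have "\<dots> \<le> - c * norm m * d" using d c0 by (intro mult_left_mono_neg) (auto simp: mult_nonneg_nonneg)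
  finally show ?thesis
    unfolding mode_def m_def[symmetric] c_def[symmetric] norm_exp_eq_Re by (simp add: mult_ac)
qed

lemma norm_boundary_row_le:
  assumes "Re z > 0" "j < 2 * N"
  shows "norm (boundary_row (principal_root N z) i j) \<le> 1"
  using norm_mode_le[OF assms(1) _ _ assms(2), of "if i < N then a else b" 0] ab
  unfolding boundary_row_def by (simp add: norm_mult norm_power split: if_splits)

lemma norm_boundary_cofactor_le:
  assumes "Re z > 0" shows "norm (boundary_cofactor (principal_root N z) r j) \<le> fact (2 * N)"
  unfolding boundary_cofactor_def by (rule norm_det_of_le) (use norm_boundary_row_le[OF assms] in auto)

lemma mode_holomorphic: "(\<lambda>z. mode (principal_root N z) j x) holomorphic_on {z. Re z > 0}"
  unfolding mode_def by (intro holomorphic_intros principal_root_holomorphic N)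

lemma boundary_row_holomorphic: "(\<lambda>z. boundary_row (principal_root N z) i j) holomorphic_on {z. Re z > 0}"
  unfolding boundary_row_def by (intro holomorphic_intros mode_holomorphic)

lemma boundary_det_holomorphic: "(\<lambda>z. boundary_det (principal_root N z)) holomorphic_on {z. Re z > 0}"
  unfolding boundary_det_def by (intro det_of_holomorphic boundary_row_holomorphic)

lemma boundary_cofactor_holomorphic: "(\<lambda>z. boundary_cofactor (principal_root N z) r j)
    holomorphic_on {z. Re z > 0}"
  unfolding boundary_cofactor_def
proof (rule det_of_holomorphic)
  show "(\<lambda>z. if i = r then if j' = j then 1 else 0 else boundary_row (principal_root N z) i j')
      holomorphic_on {z. Re z > 0}" for i j'
    by (cases "i = r") (auto intro: boundary_row_holomorphic)
qed

section \<open>Lower bound for the determinant\<close>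

text \<open>
  The limit of the matrix of boundary conditions at infinity: the entries that couple a mode with
  the end opposite to its anchor are gone.
\<close>

definition limit_row :: "nat \<Rightarrow> nat \<Rightarrow> complex" where
  "limit_row i j = (if (i < N) = (j < N) then theta N (j + 1) ^ (if i < N then i else i - N) else 0)"

lemma limit_det_nonzero: "det_of (2 * N) limit_row \<noteq> 0"
proof
  assume "det_of (2 * N) limit_row = 0"
  then obtain v where v: "\<exists>j<2 * N. v j \<noteq> 0" and ker: "\<And>i. i < 2 * N \<Longrightarrow> (\<Sum>j<2 * N. v j * limit_row i j) = 0"
    by (rule det_of_eq_0D) blast
  have inj: "inj_on (\<lambda>j. theta N (j + 1)) J" if "J \<subseteq> {..<2 * N}" for J
    using inj_on_theta[OF N] that inj_on_subset by blast
  have "v j = 0" if j: "j < 2 * N" for j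
  proof (cases "j < N")
    case True
    show ?thesis
    proof (rule vandermonde_kernel_trivial[where J = "{..<N}" and s = "\<lambda>j. theta N (j + 1)"])
      fix l assume l: "l < card {..<N}"
      have "(\<Sum>j<2 * N. v j * limit_row l j) = (\<Sum>j<N. v j * theta N (j + 1) ^ l)"
        using l by (intro sum.mono_neutral_cong_right) (auto simp: limit_row_def)
      then show "(\<Sum>j<N. v j * theta N (j + 1) ^ l) = 0" using ker[of l] l by simp
    qed (use True inj[of "{..<N}"] in auto)
  next
    case False
    show ?thesis
    proof (rule vandermonde_kernel_trivial[where J = "{N..<2 * N}" and s = "\<lambda>j. theta N (j + 1)"])
      fix l assume l: "l < card {N..<2 * N}"
      have "(\<Sum>j<2 * N. v j * limit_row (N + l) j) = (\<Sum>j\<in>{N..<2 * N}. v j * theta N (j + 1) ^ l)"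
        using l by (intro sum.mono_neutral_cong_right) (auto simp: limit_row_def)
      then show "(\<Sum>j\<in>{N..<2 * N}. v j * theta N (j + 1) ^ l) = 0" using ker[of "N + l"] l by simp
    next
      show "inj_on (\<lambda>j. theta N (j + 1)) {N..<2 * N}" by (rule inj) auto
    qed (use False j in auto)
  qed
  then show False using v by auto
qed

lemma filterlim_norm_principal_root: "filterlim (\<lambda>z. norm (principal_root N z)) at_top (inf at_infinity
    (principal {z. Re z > 0}))"
proof -
  have "\<forall>\<^sub>F z in inf at_infinity (principal {z. Re z > 0}). Z < norm (principal_root N z)" for Z
    unfolding eventually_inf_principal eventually_at_infinity
  proof (intro exI[of _ "max Z 1 ^ (2 * N) + 1"] allI impI)
    fix z :: complex assume z: "max Z 1 ^ (2 * N) + 1 \<le> norm z" "z \<in> {z. Re z > 0}"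
    then have "z \<noteq> 0" by auto
    then have "max Z 1 ^ (2 * N) < norm (principal_root N z) ^ (2 * N)"
      using z(1) norm_principal_root_power[OF N] by simp
    then have "max Z 1 < norm (principal_root N z)" by (rule power_less_imp_less_base) simp
    then show "Z < norm (principal_root N z)" by simp
  qed
  then show ?thesis unfolding filterlim_at_top_dense by blast
qed

lemma boundary_det_tendsto:
  "((\<lambda>z. boundary_det (principal_root N z))
      \<longlongrightarrow> det_of (2 * N) limit_row) (inf at_infinity (principal {z. Re z > 0}))"
  unfolding boundary_det_def
proof (rule det_of_tendsto)
  fix i j assume ij: "i < 2 * N" "j < 2 * N"
  let ?F = "inf at_infinity (principal {z. Re z > 0})"
  define c where "c = sin (pi / (4 * real N))"
  have "pi / (4 * real N) < pi" using N by (simp add: field_simps)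
  then have c0: "c > 0" unfolding c_def using N by (intro sin_gt_zero) auto
  show "((\<lambda>z. boundary_row (principal_root N z) i j) \<longlongrightarrow> limit_row i j) ?F"
  proof (cases "(i < N) = (j < N)")
    case True
    then have "boundary_row m i j = limit_row i j" for m
      unfolding boundary_row_def limit_row_def mode_def anchor_def by auto
    then show ?thesis by simp
  next
    case False
    have "filterlim (\<lambda>z. - (c * (b - a)) * norm (principal_root N z)) at_bot ?F"
      by (rule filterlim_tendsto_neg_mult_at_bot[OF tendsto_const _ filterlim_norm_principal_root])
        (use c0 ab in auto)
    then have lim: "((\<lambda>z. exp (- (c * (b - a)) * norm (principal_root N z))) \<longlongrightarrow> 0) ?F"
      by (rule filterlim_compose[OF exp_at_bot])
    have "((\<lambda>z. boundary_row (principal_root N z) i j) \<longlongrightarrow> 0) ?F"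
    proof (rule Lim_null_comparison[OF _ lim])
      show "\<forall>\<^sub>F z in ?F. norm (boundary_row (principal_root N z) i j)
          \<le> exp (- (c * (b - a)) * norm (principal_root N z))"
        unfolding eventually_inf_principal
      proof (intro always_eventually allI impI)
        fix z :: complex assume "z \<in> {z. Re z > 0}"
        then have "norm (mode (principal_root N z) j (if i < N then a else b))
            \<le> exp (- (c * (b - a)) * norm (principal_root N z))"
          unfolding c_def by (intro norm_mode_le) (use ab ij False in \<open>auto simp: anchor_def\<close>)
        then show "norm (boundary_row (principal_root N z) i j)
            \<le> exp (- (c * (b - a)) * norm (principal_root N z))"
          unfolding boundary_row_def by (simp add: norm_mult norm_power)
      qed
    qed
    then show ?thesis using False unfolding limit_row_def by simp
  qed
qed

text \<open>
  Far away the determinant is close to its nonzero limit; on the remaining compact part of the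
  half-plane it is continuous and has no zero.
\<close>

lemma boundary_det_bounded_below:
  assumes g: "g > 0"
  shows "\<exists>d>0. \<forall>z. Re z \<ge> g \<longrightarrow> d \<le> norm (boundary_det (principal_root N z))"
proof -
  define L where "L = norm (det_of (2 * N) limit_row)"
  have L: "L > 0" unfolding L_def using limit_det_nonzero by simp
  have "\<forall>\<^sub>F z in inf at_infinity (principal {z. Re z > 0}). norm (boundary_det (principal_root N z)) > L /
      2"
    by (rule order_tendstoD(1)[OF tendsto_norm[OF boundary_det_tendsto]]) (use L in \<open>simp add: L_def\<close>)
  then obtain R where R: "\<And>z. norm z \<ge> R \<Longrightarrow> Re z > 0 \<Longrightarrow> norm (boundary_det (principal_root N z)) > L / 2"
    unfolding eventually_inf_principal eventually_at_infinity by auto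
  define K where "K = {z. Re z \<ge> g} \<inter> cball 0 (max R g)"
  have K: "compact K" unfolding K_def by (intro closed_Int_compact closed_halfspace_Re_ge compact_cball)
  have Kne: "of_real g \<in> K" unfolding K_def using g by auto
  have cont: "continuous_on K (\<lambda>z. norm (boundary_det (principal_root N z)))"
    by (intro continuous_on_norm continuous_on_subset[OF holomorphic_on_imp_continuous_on[OF
      boundary_det_holomorphic]])
       (use g in \<open>auto simp: K_def\<close>)
  obtain z0 where z0: "z0 \<in> K" "\<And>z. z \<in> K
      \<Longrightarrow> norm (boundary_det (principal_root N z0)) \<le> norm (boundary_det (principal_root N z))"
    using continuous_attains_inf[OF K _ cont] Kne by blast
  have pos: "norm (boundary_det (principal_root N z0)) > 0"
    using boundary_det_nonzero[of z0] z0(1) g unfolding K_def by auto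
  show ?thesis
  proof (intro exI[of _ "min (L / 2) (norm (boundary_det (principal_root N z0)))"] conjI allI impI)
    fix z assume z: "Re z \<ge> g"
    show "min (L / 2) (norm (boundary_det (principal_root N z0)))
        \<le> norm (boundary_det (principal_root N z))"
    proof (cases "norm z \<ge> R")
      case True
      then show ?thesis using R[of z] z g by (intro min.coboundedI1) auto
    next
      case False
      then show ?thesis using z0(2)[of z] z unfolding K_def by (intro min.coboundedI2) auto
    qed
  qed (use L pos in auto)
qed

section \<open>Holomorphy, boundary values and decay of the unit solutions\<close>

lemma sol_holomorphic: "(\<lambda>z. sol r l z x) holomorphic_on {z. Re z > 0}"
  unfolding sol_def Let_def
  by (intro holomorphic_on_divide holomorphic_on_sum holomorphic_on_mult holomorphic_on_power
    holomorphic_on_const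
        boundary_cofactor_holomorphic boundary_det_holomorphic mode_holomorphic principal_root_holomorphic
          N)
     (simp add: boundary_det_nonzero)

lemma sol_has_vector_derivative: "(sol r l z has_vector_derivative sol r (Suc l) z x) (at x)"
  unfolding sol_def[abs_def] Let_def divide_inverse
  by (rule has_vector_derivative_mult_left, rule combination_has_vector_derivative)

lemma sol_heat:
  assumes "Re z > 0" shows "z * sol r 0 z x = of_real (kappa N) * sol r (2 * N) z x"
proof -
  have z0: "z \<noteq> 0" using assms by auto
  have "sol r (2 * N) z x = of_real (kappa N) * z * sol r 0 z x"
    unfolding sol_def Let_def combination_top[OF z0] by simp
  then show ?thesis by (simp only: kappa_cancel)
qed

text \<open>
  Inserting row \<open>i\<close> of the matrix into the place of row \<open>r\<close> gives the matrix itself or one with two equal rows.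
\<close>

lemma sol_boundary:
  assumes z: "Re z > 0" and r: "r < 2 * N" and i: "i < 2 * N"
  shows "sol r (if i < N then i else i - N) z (if i < N then a else b) = (if i = r then 1 else 0)"
proof -
  define m where "m = principal_root N z"
  have "(\<Sum>j<2 * N. boundary_cofactor m r j * boundary_row m i j) = det_of (2 * N) (\<lambda>i' j. if i'
      = r then boundary_row m i j else boundary_row m i' j)"
    unfolding expand_row[OF r] by (simp add: mult.commute)
  also have "\<dots> = (if i = r then boundary_det m else 0)"
    using det_of_repeated_row[OF r i, of "boundary_row m"] unfolding boundary_det_def
    by (auto intro!: det_of_cong)
  finally have s: "(\<Sum>j<2 * N. boundary_cofactor m r j * boundary_row m i j) = (if i
      = r then boundary_det m else 0)" .
  show ?thesis
    unfolding sol_def Let_def m_def[symmetric] combination_at_boundary[OF i] s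
    using boundary_det_nonzero[OF z] by (simp add: m_def)
qed

text \<open>
  The cofactors are bounded, the determinant is bounded below, and the modes decay exponentially in
  \<open>|\<mu>| = |z|\<^sup>1\<^sup>/\<^sup>2\<^sup>N\<close> on compact subintervals; \<open>|\<mu>|\<^sup>6\<^sup>N = |z|\<^sup>3\<close>.
\<close>

lemma sol_decay:
  assumes g: "g > 0" and cd: "a < c" "d < b"
  shows "\<exists>C. \<forall>z y. Re z \<ge> g \<longrightarrow> y \<in> {c..d} \<longrightarrow> norm (sol r l z y) \<le> C / norm z ^ 3"
proof -
  obtain e where e: "e > 0" "\<And>z. Re z \<ge> g \<Longrightarrow> e \<le> norm (boundary_det (principal_root N z))"
    using boundary_det_bounded_below[OF g] by auto
  define k where "k = (if r < N then r else r - N)"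
  define q where "q = sin (pi / (4 * real N)) * min (c - a) (b - d)"
  have "pi / (4 * real N) < pi" using N by (simp add: field_simps)
  then have "sin (pi / (4 * real N)) > 0" using N by (intro sin_gt_zero) auto
  then have q: "q > 0" unfolding q_def using cd by simp
  define m0 where "m0 = exp (ln g / (2 * real N))"
  define C where "C = real (2 * N) * (fact (2 * N) * (fact (l + 6 * N) / q ^ (l + 6 * N))) / (e * m0 ^ k)"
  have "norm (sol r l z y) \<le> C / norm z ^ 3" if z: "Re z \<ge> g" and y: "y \<in> {c..d}" for z y
  proof -
    define m where "m = principal_root N z"
    have z0: "Re z > 0" "z \<noteq> 0" using z g by auto
    have m: "norm m > 0" unfolding m_def by simp
    have mz: "norm m ^ (6 * N) = norm z ^ 3"
    proof -
      have "norm m ^ (6 * N) = (norm m ^ (2 * N)) ^ 3" unfolding power_mult[symmetric]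
        by (simp add: mult.commute)
      then show ?thesis using norm_principal_root_power[OF N z0(2)] unfolding m_def by simp
    qed
    have "g \<le> norm z" using z complex_Re_le_cmod[of z] by linarith
    then have "ln g \<le> Re (Ln z)" using g z0 by (simp add: Re_Ln)
    then have m0: "m0 \<le> norm m" unfolding m0_def m_def norm_principal_root by (simp add: divide_right_mono)
    have summand: "norm (boundary_cofactor m r j * (m * theta N (j + 1)) ^ l * mode m j y)
        \<le> fact (2 * N) * (fact (l + 6 * N) / q ^ (l + 6 * N)) / norm z ^ 3" if j: "j < 2 * N" for j
    proof -
      have "norm (mode m j y) \<le> exp (- q * norm m)"
        unfolding m_def q_def by (rule norm_mode_le[OF z0(1) _ _ j]) (use y cd in \<open>auto simp: anchor_def\<close>)
      then have "norm (boundary_cofactor m r j * (m * theta N (j + 1)) ^ l * mode m j y)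
          \<le> fact (2 * N) * norm m ^ l * exp (- q * norm m)"
        using norm_boundary_cofactor_le[OF z0(1), of r j]
        by (auto simp: norm_mult norm_power m_def intro!: mult_mono)
      also have "\<dots> = fact (2 * N) * (norm m ^ (l + 6 * N) * exp (- q * norm m)) / norm z ^ 3"
        using m unfolding mz[symmetric] by (simp add: power_add)
      also have "\<dots> \<le> fact (2 * N) * (fact (l + 6 * N) / q ^ (l + 6 * N)) / norm z ^ 3"
        by (intro divide_right_mono mult_left_mono power_times_exp_bounded q) auto
      finally show ?thesis .
    qed
    have "norm (\<Sum>j<2 * N. boundary_cofactor m r j * (m * theta N (j + 1)) ^ l * mode m j y)
        \<le> (\<Sum>j<2 * N. fact (2 * N) * (fact (l + 6 * N) / q ^ (l + 6 * N)) / norm z ^ 3)"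
      by (rule sum_norm_le) (use summand in auto)
    also have "\<dots> = real (2 * N) * (fact (2 * N) * (fact (l + 6 * N) / q ^ (l + 6 * N))) / norm z ^ 3"
      by simp
    finally have num: "norm (\<Sum>j<2 * N. boundary_cofactor m r j * (m * theta N (j + 1)) ^ l * mode m j y)
        \<le> real (2 * N) * (fact (2 * N) * (fact (l + 6 * N) / q ^ (l + 6 * N))) / norm z ^ 3" .
    have den: "e * m0 ^ k \<le> norm (boundary_det m * m ^ k)"
      unfolding norm_mult norm_power using e(2)[OF z] m0 e(1)
      by (intro mult_mono power_mono) (auto simp: m_def m0_def)
    have "norm (sol r l z y) \<le> (real (2 * N) * (fact (2 * N) * (fact (l + 6 * N) / q ^ (l
        + 6 * N))) / norm z ^ 3) / (e * m0 ^ k)"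
      unfolding sol_def Let_def m_def[symmetric] k_def[symmetric] norm_divide
      by (rule frac_le[OF _ num _ den]) (use q e in \<open>auto simp: m0_def\<close>)
    also have "\<dots> = C / norm z ^ 3" unfolding C_def by simp
    finally show ?thesis .
  qed
  then show ?thesis by blast
qed

text \<open>
  The normalisation multiplies numerator and denominator by the same product of exponentials.
\<close>

lemma Delta_ratio:
  assumes lam: "lam > 0" and r: "r < 2 * N"
  shows "of_real (lam powr (- (real (if r < N then r else r - N) / (2 * real N))))
      * (Delta_row r N a b lam x / Delta N a b lam)
    = sol r 0 (of_real lam) x"
proof -
  define k where "k = (if r < N then r else r - N)"
  define m where "m = principal_root N (of_real lam)"
  have m: "m = of_real (lam powr (1 / (2 * real N)))" unfolding m_def
    by (rule principal_root_of_real[OF lam])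
  define d where "d j = exp (m * theta N (j + 1) * of_real (anchor j))" for j
  have e: "e_pow N lam (theta N (j + 1) * of_real y) = mode m j y * d j" for j y
    unfolding e_pow_def d_def mode_def m[symmetric] exp_add[symmetric] by (simp add: algebra_simps)
  have entry: "Delta_entry N a b lam (i, j) = boundary_row m i j * d j" for i j
    unfolding Delta_entry_def boundary_row_def using e by (simp add: mult_ac)
  have D: "Delta N a b lam = (\<Prod>j<2 * N. d j) * boundary_det m"
  proof -
    have "Delta N a b lam = det_of (2 * N) (\<lambda>i j. Delta_entry N a b lam (i, j))"
      unfolding Delta_def det_of_def by (simp add: case_prod_beta')
    then show ?thesis unfolding entry det_of_scale_columns boundary_det_def .
  qed
  have Dr: "Delta_row r N a b lam x = (\<Prod>j<2 * N. d j) * (\<Sum>j<2 * N. mode m j x * boundary_cofactor m r j)"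
  proof -
    have "Delta_row r N a b lam x = det_of (2 * N) (\<lambda>i j. (if i
        = r then mode m j x else boundary_row m i j) * d j)"
      unfolding Delta_row_def det_of_def entry e by (simp add: if_distrib if_distribR cong: if_cong)
    then show ?thesis unfolding det_of_scale_columns expand_row[OF r] .
  qed
  have d0: "(\<Prod>j<2 * N. d j) \<noteq> 0" unfolding d_def by simp
  have "lam powr (- (real k / (2 * real N))) = inverse ((lam powr (1 / (2 * real N))) ^ k)"
  proof -
    have "(lam powr (1 / (2 * real N))) ^ k = lam powr (real k / (2 * real N))"
      using lam by (simp add: powr_realpow[symmetric] powr_powr)
    then show ?thesis by (simp add: powr_minus)
  qed
  then have p: "of_real (lam powr (- (real k / (2 * real N)))) = inverse (m ^ k)" unfolding m by simp
  show ?thesis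
    unfolding k_def[symmetric] p D Dr sol_def Let_def m_def[symmetric] using d0
    by (simp add: field_simps)
qed

section \<open>The exit densities\<close>

lemma sol_tower: "laplace_tower (sol r) a b"
  by unfold_locales (use sol_holomorphic sol_decay sol_has_vector_derivative in auto)

text \<open>
  For \<open>k < N\<close>, index \<open>k\<close> belongs to the end \<open>a\<close> and index \<open>N + k\<close> to the end \<open>b\<close>.
\<close>

definition exit_kernel :: "nat \<Rightarrow> real \<Rightarrow> real \<Rightarrow> real" where
  "exit_kernel r = laplace_tower.original (sol r) 0"

lemma sol_tendsto:
  assumes z: "Re z > 0" and r: "r < 2 * N" and l: "l < N"
  shows "(sol r l z \<longlongrightarrow> (if l = r then 1 else 0)) (at_right a)"
    and "(sol r l z \<longlongrightarrow> (if N + l = r then 1 else 0)) (at_left b)"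
proof -
  have cont: "isCont (sol r l z) x" for x
    using sol_has_vector_derivative has_vector_derivative_continuous by blast
  show "(sol r l z \<longlongrightarrow> (if l = r then 1 else 0)) (at_right a)"
    using cont[of a] sol_boundary[OF z r, of l] l unfolding isCont_def filterlim_at_split by simp
  show "(sol r l z \<longlongrightarrow> (if N + l = r then 1 else 0)) (at_left b)"
    using cont[of b] sol_boundary[OF z r, of "N + l"] l unfolding isCont_def filterlim_at_split by simp
qed

lemma exit_kernel_solves:
  assumes r: "r < 2 * N"
  shows "solves_evolution_bvp N a b (\<lambda>l. if l = r then 1 else 0) (\<lambda>l. if N + l
      = r then 1 else 0) (exit_kernel r)"
  unfolding exit_kernel_def
proof (rule laplace_tower.original_solves_evolution_bvp[OF sol_tower])
  show "z * sol r 0 z y = of_real (kappa N) * sol r (2 * N) z y" if "Re z > 0" for z y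
    by (rule sol_heat[OF that])
  fix l lam assume l: "l < N" and lam: "(lam::real) > 0"
  have z: "Re (of_real lam) > 0" using lam by simp
  show "((\<lambda>y. Re (sol r l (of_real lam) y)) \<longlongrightarrow> (if l = r then 1 else 0)) (at_right a)"
    using tendsto_Re[OF sol_tendsto(1)[OF z r l]] by (simp split: if_splits)
  show "((\<lambda>y. Re (sol r l (of_real lam) y)) \<longlongrightarrow> (if N + l = r then 1 else 0)) (at_left b)"
    using tendsto_Re[OF sol_tendsto(2)[OF z r l]] by (simp split: if_splits)
qed (rule ab)

lemma exit_kernel_characterized_by_bvp:
  assumes r: "r < 2 * N"
  shows "characterized_by_bvp N a b (\<lambda>l. if l = r then 1 else 0) (\<lambda>l. if N + l
      = r then 1 else 0) (exit_kernel r)"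
  unfolding characterized_by_bvp_def
  using exit_kernel_solves[OF r] evolution_bvp_unique[OF N ab exit_kernel_solves[OF r]] by blast

text \<open>
  For a real parameter the imaginary part solves the problem with zero boundary data.
\<close>

lemma sol_real:
  assumes r: "r < 2 * N" and lam: "lam > 0" and x: "x \<in> {a<..<b}"
  shows "Im (sol r 0 (of_real lam) x) = 0"
proof -
  have z: "Re (of_real lam) > 0" using lam by simp
  define f where "f l y = complex_of_real (Im (sol r l (of_real lam) y))" for l y
  have "f 0 x = 0"
  proof (rule exit_bvp_unique[OF ab N z _ _ _ _ x])
    show "(f j has_vector_derivative f (Suc j) y) (at y)" for j y
      unfolding f_def
      by (intro bounded_linear.has_vector_derivative[OF bounded_linear_of_real]
          bounded_linear.has_vector_derivative[OF bounded_linear_Im] sol_has_vector_derivative)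
    show "of_real (kappa N) * f (2 * N) y = of_real lam * f 0 y" for y
      using arg_cong[OF sol_heat[OF z, of r y], of Im] unfolding f_def by (simp flip: of_real_mult)
    fix l assume l: "l < N"
    have "(f l \<longlongrightarrow> of_real (Im (if l = r then 1 else 0))) (at_right a)"
      unfolding f_def by (intro tendsto_of_real tendsto_Im sol_tendsto z r l)
    then show "(f l \<longlongrightarrow> 0) (at_right a)" by (simp split: if_splits)
    have "(f l \<longlongrightarrow> of_real (Im (if N + l = r then 1 else 0))) (at_left b)"
      unfolding f_def by (intro tendsto_of_real tendsto_Im sol_tendsto z r l)
    then show "(f l \<longlongrightarrow> 0) (at_left b)" by (simp split: if_splits)
  qed
  then show ?thesis unfolding f_def by simp
qed

lemma exit_kernel_laplace:
  assumes x: "x \<in> {a<..<b}" and lam: "lam > 0"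
  shows "set_integrable lborel {0<..} (\<lambda>t. exp (- lam * t) * exit_kernel r t x)"
    and "(LINT t:{0<..}|lborel. exp (- lam * t) * exit_kernel r t x) = Re (sol r 0 (of_real lam) x)"
  unfolding exit_kernel_def by (rule laplace_tower.original_laplace[OF sol_tower x lam])+

lemma exit_kernel_characterized_by_laplace:
  assumes r: "r < 2 * N" and x: "x \<in> {a<..<b}"
  shows "characterized_by_laplace (\<lambda>t. exit_kernel r t x)
    (\<lambda>lam. of_real (lam powr (- (real (if r < N then r else r - N) / (2 * real N))))
      * (Delta_row r N a b lam x / Delta N a b lam))"
    (is "characterized_by_laplace ?f ?F")
  unfolding characterized_by_laplace_def
proof (intro conjI allI impI)
  have F: "?F lam = of_real (Re (sol r 0 (of_real lam) x))" if "lam > 0" for lam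
    unfolding Delta_ratio[OF that r] using sol_real[OF r that x] by (simp add: complex_eq_iff)
  show cont: "continuous_on {0<..} ?f"
  proof (rule continuous_at_imp_continuous_on, rule ballI)
    fix t :: real assume "t \<in> {0<..}"
    then have "(?f has_real_derivative kappa N * (deriv ^^ (2 * N)) (exit_kernel r t) x) (at t)"
      using exit_kernel_solves[OF r] x unfolding solves_evolution_bvp_def by simp
    then show "isCont ?f t" by (rule DERIV_isCont)
  qed
  show "has_laplace_transform ?f ?F"
    unfolding has_laplace_transform_def
  proof (intro allI impI conjI)
    fix lam :: real assume lam: "lam > 0"
    show "set_integrable lborel {0<..} (\<lambda>t. exit_kernel r t x * exp (- lam * t))"
      using exit_kernel_laplace(1)[OF x lam] by (simp only: mult.commute)
    show "of_real (LINT t:{0<..}|lborel. exit_kernel r t x * exp (- lam * t)) = ?F lam"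
      unfolding F[OF lam] exit_kernel_laplace(2)[OF x lam, of r, symmetric] by (simp only: mult.commute)
  qed
  fix g t assume g: "continuous_on {0<..} g \<and> has_laplace_transform g ?F" and t: "t > (0::real)"
  show "g t = exit_kernel r t x"
  proof (rule laplace_transform_inject[where c = 0 and g = ?f, OF _ cont _ _ _ t])
    fix lam :: real assume lam: "lam > 0"
    have gi: "set_integrable lborel {0<..} (\<lambda>t. g t * exp (- lam * t))"
      and gv: "of_real (LINT t:{0<..}|lborel. g t * exp (- lam * t)) = ?F lam"
      using g lam unfolding has_laplace_transform_def by blast+
    show "set_integrable lborel {0<..} (\<lambda>t. exp (- lam * t) * g t)"
      using gi by (simp only: mult.commute)
    show "set_integrable lborel {0<..} (\<lambda>t. exp (- lam * t) * exit_kernel r t x)"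
      by (rule exit_kernel_laplace(1)[OF x lam])
    have "(LINT t:{0<..}|lborel. g t * exp (- lam * t)) = Re (sol r 0 (of_real lam) x)"
      using gv unfolding F[OF lam] by (simp only: of_real_eq_iff)
    then show "(LINT t:{0<..}|lborel. exp (- lam * t) * g t)
        = (LINT t:{0<..}|lborel. exp (- lam * t) * exit_kernel r t x)"
      unfolding exit_kernel_laplace(2)[OF x lam] by (simp only: mult.commute)
  qed (use g in auto)
qed

text \<open>
  The difference of both sides solves the problem with zero boundary data.
\<close>

lemma exit_bvp_solution_eq:
  assumes \<Phi>: "solves_exit_bvp N a b lam \<phi> \<Phi>" and lam: "lam > 0" and x: "x \<in> {a<..<b}"
  shows "\<Phi> x = (\<Sum>r<2 * N. (if r < N then (deriv ^^ r) \<phi> a else (deriv ^^ (r - N)) \<phi> b)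
      * Re (sol r 0 (of_real lam) x))"
proof -
  define c where "c r = (if r < N then (deriv ^^ r) \<phi> a else (deriv ^^ (r - N)) \<phi> b)" for r
  have z: "Re (of_real lam) > 0" using lam by simp
  define f where "f l y = complex_of_real ((deriv ^^ l) \<Phi> y) - (\<Sum>r<2 * N. of_real (c r)
      * sol r l (of_real lam) y)" for l y
  have "f 0 x = 0"
  proof (rule exit_bvp_unique[OF ab N z _ _ _ _ x])
    fix j y assume j: "j < 2 * N" and y: "y \<in> {a<..<b}"
    have "((deriv ^^ j) \<Phi> has_vector_derivative (deriv ^^ Suc j) \<Phi> y) (at y)"
      unfolding has_real_derivative_iff_has_vector_derivative[symmetric]
      by (rule times_differentiable_on_derivD[OF _ j y]) (use \<Phi> in \<open>auto simp: solves_exit_bvp_def\<close>)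
    then show "(f j has_vector_derivative f (Suc j) y) (at y)"
      unfolding f_def
      by (intro has_vector_derivative_diff has_vector_derivative_sum has_vector_derivative_mult_right
          sol_has_vector_derivative bounded_linear.has_vector_derivative[OF bounded_linear_of_real])
  next
    fix y assume y: "y \<in> {a<..<b}"
    have "kappa N * (deriv ^^ (2 * N)) \<Phi> y = lam * (deriv ^^ 0) \<Phi> y"
      using \<Phi> y unfolding solves_exit_bvp_def by simp
    then have 1: "of_real (kappa N) * complex_of_real ((deriv ^^ (2 * N)) \<Phi> y)
        = of_real lam * of_real ((deriv ^^ 0) \<Phi> y)"
      by (simp only: of_real_mult[symmetric])
    have 2: "of_real (kappa N) * (of_real (c r) * sol r (2 * N) (of_real lam) y)
        = of_real lam * (of_real (c r) * sol r 0 (of_real lam) y)" for r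
      using sol_heat[OF z, of r y] by (metis mult.left_commute)
    then show "of_real (kappa N) * f (2 * N) y = of_real lam * f 0 y"
      unfolding f_def right_diff_distrib 1 sum_distrib_left by (simp only: 2)
  next
    fix l assume l: "l < N"
    have pick: "(\<Sum>r<2 * N. of_real (c r) * (if i = r then 1 else 0))
        = complex_of_real (c i)" if "i < 2 * N" for i
      using that by (simp add: if_distrib sum.delta' cong: if_cong)
    have "(f l \<longlongrightarrow> of_real ((deriv ^^ l) \<phi> a) - (\<Sum>r<2 * N. of_real (c r) * (if l
        = r then 1 else 0))) (at_right a)"
      unfolding f_def
      by (intro tendsto_diff tendsto_of_real tendsto_sum tendsto_mult tendsto_const sol_tendsto z l)
         (use \<Phi> l in \<open>auto simp: solves_exit_bvp_def\<close>)
    then show "(f l \<longlongrightarrow> 0) (at_right a)" by (subst (asm) pick) (use l in \<open>auto simp: c_def\<close>)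
    have "(f l \<longlongrightarrow> of_real ((deriv ^^ l) \<phi> b) - (\<Sum>r<2 * N. of_real (c r) * (if N + l
        = r then 1 else 0))) (at_left b)"
      unfolding f_def
      by (intro tendsto_diff tendsto_of_real tendsto_sum tendsto_mult tendsto_const sol_tendsto z l)
         (use \<Phi> l in \<open>auto simp: solves_exit_bvp_def\<close>)
    then show "(f l \<longlongrightarrow> 0) (at_left b)" by (subst (asm) pick) (use l in \<open>auto simp: c_def\<close>)
  qed
  then have "complex_of_real (\<Phi> x) = (\<Sum>r<2 * N. of_real (c r) * sol r 0 (of_real lam) x)"
    unfolding f_def by simp
  from arg_cong[OF this, of Re] show ?thesis unfolding c_def by simp
qed

text \<open>
  The signs of the density and of the derivatives of the Dirac masses cancel, so the pairing is the
  combination of \<open>exit_bvp_solution_eq\<close>.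
\<close>

lemma exit_kernel_joint_law:
  assumes FK: "feynman_kac_heuristic N p a b" and x: "x \<in> {a<..<b}"
  shows "joint_exit_law N p a b x
    (\<lambda>t \<phi>. (\<Sum>k<N. (-1) ^ k * exit_kernel k t x * dirac_deriv k a \<phi>)
         + (\<Sum>k<N. (-1) ^ k * exit_kernel (N + k) t x * dirac_deriv k b \<phi>))"
  unfolding joint_exit_law_def
proof (intro allI impI)
  fix lam :: real and \<phi> assume lam: "lam > 0" and adm: "admissible N \<phi>"
  define c where "c r = (if r < N then (deriv ^^ r) \<phi> a else (deriv ^^ (r - N)) \<phi> b)" for r
  have split: "(\<Sum>r<N + m. g r) = (\<Sum>k<N. g k) + (\<Sum>k<m. g (N + k))" for g :: "nat \<Rightarrow> real" and m
    by (induction m) (simp_all add: add.assoc)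
  have one: "(-1) ^ k * y * ((-1) ^ k * w) = w * y" for k and y w :: real
  proof -
    have "(-1) ^ k * y * ((-1) ^ k * w) = ((-1) ^ k * (-1) ^ k) * (w * y)" by (simp only: mult_ac)
    then show ?thesis by (simp flip: power_add)
  qed
  have D: "(\<Sum>k<N. (-1) ^ k * exit_kernel k t x * dirac_deriv k a \<phi>)
      + (\<Sum>k<N. (-1) ^ k * exit_kernel (N + k) t x * dirac_deriv k b \<phi>)
        = (\<Sum>r<2 * N. c r * exit_kernel r t x)" for t
    using split[of "\<lambda>r. c r * exit_kernel r t x" N] unfolding dirac_deriv_def one c_def mult_2 by simp
  have e: "indicator {0<..} t *\<^sub>R (exp (- lam * t) * (\<Sum>r<2 * N. c r * exit_kernel r t x))
      = (\<Sum>r<2 * N. c r * (indicator {0<..} t *\<^sub>R (exp (- lam * t) * exit_kernel r t x)))" for t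
    by (simp only: real_scaleR_def sum_distrib_left mult_ac)
  have int: "integrable lborel (\<lambda>t. c r * (indicator {0<..} t
      *\<^sub>R (exp (- lam * t) * exit_kernel r t x)))" for r
    by (rule integrable_mult_right, rule exit_kernel_laplace(1)[OF x lam, unfolded set_integrable_def])
  have val: "(LINT t|lborel. c r * (indicator {0<..} t *\<^sub>R (exp (- lam * t) * exit_kernel r t x)))
      = c r * Re (sol r 0 (of_real lam) x)" for r
    unfolding exit_kernel_laplace(2)[OF x lam, unfolded set_lebesgue_integral_def, symmetric]
      by (rule integral_mult_right_zero)
  have "solves_exit_bvp N a b lam \<phi> (FK p a b lam \<phi>)"
    using FK lam adm unfolding feynman_kac_heuristic_def by simp
  from exit_bvp_solution_eq[OF this lam x]
  have "FK p a b lam \<phi> x = (\<Sum>r<2 * N. c r * Re (sol r 0 (of_real lam) x))" unfolding c_def .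
  then show "set_integrable lborel {0<..} (\<lambda>t. exp (- lam * t) *
        ((\<Sum>k<N. (-1) ^ k * exit_kernel k t x * dirac_deriv k a \<phi>)
         + (\<Sum>k<N. (-1) ^ k * exit_kernel (N + k) t x * dirac_deriv k b \<phi>))) \<and>
      (LINT t:{0<..}|lborel. exp (- lam * t) *
        ((\<Sum>k<N. (-1) ^ k * exit_kernel k t x * dirac_deriv k a \<phi>)
         + (\<Sum>k<N. (-1) ^ k * exit_kernel (N + k) t x * dirac_deriv k b \<phi>))) = FK p a b lam \<phi> x"
    unfolding D set_integrable_def set_lebesgue_integral_def e
    using int val by (simp only: Bochner_Integration.integrable_sum Bochner_Integration.integral_sum)
qed

end

section \<open>The joint law of exit time and exit position\<close>

theorem theorem2:
  fixes N :: nat and a b :: real and p :: "real \<Rightarrow> real \<Rightarrow> real"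
  assumes "N \<ge> 2" and "a < b"
    and "pseudo_kernel N p"
    and "feynman_kac_heuristic N p a b"
  shows "\<exists>I_minus I_plus :: nat \<Rightarrow> real \<Rightarrow> real \<Rightarrow> real.
     (\<forall>x\<in>{a<..<b}. joint_exit_law N p a b x
        (\<lambda>t \<phi>. (\<Sum>k<N. (-1) ^ k * I_minus k t x * dirac_deriv k a \<phi>)
              + (\<Sum>k<N. (-1) ^ k * I_plus k t x * dirac_deriv k b \<phi>))) \<and>
     (\<forall>k<N. \<forall>x\<in>{a<..<b}.
        characterized_by_laplace (\<lambda>t. I_minus k t x)
          (\<lambda>lam. of_real (lam powr (- (real k / (2 * real N))))
                  * (Delta_minus k N a b lam x / Delta N a b lam)) \<and>
        characterized_by_laplace (\<lambda>t. I_plus k t x)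
          (\<lambda>lam. of_real (lam powr (- (real k / (2 * real N))))
                  * (Delta_plus k N a b lam x / Delta N a b lam))) \<and>
     (\<forall>k<N.
        characterized_by_bvp N a b (kronecker k) (\<lambda>l. 0) (I_minus k) \<and>
        characterized_by_bvp N a b (\<lambda>l. 0) (kronecker k) (I_plus k))"
proof -
  interpret clamped_interval N a b by unfold_locales (use assms in auto)
  have bvp_cong: "characterized_by_bvp N a b \<alpha> \<beta> u \<Longrightarrow> (\<And>l. l < N \<Longrightarrow> \<alpha> l = \<alpha>' l) \<Longrightarrow> (\<And>l. l < N \<Longrightarrow> \<beta> l = \<beta>' l)
      \<Longrightarrow> characterized_by_bvp N a b \<alpha>' \<beta>' u" for \<alpha> \<beta> \<alpha>' \<beta>' u
    unfolding characterized_by_bvp_def solves_evolution_bvp_def by simp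
  show ?thesis
  proof (rule exI[of _ exit_kernel], rule exI[of _ "\<lambda>k. exit_kernel (N + k)"], intro conjI ballI allI impI)
    fix x assume x: "x \<in> {a<..<b}"
    show "joint_exit_law N p a b x
        (\<lambda>t \<phi>. (\<Sum>k<N. (-1) ^ k * exit_kernel k t x * dirac_deriv k a \<phi>)
              + (\<Sum>k<N. (-1) ^ k * exit_kernel (N + k) t x * dirac_deriv k b \<phi>))"
      by (rule exit_kernel_joint_law[OF assms(4) x])
  next
    fix k x assume k: "k < N" and x: "x \<in> {a<..<b}"
    show "characterized_by_laplace (\<lambda>t. exit_kernel k t x)
          (\<lambda>lam. of_real (lam powr (- (real k / (2 * real N))))
                  * (Delta_minus k N a b lam x / Delta N a b lam))"
      using exit_kernel_characterized_by_laplace[of k x] k x unfolding Delta_minus_def by simp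
    show "characterized_by_laplace (\<lambda>t. exit_kernel (N + k) t x)
          (\<lambda>lam. of_real (lam powr (- (real k / (2 * real N))))
                  * (Delta_plus k N a b lam x / Delta N a b lam))"
      using exit_kernel_characterized_by_laplace[of "N + k" x] k x unfolding Delta_plus_def by simp
  next
    fix k assume k: "k < N"
    show "characterized_by_bvp N a b (kronecker k) (\<lambda>l. 0) (exit_kernel k)"
      by (rule bvp_cong[OF exit_kernel_characterized_by_bvp]) (use k in \<open>auto simp: kronecker_def\<close>)
    show "characterized_by_bvp N a b (\<lambda>l. 0) (kronecker k) (exit_kernel (N + k))"
      by (rule bvp_cong[OF exit_kernel_characterized_by_bvp]) (use k in \<open>auto simp: kronecker_def\<close>)
  qed
qed

end
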